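(* Let $\Omega,\Omega_1,\Omega_2$ be minimal aperiodic tiling spaces in $\mathbb{R}^d$, with or without finite local complexity (FLC). Let $h_i:\Omega\to\Omega_i$ ($i=1,2$) be surjective continuous maps which preserve orbits (send $\mathbb{R}^d$-orbits into $\mathbb{R}^d$-orbits), and such that $h_1$ is an orbit equivalence. If $[h_1]_w=[h_2]_w$, then there exists a factor map $\phi:\Omega_1\to\Omega_2$ such that $h_2$ is homotopic to $\phi\circ h_1$. If the spaces have FLC and $[h_1]_s=[h_2]_s$, then $\phi$ can be chosen to be a local derivation.
   Context: **Tiling spaces.** A tile is a convex polytope in $\mathbb{R}^d$ with non-empty interior, possibly carrying a label in a compact metric space; the set of prototiles (tiles up to translation) is compact. A tiling is a collection of tiles covering $\mathbb{R}^d$, any two of which meet only along their boundaries. A Delone set is a uniformly discrete and relatively dense subset of $\mathbb{R}^d$, possibly labelled. Tilings and labelled Delone sets are used interchangeably. $\mathbb{R}^d$ acts by translation, $T\mapsto T-x$. The patch $T\cap B(x,R)$ is the set of labelled tiles meeting $B(x,R)$ (for Delone sets: labelled points in $B(x,R)$). Two tilings (Delone sets) are $\varepsilon$-close if on a ball of radius about $1/\varepsilon$ around the origin there is a one-to-one correspondence between their tiles (points), corresponding tiles being $\varepsilon$-close in Hausdorff distance (points being $\varepsilon$-close) with $\varepsilon$-close labels. A tiling space is a compact translation-invariant set of tilings (or labelled Delone sets). It is minimal if every $\mathbb{R}^d$-orbit is dense, aperiodic if $T-x=T$ implies $x=0$ for each of its elements, FLC if for each $R$ there are finitely many patches of radius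 $R$ up to translation. **Maps.** An orbit equivalence is a homeomorphism sending orbits to orbits. A factor map is a continuous onto map $\phi$ with $\phi(T-x)=\phi(T)-x$. A local derivation between FLC tiling spaces is a factor map such that for all $r>0$ there is $R>0$ with: $T\cap B(0,R)=T'\cap B(0,R)$ implies $\phi(T)\cap B(0,r)=\phi(T')\cap B(0,r)$. **Weak class.** A weak 1-cocycle is a continuous $\alpha:\Omega\times\mathbb{R}^d\to\mathbb{R}^d$ with $\alpha(T,x)+\alpha(T-x,y)=\alpha(T,x+y)$; it is a weak coboundary if $\alpha(T,v)=s(T-v)-s(T)$ with $s:\Omega\to\mathbb{R}^d$ continuous. $H^1_w(\Omega;\mathbb{R}^d)$ is the quotient. For a continuous map $f:\Omega\to\Omega'$ sending orbits into orbits, $f(T-v)=f(T)-f_T(v)$ defines a cocycle $\alpha(T,v)=f_T(v)$, and $[f]_w:=[\alpha]\in H^1_w(\Omega;\mathbb{R}^d)$. **Strong class (FLC case).** The canonical transversal of a space of Delone sets is the set of its elements containing the origin; an FLC transversal of $\Omega$ is $\mathcal{D}^{-1}(\Xi')$, where $\mathcal{D}:\Omega\to\Omega_0$ is a local derivation to a space of Delone sets with canonical transversal $\Xi'$. A function on $\Omega$ is transversally locally constant if its restriction to every FLC transversal is locally constant. A strong 1-cocycle is a weak 1-cocycle $\alpha$ with $\alpha(\cdot,v)$ transversally locally constant for each $v$; a strong coboundary is $\alpha(T,v)=s(T-v)-s(T)$ with $s$ continuous and transversally locally constant. The quotient $H^1_s(\Omega;\mathbb{R}^d)$ is canonically isomorphic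 to $\check H^1(\Omega;\mathbb{R}^d)$: on an open flow box $U=\{S-x: S\in\Xi, |x|<\varepsilon\}$ ($\Xi$ an FLC transversal) put $c_U(S-x)=\alpha(S,x)$; the differences $c_U-c_V$ on overlaps are locally constant and form the Čech cocycle. The fundamental shape class $[\mathcal{F}(\Omega)]$ is the class of $\mathcal{F}(T,v)=v$. For a continuous map $f:\Omega\to\Omega'$ of FLC tiling spaces, $[f]_s:=f^*[\mathcal{F}(\Omega')]$, with $f^*$ the pullback in Čech cohomology. *)

theory Defs
  imports "HOL-Analysis.Analysis"
begin

section \<open>The Hausdorff distance\<close>

text \<open>The value on empty or unbounded sets is a convention: it makes the distance total and
  nonnegative, as the locale \<^locale>\<open>Metric_space\<close> requires outside the carrier.\<close>

definition hausdorff_dist :: "'v::metric_space set \<Rightarrow> 'v set \<Rightarrow> real" where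
  "hausdorff_dist A B =
     (if A \<noteq> {} \<and> B \<noteq> {} \<and> bounded A \<and> bounded B
      then max (SUP a\<in>A. infdist a B) (SUP b\<in>B. infdist b A) else 0)"

lemma hausdorff_dist_commute: "hausdorff_dist A B = hausdorff_dist B A"
  by (auto simp: hausdorff_dist_def max.commute)

lemma hausdorff_dist_singleton [simp]: "hausdorff_dist {p} {q} = dist p q"
  by (simp add: hausdorff_dist_def dist_commute)

lemma bounded_infdist_bdd_above:
  assumes "bounded A"
  shows "bdd_above ((\<lambda>a. infdist a B) ` A)"
proof -
  obtain x e where e: "\<And>a. a \<in> A \<Longrightarrow> dist x a \<le> e"
    using assms unfolding bounded_def by auto
  have "infdist a B \<le> infdist x B + e" if "a \<in> A" for a
    using infdist_triangle[of a B x] e[OF that] by (simp add: dist_commute)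
  then show ?thesis by (auto intro!: bdd_aboveI)
qed

lemma infdist_le_hausdorff_dist:
  assumes "bounded A" "bounded B" "B \<noteq> {}" "a \<in> A"
  shows "infdist a B \<le> hausdorff_dist A B"
proof -
  have "infdist a B \<le> (SUP a\<in>A. infdist a B)"
    using assms(4) bounded_infdist_bdd_above[OF assms(1)] by (rule cSUP_upper)
  with assms show ?thesis
    by (auto simp: hausdorff_dist_def le_max_iff_disj)
qed

lemma hausdorff_dist_nonneg [simp]: "0 \<le> hausdorff_dist A B"
proof (cases "A \<noteq> {} \<and> B \<noteq> {} \<and> bounded A \<and> bounded B")
  case True
  then obtain a where "a \<in> A" by auto
  with True show ?thesis
    using infdist_le_hausdorff_dist[of A B a] infdist_nonneg[of a B] by auto
qed (auto simp: hausdorff_dist_def)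

lemma infdist_SUP_triangle:
  assumes "compact A" "compact B" "compact C" "A \<noteq> {}" "B \<noteq> {}" "C \<noteq> {}"
  shows "(SUP a\<in>A. infdist a C) \<le> hausdorff_dist A B + hausdorff_dist B C"
proof (rule cSUP_least[OF assms(4)])
  fix a assume a: "a \<in> A"
  have "continuous_on B (dist a)"
    by (intro continuous_intros)
  then obtain b where b: "b \<in> B" "\<And>y. y \<in> B \<Longrightarrow> dist a b \<le> dist a y"
    using continuous_attains_inf[OF assms(2,5)] by blast
  have "dist a b \<le> infdist a B"
    using assms(5) b(2) by (auto simp: infdist_notempty intro: cINF_greatest)
  have "infdist a C \<le> infdist b C + dist a b"
    by (rule infdist_triangle)
  moreover have "dist a b \<le> hausdorff_dist A B"
    using infdist_le_hausdorff_dist[of A B a] a assms \<open>dist a b \<le> infdist a B\<close>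
    by (simp add: compact_imp_bounded)
  moreover have "infdist b C \<le> hausdorff_dist B C"
    using infdist_le_hausdorff_dist[of B C b] b(1) assms by (simp add: compact_imp_bounded)
  ultimately show "infdist a C \<le> hausdorff_dist A B + hausdorff_dist B C" by simp
qed

lemma hausdorff_dist_eq_0_subset:
  assumes "compact A" "compact B" "B \<noteq> {}" "hausdorff_dist A B = 0"
  shows "A \<subseteq> B"
proof
  fix a assume a: "a \<in> A"
  have "infdist a B \<le> 0"
    using infdist_le_hausdorff_dist[of A B a] a assms by (auto simp: compact_imp_bounded)
  then show "a \<in> B"
    using in_closed_iff_infdist_zero[OF compact_imp_closed[OF assms(2)] assms(3)]
      infdist_nonneg[of a B] by force
qed

lemma hausdorff_dist_self [simp]: "hausdorff_dist A A = 0"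
  by (simp add: hausdorff_dist_def)

lemma Metric_space_hausdorff:
  "Metric_space {A. compact A \<and> A \<noteq> {}} hausdorff_dist"
proof
  fix A B C :: "'a set"
  show "0 \<le> hausdorff_dist A B" by simp
  show "hausdorff_dist A B = hausdorff_dist B A" by (rule hausdorff_dist_commute)
  assume A: "A \<in> {A. compact A \<and> A \<noteq> {}}" and B: "B \<in> {A. compact A \<and> A \<noteq> {}}"
  show "hausdorff_dist A B = 0 \<longleftrightarrow> A = B"
    using A B hausdorff_dist_eq_0_subset[of A B] hausdorff_dist_eq_0_subset[of B A]
      hausdorff_dist_commute[of A B] by auto
  assume C: "C \<in> {A. compact A \<and> A \<noteq> {}}"
  show "hausdorff_dist A C \<le> hausdorff_dist A B + hausdorff_dist B C"
    using infdist_SUP_triangle[of A B C] infdist_SUP_triangle[of C B A] A B C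
    by (simp add: hausdorff_dist_def[of A C] compact_imp_bounded
        hausdorff_dist_commute[of B A] hausdorff_dist_commute[of C B])
qed

abbreviation hausdorff_topology :: "'v::metric_space set topology" where
  "hausdorff_topology \<equiv> Metric_space.mtopology {A. compact A \<and> A \<noteq> {}} hausdorff_dist"


section \<open>Tilings and labelled Delone sets\<close>

text \<open>A labelled tile is a pair of a set and a label. Labelled Delone sets are treated on the
  same footing: the point \<open>p\<close> with label \<open>l\<close> is encoded as the degenerate tile \<open>({p}, l)\<close>.
  The patch, the topology and the translation action then have one definition for both, since
  the Hausdorff distance of \<open>{p}\<close> and \<open>{q}\<close> is the distance of \<open>p\<close> and \<open>q\<close>, and \<open>{p}\<close> meets
  a ball iff \<open>p\<close> lies in it. The unlabelled case is the case of a constant label.\<close>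

type_synonym ('d, 'l) tile = "(real^'d) set \<times> 'l"
type_synonym ('d, 'l) tiling = "('d, 'l) tile set"

definition translate_tile :: "('d::finite, 'l) tile \<Rightarrow> real^'d \<Rightarrow> ('d, 'l) tile" where
  "translate_tile t x = ((\<lambda>a. a - x) ` fst t, snd t)"

definition translate :: "('d::finite, 'l) tiling \<Rightarrow> real^'d \<Rightarrow> ('d, 'l) tiling"
    (infixl \<open>\<ominus>\<close> 65) where
  "T \<ominus> x = (\<lambda>t. translate_tile t x) ` T"

definition orbit :: "('d::finite, 'l) tiling \<Rightarrow> ('d, 'l) tiling set" where
  "orbit T = range (translate T)"

definition prototile_set :: "('d::finite, 'l::metric_space) tile set \<Rightarrow> bool" where
  "prototile_set P \<longleftrightarrow>
     (\<forall>(A, l)\<in>P. polytope A \<and> interior A \<noteq> {}) \<and>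
     compactin (prod_topology hausdorff_topology euclidean) P"

definition is_tiling :: "('d::finite, 'l) tile set \<Rightarrow> ('d, 'l) tiling \<Rightarrow> bool" where
  "is_tiling P T \<longleftrightarrow>
     (\<forall>t\<in>T. \<exists>p\<in>P. \<exists>x. t = translate_tile p x) \<and>
     (\<Union>t\<in>T. fst t) = UNIV \<and>
     (\<forall>t\<in>T. \<forall>u\<in>T. t \<noteq> u \<longrightarrow> fst t \<inter> fst u \<subseteq> frontier (fst t) \<inter> frontier (fst u))"

definition is_delone :: "'l set \<Rightarrow> ('d::finite, 'l) tiling \<Rightarrow> bool" where
  "is_delone L T \<longleftrightarrow>
     (\<forall>t\<in>T. (\<exists>p. fst t = {p}) \<and> snd t \<in> L) \<and>
     (\<exists>r>0. \<forall>p l q m. ({p}, l) \<in> T \<and> ({q}, m) \<in> T \<and> ({p}, l) \<noteq> ({q}, m) \<longrightarrow> r \<le> dist p q) \<and>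
     (\<exists>R>0. \<forall>x. \<exists>p l. ({p}, l) \<in> T \<and> dist x p \<le> R)"

definition patch :: "('d::finite, 'l) tiling \<Rightarrow> real^'d \<Rightarrow> real \<Rightarrow> ('d, 'l) tiling" where
  "patch T x R = {t \<in> T. fst t \<inter> ball x R \<noteq> {}}"

text \<open>The correspondence \<open>b\<close> is required to be defined on all tiles of \<open>T\<close>, and to reach all tiles
  of \<open>T'\<close>, that meet the ball of radius \<open>1/\<epsilon>\<close>; partners of such tiles may miss that ball.\<close>

definition eps_close :: "real \<Rightarrow> ('d::finite, 'l::metric_space) tiling \<Rightarrow> ('d, 'l) tiling \<Rightarrow> bool" where
  "eps_close \<epsilon> T T' \<longleftrightarrow>
     (\<exists>b Q Q'. patch T 0 (1/\<epsilon>) \<subseteq> Q \<and> Q \<subseteq> T \<and> patch T' 0 (1/\<epsilon>) \<subseteq> Q' \<and> Q' \<subseteq> T' \<and>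
        bij_betw b Q Q' \<and>
        (\<forall>t\<in>Q. hausdorff_dist (fst t) (fst (b t)) < \<epsilon> \<and> dist (snd t) (snd (b t)) < \<epsilon>))"

lemma eps_close_mono:
  assumes "eps_close \<delta> T T'" "0 < \<delta>" "\<delta> \<le> \<epsilon>"
  shows "eps_close \<epsilon> T T'"
proof -
  have "1/\<epsilon> \<le> 1/\<delta>" using assms by (simp add: frac_le)
  then have "patch S 0 (1/\<epsilon>) \<subseteq> patch S 0 (1/\<delta>)" for S :: "('a, 'b) tiling"
    using subset_ball[of "1/\<epsilon>" "1/\<delta>"] unfolding patch_def by blast
  note sub = this
  obtain b Q Q' where b: "patch T 0 (1/\<delta>) \<subseteq> Q" "Q \<subseteq> T" "patch T' 0 (1/\<delta>) \<subseteq> Q'"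
    "Q' \<subseteq> T'" "bij_betw b Q Q'"
    "\<forall>t\<in>Q. hausdorff_dist (fst t) (fst (b t)) < \<delta> \<and> dist (snd t) (snd (b t)) < \<delta>"
    using assms(1) unfolding eps_close_def by blast
  have "\<forall>t\<in>Q. hausdorff_dist (fst t) (fst (b t)) < \<epsilon> \<and> dist (snd t) (snd (b t)) < \<epsilon>"
    using b(6) assms(3) by fastforce
  then show ?thesis
    unfolding eps_close_def
    using b(2,4,5) subset_trans[OF sub b(1)] subset_trans[OF sub b(3)]
    by (intro exI[of _ b] exI[of _ Q] exI[of _ Q'] conjI)
qed

definition tiling_topology :: "('d::finite, 'l::metric_space) tiling set \<Rightarrow> ('d, 'l) tiling topology" where
  "tiling_topology \<Omega> =
     topology (\<lambda>U. U \<subseteq> \<Omega> \<and> (\<forall>T\<in>U. \<exists>\<epsilon>>0. \<forall>T'\<in>\<Omega>. eps_close \<epsilon> T T' \<longrightarrow> T' \<in> U))"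

lemma openin_tiling_topology:
  "openin (tiling_topology \<Omega>) U \<longleftrightarrow>
     U \<subseteq> \<Omega> \<and> (\<forall>T\<in>U. \<exists>\<epsilon>>0. \<forall>T'\<in>\<Omega>. eps_close \<epsilon> T T' \<longrightarrow> T' \<in> U)"
proof -
  have "istopology (\<lambda>U. U \<subseteq> \<Omega> \<and> (\<forall>T\<in>U. \<exists>\<epsilon>>0. \<forall>T'\<in>\<Omega>. eps_close \<epsilon> T T' \<longrightarrow> T' \<in> U))"
    (is "istopology ?P")
    unfolding istopology_def
  proof (intro conjI allI impI)
    fix S S' assume S: "?P S" and S': "?P S'"
    show "S \<inter> S' \<subseteq> \<Omega>" using S by blast
    show "\<forall>T\<in>S \<inter> S'. \<exists>\<epsilon>>0. \<forall>T'\<in>\<Omega>. eps_close \<epsilon> T T' \<longrightarrow> T' \<in> S \<inter> S'"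
    proof
      fix T assume "T \<in> S \<inter> S'"
      then obtain e e' where e: "e > 0" "\<forall>T'\<in>\<Omega>. eps_close e T T' \<longrightarrow> T' \<in> S"
        and e': "e' > 0" "\<forall>T'\<in>\<Omega>. eps_close e' T T' \<longrightarrow> T' \<in> S'"
        using S S' by blast
      have "\<forall>T'\<in>\<Omega>. eps_close (min e e') T T' \<longrightarrow> T' \<in> S \<inter> S'"
      proof (intro ballI impI)
        fix T' assume T': "T' \<in> \<Omega>" and close: "eps_close (min e e') T T'"
        have "eps_close e T T'" "eps_close e' T T'"
          by (rule eps_close_mono[OF close]; use e(1) e'(1) in simp)+
        then show "T' \<in> S \<inter> S'" using e(2) e'(2) T' by blast
      qed
      moreover have "min e e' > 0" using e(1) e'(1) by simp
      ultimately show "\<exists>\<epsilon>>0. \<forall>T'\<in>\<Omega>. eps_close \<epsilon> T T' \<longrightarrow> T' \<in> S \<inter> S'"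
        by blast
    qed
  next
    fix \<K> assume "\<forall>K\<in>\<K>. ?P K"
    note \<K> = this
    show "\<Union>\<K> \<subseteq> \<Omega>" using \<K> by blast
    show "\<forall>T\<in>\<Union>\<K>. \<exists>\<epsilon>>0. \<forall>T'\<in>\<Omega>. eps_close \<epsilon> T T' \<longrightarrow> T' \<in> \<Union>\<K>"
    proof
      fix T assume "T \<in> \<Union>\<K>"
      then obtain K where K: "K \<in> \<K>" "T \<in> K" by blast
      then obtain \<epsilon> where "\<epsilon> > 0" "\<forall>T'\<in>\<Omega>. eps_close \<epsilon> T T' \<longrightarrow> T' \<in> K"
        using \<K> by blast
      with K show "\<exists>\<epsilon>>0. \<forall>T'\<in>\<Omega>. eps_close \<epsilon> T T' \<longrightarrow> T' \<in> \<Union>\<K>" by blast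
    qed
  qed
  then show ?thesis unfolding tiling_topology_def by (rule fun_cong[OF topology_inverse'])
qed

lemma topspace_tiling_topology [simp]: "topspace (tiling_topology \<Omega>) = \<Omega>"
proof -
  have "openin (tiling_topology \<Omega>) \<Omega>"
    unfolding openin_tiling_topology by (auto intro: exI[of _ 1])
  then have "\<Omega> \<subseteq> topspace (tiling_topology \<Omega>)"
    by (rule openin_subset)
  moreover have "topspace (tiling_topology \<Omega>) \<subseteq> \<Omega>"
    using openin_topspace[of "tiling_topology \<Omega>"] unfolding openin_tiling_topology by (rule conjunct1)
  ultimately show ?thesis by (rule subset_antisym[rotated])
qed

definition translation_compact :: "('d::finite, 'l::metric_space) tiling set \<Rightarrow> bool" where
  "translation_compact \<Omega> \<longleftrightarrow>
     (\<forall>T\<in>\<Omega>. \<forall>x. T \<ominus> x \<in> \<Omega>) \<and> compact_space (tiling_topology \<Omega>)"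

definition delone_space :: "('d::finite, 'l::metric_space) tiling set \<Rightarrow> bool" where
  "delone_space \<Omega> \<longleftrightarrow>
     (\<exists>L. compact L \<and> (\<forall>T\<in>\<Omega>. is_delone L T)) \<and> translation_compact \<Omega>"

definition tiling_space :: "('d::finite, 'l::metric_space) tiling set \<Rightarrow> bool" where
  "tiling_space \<Omega> \<longleftrightarrow>
     (\<exists>P. prototile_set P \<and> (\<forall>T\<in>\<Omega>. is_tiling P T)) \<and> translation_compact \<Omega> \<or>
     delone_space \<Omega>"

definition minimal_space :: "('d::finite, 'l::metric_space) tiling set \<Rightarrow> bool" where
  "minimal_space \<Omega> \<longleftrightarrow> (\<forall>T\<in>\<Omega>. tiling_topology \<Omega> closure_of orbit T = \<Omega>)"

definition aperiodic :: "('d::finite, 'l) tiling set \<Rightarrow> bool" where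
  "aperiodic \<Omega> \<longleftrightarrow> (\<forall>T\<in>\<Omega>. \<forall>x. T \<ominus> x = T \<longrightarrow> x = 0)"

definition FLC :: "('d::finite, 'l) tiling set \<Rightarrow> bool" where
  "FLC \<Omega> \<longleftrightarrow>
     (\<forall>R. \<exists>F. finite F \<and> (\<forall>T\<in>\<Omega>. \<forall>x. \<exists>Q\<in>F. \<exists>y. patch T x R = Q \<ominus> y))"


section \<open>Maps between tiling spaces\<close>

definition preserves_orbits ::
    "('d::finite, 'l) tiling set \<Rightarrow> (('d, 'l) tiling \<Rightarrow> ('d, 'm) tiling) \<Rightarrow> bool" where
  "preserves_orbits \<Omega> f \<longleftrightarrow> (\<forall>T\<in>\<Omega>. f ` orbit T \<subseteq> orbit (f T))"

definition orbit_equivalence ::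
    "('d::finite, 'l::metric_space) tiling set \<Rightarrow> ('d, 'm::metric_space) tiling set \<Rightarrow>
     (('d, 'l) tiling \<Rightarrow> ('d, 'm) tiling) \<Rightarrow> bool" where
  "orbit_equivalence \<Omega> \<Omega>' f \<longleftrightarrow>
     homeomorphic_map (tiling_topology \<Omega>) (tiling_topology \<Omega>') f \<and>
     (\<forall>T\<in>\<Omega>. f ` orbit T = orbit (f T))"

definition factor_map ::
    "('d::finite, 'l::metric_space) tiling set \<Rightarrow> ('d, 'm::metric_space) tiling set \<Rightarrow>
     (('d, 'l) tiling \<Rightarrow> ('d, 'm) tiling) \<Rightarrow> bool" where
  "factor_map \<Omega> \<Omega>' \<phi> \<longleftrightarrow>
     continuous_map (tiling_topology \<Omega>) (tiling_topology \<Omega>') \<phi> \<and> \<phi> ` \<Omega> = \<Omega>' \<and>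
     (\<forall>T\<in>\<Omega>. \<forall>x. \<phi> (T \<ominus> x) = \<phi> T \<ominus> x)"

definition local_derivation ::
    "('d::finite, 'l::metric_space) tiling set \<Rightarrow> ('d, 'm::metric_space) tiling set \<Rightarrow>
     (('d, 'l) tiling \<Rightarrow> ('d, 'm) tiling) \<Rightarrow> bool" where
  "local_derivation \<Omega> \<Omega>' \<phi> \<longleftrightarrow>
     FLC \<Omega> \<and> FLC \<Omega>' \<and> factor_map \<Omega> \<Omega>' \<phi> \<and>
     (\<forall>r>0. \<exists>R>0. \<forall>T\<in>\<Omega>. \<forall>T'\<in>\<Omega>. patch T 0 R = patch T' 0 R \<longrightarrow>
        patch (\<phi> T) 0 r = patch (\<phi> T') 0 r)"


section \<open>The weak class\<close>

definition weak_cocycle ::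
    "('d::finite, 'l::metric_space) tiling set \<Rightarrow> (('d, 'l) tiling \<Rightarrow> real^'d \<Rightarrow> real^'d) \<Rightarrow> bool" where
  "weak_cocycle \<Omega> \<alpha> \<longleftrightarrow>
     continuous_map (prod_topology (tiling_topology \<Omega>) euclidean) euclidean (\<lambda>(T, v). \<alpha> T v) \<and>
     (\<forall>T\<in>\<Omega>. \<forall>x y. \<alpha> T x + \<alpha> (T \<ominus> x) y = \<alpha> T (x + y))"

definition weak_coboundary ::
    "('d::finite, 'l::metric_space) tiling set \<Rightarrow> (('d, 'l) tiling \<Rightarrow> real^'d \<Rightarrow> real^'d) \<Rightarrow> bool" where
  "weak_coboundary \<Omega> \<alpha> \<longleftrightarrow>
     (\<exists>s. continuous_map (tiling_topology \<Omega>) euclidean s \<and>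
          (\<forall>T\<in>\<Omega>. \<forall>v. \<alpha> T v = s (T \<ominus> v) - s T))"

text \<open>The coset of \<open>\<alpha>\<close> in \<open>H\<^sup>1\<^sub>w(\<Omega>; \<real>\<^sup>d)\<close>.\<close>

definition weak_class ::
    "('d::finite, 'l::metric_space) tiling set \<Rightarrow> (('d, 'l) tiling \<Rightarrow> real^'d \<Rightarrow> real^'d) \<Rightarrow>
     (('d, 'l) tiling \<Rightarrow> real^'d \<Rightarrow> real^'d) set" where
  "weak_class \<Omega> \<alpha> = {\<beta>. weak_cocycle \<Omega> \<beta> \<and> weak_coboundary \<Omega> (\<lambda>T v. \<beta> T v - \<alpha> T v)}"

text \<open>\<open>displacement f T v\<close> is \<open>f\<^sub>T(v)\<close>; it is uniquely determined when \<open>f\<close> preserves orbits and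
  its target is aperiodic.\<close>

definition displacement ::
    "(('d::finite, 'l) tiling \<Rightarrow> ('d, 'm) tiling) \<Rightarrow> ('d, 'l) tiling \<Rightarrow> real^'d \<Rightarrow> real^'d" where
  "displacement f T v = (THE w. f (T \<ominus> v) = f T \<ominus> w)"

definition weak_class_of_map ::
    "('d::finite, 'l::metric_space) tiling set \<Rightarrow> (('d, 'l) tiling \<Rightarrow> ('d, 'm) tiling) \<Rightarrow>
     (('d, 'l) tiling \<Rightarrow> real^'d \<Rightarrow> real^'d) set" where
  "weak_class_of_map \<Omega> f = weak_class \<Omega> (displacement f)"


section \<open>First Cech cohomology with constant coefficients\<close>

text \<open>A cocycle is a triple of an index set, an open cover and a family of locally constant
  functions on the pairwise overlaps.\<close>

type_synonym ('i, 'a, 'v) cech = "'i set \<times> ('i \<Rightarrow> 'a set) \<times> ('i \<Rightarrow> 'i \<Rightarrow> 'a \<Rightarrow> 'v)"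

definition locally_constant_on :: "'a topology \<Rightarrow> 'a set \<Rightarrow> ('a \<Rightarrow> 'v) \<Rightarrow> bool" where
  "locally_constant_on X S f \<longleftrightarrow>
     (\<forall>x\<in>S. \<exists>N. openin X N \<and> x \<in> N \<and> f constant_on (N \<inter> S))"

definition open_cover :: "'a topology \<Rightarrow> 'i set \<Rightarrow> ('i \<Rightarrow> 'a set) \<Rightarrow> bool" where
  "open_cover X I U \<longleftrightarrow> (\<forall>i\<in>I. openin X (U i)) \<and> (\<Union>i\<in>I. U i) = topspace X"

definition cech_cocycle :: "'a topology \<Rightarrow> ('i, 'a, 'v::ab_group_add) cech \<Rightarrow> bool" where
  "cech_cocycle X = (\<lambda>(I, U, g).
     open_cover X I U \<and>
     (\<forall>i\<in>I. \<forall>j\<in>I. locally_constant_on X (U i \<inter> U j) (g i j)) \<and>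
     (\<forall>i\<in>I. \<forall>j\<in>I. \<forall>k\<in>I. \<forall>x\<in>U i \<inter> U j \<inter> U k. g i j x + g j k x = g i k x))"

text \<open>Two cocycles have the same image in the direct limit over all open covers iff they become
  cohomologous on a common refinement. Refinements indexed by points of the space suffice: from
  any cover choose one member around each point.\<close>

definition cech_cohomologous ::
    "'a topology \<Rightarrow> ('i, 'a, 'v::ab_group_add) cech \<Rightarrow> ('j, 'a, 'v) cech \<Rightarrow> bool" where
  "cech_cohomologous X = (\<lambda>(I, U, g) (J, V, h).
     \<exists>(K :: 'a set) W r s b.
       open_cover X K W \<and>
       (\<forall>k\<in>K. r k \<in> I \<and> W k \<subseteq> U (r k) \<and> s k \<in> J \<and> W k \<subseteq> V (s k) \<and>
               locally_constant_on X (W k) (b k)) \<and>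
       (\<forall>k\<in>K. \<forall>l\<in>K. \<forall>x\<in>W k \<inter> W l.
           g (r k) (r l) x - h (s k) (s l) x = b k x - b l x))"

text \<open>The class of a cocycle in the first Cech cohomology group. For the same reason, every class
  is represented on a cover indexed by points, and classes are taken to consist of these.\<close>

definition cech_class ::
    "'a topology \<Rightarrow> ('i, 'a, 'v::ab_group_add) cech \<Rightarrow> ('a, 'a, 'v) cech set" where
  "cech_class X z = {z'. cech_cocycle X z' \<and> cech_cohomologous X z z'}"

definition cech_pull_cocycle ::
    "'a topology \<Rightarrow> ('a \<Rightarrow> 'b) \<Rightarrow> ('i, 'b, 'v) cech \<Rightarrow> ('i, 'a, 'v) cech" where
  "cech_pull_cocycle X f = (\<lambda>(I, U, g).
     (I, \<lambda>i. {x \<in> topspace X. f x \<in> U i}, \<lambda>i j x. g i j (f x)))"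

text \<open>The map \<open>f\<^sup>*\<close> on classes; all representatives \<open>z\<close> contribute the same class to the union.\<close>

definition cech_pullback ::
    "'a topology \<Rightarrow> ('a \<Rightarrow> 'b) \<Rightarrow> ('b, 'b, 'v::ab_group_add) cech set \<Rightarrow> ('a, 'a, 'v) cech set" where
  "cech_pullback X f c = (\<Union>z\<in>c. cech_class X (cech_pull_cocycle X f z))"


section \<open>The strong class\<close>

definition canonical_transversal :: "('d::finite, 'l) tiling set \<Rightarrow> ('d, 'l) tiling set" where
  "canonical_transversal \<Omega> = {T \<in> \<Omega>. \<exists>l. ({0}, l) \<in> T}"

text \<open>The target of a local derivation has FLC, hence only finitely many labels, so real labels
  are no restriction on the Delone sets.\<close>

definition FLC_transversal ::
    "('d::finite, 'l::metric_space) tiling set \<Rightarrow> ('d, 'l) tiling set \<Rightarrow> bool" where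
  "FLC_transversal \<Omega> \<Xi> \<longleftrightarrow>
     (\<exists>(\<Omega>\<^sub>0 :: ('d, real) tiling set) D.
        delone_space \<Omega>\<^sub>0 \<and> local_derivation \<Omega> \<Omega>\<^sub>0 D \<and>
        \<Xi> = {T \<in> \<Omega>. D T \<in> canonical_transversal \<Omega>\<^sub>0})"

definition flow_box :: "('d::finite, 'l) tiling set \<times> real \<Rightarrow> ('d, 'l) tiling set" where
  "flow_box = (\<lambda>(\<Xi>, \<epsilon>). {S \<ominus> x |S x. S \<in> \<Xi> \<and> norm x < \<epsilon>})"

text \<open>The injectivity condition expresses that the box is a product of \<open>\<Xi>\<close> and a ball, i.e. that
  \<open>S\<close> and \<open>x\<close> are determined by \<open>S \<ominus> x\<close>.\<close>

definition open_flow_boxes ::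
    "('d::finite, 'l::metric_space) tiling set \<Rightarrow> (('d, 'l) tiling set \<times> real) set" where
  "open_flow_boxes \<Omega> = {(\<Xi>, \<epsilon>). FLC_transversal \<Omega> \<Xi> \<and> \<epsilon> > 0 \<and>
     inj_on (\<lambda>(S, x). S \<ominus> x) (\<Xi> \<times> ball 0 \<epsilon>) \<and> openin (tiling_topology \<Omega>) (flow_box (\<Xi>, \<epsilon>))}"

definition flow_box_primitive ::
    "(('d::finite, 'l) tiling \<Rightarrow> real^'d \<Rightarrow> real^'d) \<Rightarrow> ('d, 'l) tiling set \<times> real \<Rightarrow>
     ('d, 'l) tiling \<Rightarrow> real^'d" where
  "flow_box_primitive \<alpha> = (\<lambda>(\<Xi>, \<epsilon>) T.
     THE w. \<exists>S x. S \<in> \<Xi> \<and> norm x < \<epsilon> \<and> T = S \<ominus> x \<and> w = \<alpha> S x)"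

text \<open>The image of the class of a strong cocycle \<open>\<alpha>\<close> in Cech cohomology.\<close>

definition cech_class_of_cocycle ::
    "('d::finite, 'l::metric_space) tiling set \<Rightarrow> (('d, 'l) tiling \<Rightarrow> real^'d \<Rightarrow> real^'d) \<Rightarrow>
     (('d, 'l) tiling, ('d, 'l) tiling, real^'d) cech set" where
  "cech_class_of_cocycle \<Omega> \<alpha> =
     cech_class (tiling_topology \<Omega>)
       (open_flow_boxes \<Omega>, flow_box, \<lambda>B C T. flow_box_primitive \<alpha> B T - flow_box_primitive \<alpha> C T)"

definition shape_class ::
    "('d::finite, 'l::metric_space) tiling set \<Rightarrow>
     (('d, 'l) tiling, ('d, 'l) tiling, real^'d) cech set" where
  "shape_class \<Omega> = cech_class_of_cocycle \<Omega> (\<lambda>T v. v)"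

definition strong_class_of_map ::
    "('d::finite, 'l::metric_space) tiling set \<Rightarrow> ('d, 'm::metric_space) tiling set \<Rightarrow>
     (('d, 'l) tiling \<Rightarrow> ('d, 'm) tiling) \<Rightarrow>
     (('d, 'l) tiling, ('d, 'l) tiling, real^'d) cech set" where
  "strong_class_of_map \<Omega> \<Omega>' f = cech_pullback (tiling_topology \<Omega>) f (shape_class \<Omega>')"

end

theory Submission
  imports Defs
begin

text \<open>Let \<open>h1_T(v)\<close> and \<open>h2_T(v)\<close> be the displacements of the two maps. If a function \<open>s\<close> satisfies
  \<open>h1_T(v) - h2_T(v) = s(T - v) - s(T)\<close>, then \<open>T \<mapsto> h2(T) - s(T)\<close> has the same displacement as
  \<open>h1\<close>. Since \<open>h1\<close> is a homeomorphism, this map is \<open>\<phi> \<circ> h1\<close> for a map \<open>\<phi>\<close>, which commutes with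
  translations and is onto by minimality; \<open>(t, T) \<mapsto> h2(T) - t s(T)\<close> is the homotopy
  (\<open>factor_map_if_displacements_cohomologous\<close>). It remains to find \<open>s\<close>, and to show that \<open>\<phi>\<close> is
  local if \<open>s\<close> comes from an equality of strong classes.

  In the weak case the equality of the cosets provides \<open>s\<close>, as soon as the displacement of \<open>h1\<close> lies in
  its own coset, that is, is continuous. This holds for every continuous map into an aperiodic space that
  preserves orbits. A short path in an orbit could only have a large
  displacement if it jumped between the countably many sheets of the orbit that pass near its starting
  point. The times spent in the several sheets would partition an interval into countably many
  closed sets, which is impossible by a theorem of Sierpinski (\<open>small_displacement\<close>). What
  separates the sheets is that, by compactness and freeness of the action, an orbit which returns close to
  its starting point after a bounded time has moved only a little (\<open>no_return\<close>).

  In the strong case \<open>s\<close> comes from Cech cocycles. The shape class of a space is represented by the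
  differences of the flow coordinates \<open>S - x \<mapsto> x\<close> of its flow boxes; these coordinates form a
  primitive that is not locally constant. Cohomologous cocycles have primitives that agree locally up to
  constants (\<open>cech_primitive_transport\<close>). A common representative of the two classes therefore has two
  primitives, one locally the flow coordinate of \<open>h1(T)\<close> and the other that of \<open>h2(T)\<close>, up to constants.
  Their difference is a global function \<open>s\<close>. As flow coordinates change by the displacement, \<open>s\<close> cobounds
  the difference of the displacements for small \<open>v\<close>, hence for all \<open>v\<close>
  (\<open>cobounding_if_coordinate_difference\<close>). This argument is void unless the classes have elements, so
  flow boxes have to be constructed that cover the space (\<open>flow_boxes_cover\<close>), and their coordinates must
  differ by locally constant functions (\<open>shape_cocycle\<close>).

  For this \<open>s\<close> the map \<open>\<phi>\<close> sends transversals locally into translates of transversals. Two tilings that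
  agree on a large ball have, by continuity and finite local complexity, images that agree on a
  large ball up to a small translation, and the transversal excludes a nonzero translation
  (\<open>local_if_respects_transversals\<close>). The basis of all this is that under finite local complexity
  nearby tilings agree exactly on a large ball after a small translation
  (\<open>close_imp_patch_eq\<close>).\<close>


section \<open>Translations and patches\<close>

lemma fst_translate_tile [simp]: "fst (translate_tile t x) = (\<lambda>a. a - x) ` fst t"
  and snd_translate_tile [simp]: "snd (translate_tile t x) = snd t"
  by (simp_all add: translate_tile_def)

lemma translate_tile_add [simp]: "translate_tile (translate_tile t x) y = translate_tile t (x + y)"
  by (simp add: translate_tile_def image_image algebra_simps)

lemma translate_tile_0 [simp]: "translate_tile t 0 = t"
  by (simp add: translate_tile_def)

lemma translate_add [simp]: "T \<ominus> x \<ominus> y = T \<ominus> (x + y)"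
  by (simp add: translate_def image_image)

lemma translate_0 [simp]: "T \<ominus> 0 = T"
  by (simp add: translate_def)

lemma mem_translate: "u \<in> T \<ominus> x \<longleftrightarrow> translate_tile u (-x) \<in> T"
proof
  assume "translate_tile u (-x) \<in> T"
  then have "translate_tile (translate_tile u (-x)) x \<in> T \<ominus> x"
    unfolding translate_def by (rule imageI)
  then show "u \<in> T \<ominus> x" by simp
qed (auto simp: translate_def)

lemma translate_tile_in_translate [simp]: "translate_tile t x \<in> T \<ominus> x \<longleftrightarrow> t \<in> T"
  by (simp add: mem_translate)

lemma translate_mono: "S \<subseteq> T \<Longrightarrow> S \<ominus> x \<subseteq> T \<ominus> x"
  by (auto simp: translate_def)

lemma translate_eq_iff: "T \<ominus> x = T' \<ominus> y \<longleftrightarrow> T = T' \<ominus> (y - x)"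
proof
  assume "T \<ominus> x = T' \<ominus> y"
  then have "T \<ominus> x \<ominus> -x = T' \<ominus> y \<ominus> -x" by simp
  then show "T = T' \<ominus> (y - x)" by simp
qed simp

lemma inj_translate_tile: "inj_on (\<lambda>t. translate_tile t x) S"
  by (rule inj_on_inverseI[of _ "\<lambda>t. translate_tile t (-x)"]) simp

lemma finite_translate [simp]: "finite (T \<ominus> x) \<longleftrightarrow> finite T"
  unfolding translate_def by (rule finite_image_iff[OF inj_translate_tile])

lemma translate_in_orbit: "T \<ominus> x \<in> orbit T"
  by (simp add: orbit_def)

lemma in_patch_iff: "t \<in> patch T x R \<longleftrightarrow> t \<in> T \<and> (\<exists>a\<in>fst t. dist x a < R)"
  by (auto simp: patch_def)

lemma patch_translate: "patch (T \<ominus> v) x R = patch T (x + v) R \<ominus> v"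
proof -
  have "u \<in> patch (T \<ominus> v) x R \<longleftrightarrow> u \<in> patch T (x + v) R \<ominus> v" for u
    unfolding mem_translate in_patch_iff by (auto simp: dist_norm algebra_simps)
  then show ?thesis by blast
qed

lemma patch_subset: "patch T x R \<subseteq> T"
  by (auto simp: patch_def)

lemma patch_mono:
  assumes "dist x y + r \<le> R"
  shows "patch T x r \<subseteq> patch T y R"
proof
  fix t assume "t \<in> patch T x r"
  then obtain a where a: "t \<in> T" "a \<in> fst t" "dist x a < r" by (auto simp: in_patch_iff)
  have "dist y a < R" using a(3) assms dist_triangle[of y a x] by (simp add: dist_commute)
  with a show "t \<in> patch T y R" by (auto simp: in_patch_iff)
qed

lemma patch_eq_mono:
  assumes "patch T y R = patch T' y R" "dist x y + r \<le> R"
  shows "patch T x r = patch T' x r"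
proof -
  have *: "patch S x r = {t \<in> patch S y R. \<exists>a\<in>fst t. dist x a < r}" for S :: "('a, 'b) tiling"
    using patch_mono[OF assms(2), of S] by (auto simp: in_patch_iff)
  show ?thesis unfolding *[of T] *[of T'] assms(1) ..
qed

lemma patch_eq_translate:
  assumes "patch T 0 R = patch T' 0 R" "norm v + r \<le> R"
  shows "patch (T \<ominus> v) 0 r = patch (T' \<ominus> v) 0 r"
  using patch_eq_mono[OF assms(1), of v r] assms(2) unfolding patch_translate by simp


section \<open>Hausdorff distance and closeness of tiles\<close>

definition proper_tile :: "('d::finite, 'l) tile \<Rightarrow> bool" where
  "proper_tile t \<longleftrightarrow> compact (fst t) \<and> fst t \<noteq> {}"

lemma proper_translate_tile [simp]: "proper_tile (translate_tile t x) \<longleftrightarrow> proper_tile t"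
proof -
  have "proper_tile (translate_tile t x)" if "proper_tile t" for t :: "('d::finite, 'l) tile" and x
    using that by (simp add: proper_tile_def compact_translation_subtract)
  from this[of "translate_tile t x" "-x"] this[of t x] show ?thesis by auto
qed

lemma hausdorff_dist_leI:
  assumes "A \<noteq> {}" "B \<noteq> {}" "bounded A" "bounded B"
    and "\<And>a. a \<in> A \<Longrightarrow> \<exists>b\<in>B. dist a b \<le> r" "\<And>b. b \<in> B \<Longrightarrow> \<exists>a\<in>A. dist a b \<le> r"
  shows "hausdorff_dist A B \<le> r"
proof -
  have "infdist a B \<le> r" if "a \<in> A" for a
    using assms(5)[OF that] infdist_le2 by blast
  moreover have "infdist b A \<le> r" if "b \<in> B" for b
    using assms(6)[OF that] infdist_le2 by (metis dist_commute)
  ultimately show ?thesis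
    using assms(1-4) by (auto simp: hausdorff_dist_def intro!: cSUP_least)
qed

lemma hausdorff_dist_near:
  fixes A B :: "'v::heine_borel set"
  assumes "compact A" "compact B" "B \<noteq> {}" "a \<in> A"
  obtains b where "b \<in> B" "dist a b \<le> hausdorff_dist A B"
proof -
  obtain b where "b \<in> B" "infdist a B = dist a b"
    using infdist_attains_inf[of B a] compact_imp_closed[OF assms(2)] assms(3) by metis
  with infdist_le_hausdorff_dist[of A B a] assms that show ?thesis
    by (simp add: compact_imp_bounded)
qed

lemma hausdorff_dist_translate_le:
  fixes A B :: "'v::euclidean_space set"
  assumes "compact A" "compact B" "A \<noteq> {}" "B \<noteq> {}"
  shows "hausdorff_dist ((\<lambda>a. a - v) ` A) ((\<lambda>b. b - w) ` B) \<le> hausdorff_dist A B + norm (v - w)"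
proof (rule hausdorff_dist_leI)
  show "bounded ((\<lambda>a. a - v) ` A)" "bounded ((\<lambda>b. b - w) ` B)"
    using assms bounded_translation_minus compact_imp_bounded by blast+
  have *: "dist (a - v) (b - w) \<le> dist a b + norm (v - w)" for a b :: 'v
    using norm_triangle_ineq4[of "a - b" "v - w"] by (simp add: dist_norm algebra_simps)
  { fix a assume "a \<in> (\<lambda>a. a - v) ` A"
    then obtain a' where a': "a' \<in> A" "a = a' - v" by blast
    obtain b where "b \<in> B" "dist a' b \<le> hausdorff_dist A B"
      using hausdorff_dist_near[OF assms(1,2,4) a'(1)] by blast
    with * [of a' b] a' show "\<exists>b\<in>(\<lambda>b. b - w) ` B. dist a b \<le> hausdorff_dist A B + norm (v - w)"
      by force }
  { fix b assume "b \<in> (\<lambda>b. b - w) ` B"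
    then obtain b' where b': "b' \<in> B" "b = b' - w" by blast
    obtain a where "a \<in> A" "dist b' a \<le> hausdorff_dist B A"
      using hausdorff_dist_near[OF assms(2,1,3) b'(1)] by blast
    with * [of a b'] b' show "\<exists>a\<in>(\<lambda>a. a - v) ` A. dist a b \<le> hausdorff_dist A B + norm (v - w)"
      by (force simp: hausdorff_dist_commute[of B A] dist_commute[of b' a]) }
qed (use assms in auto)

definition tile_near :: "real \<Rightarrow> ('d::finite, 'l::metric_space) tile \<Rightarrow> ('d, 'l) tile \<Rightarrow> bool" where
  "tile_near \<epsilon> t u \<longleftrightarrow> hausdorff_dist (fst t) (fst u) < \<epsilon> \<and> dist (snd t) (snd u) < \<epsilon>"

lemma tile_near_refl: "0 < \<epsilon> \<Longrightarrow> tile_near \<epsilon> t t"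
  by (simp add: tile_near_def)

lemma tile_near_sym: "tile_near \<epsilon> t u \<Longrightarrow> tile_near \<epsilon> u t"
  by (simp add: tile_near_def hausdorff_dist_commute dist_commute)

lemma tile_near_trans:
  assumes "tile_near \<delta> t u" "tile_near \<eta> u v" "proper_tile t" "proper_tile u" "proper_tile v"
  shows "tile_near (\<delta> + \<eta>) t v"
proof -
  have "hausdorff_dist (fst t) (fst v) \<le> hausdorff_dist (fst t) (fst u) + hausdorff_dist (fst u) (fst v)"
    using Metric_space.triangle[OF Metric_space_hausdorff, of "fst t" "fst u" "fst v"] assms(3-5)
    by (simp add: proper_tile_def)
  with assms(1,2) dist_triangle[of "snd t" "snd v" "snd u"] show ?thesis
    by (simp add: tile_near_def)
qed

lemma tile_near_translate:
  assumes "tile_near \<delta> t u" "norm (v - w) + \<delta> \<le> \<epsilon>" "proper_tile t" "proper_tile u"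
  shows "tile_near \<epsilon> (translate_tile t v) (translate_tile u w)"
proof -
  have "hausdorff_dist ((\<lambda>a. a - v) ` fst t) ((\<lambda>a. a - w) ` fst u)
      \<le> hausdorff_dist (fst t) (fst u) + norm (v - w)"
    using assms(3,4) by (simp add: hausdorff_dist_translate_le proper_tile_def)
  with assms(1,2) norm_ge_zero[of "v - w"] show ?thesis
    unfolding tile_near_def fst_translate_tile snd_translate_tile by linarith
qed

lemma tile_near_eqI:
  assumes "\<And>\<epsilon>. 0 < \<epsilon> \<Longrightarrow> tile_near \<epsilon> t u" "proper_tile t" "proper_tile u"
  shows "t = u"
proof -
  have "hausdorff_dist (fst t) (fst u) \<le> 0" "dist (snd t) (snd u) \<le> 0"
    by (rule dense_ge, use assms(1) in \<open>simp add: tile_near_def less_imp_le\<close>)+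
  then have "hausdorff_dist (fst t) (fst u) = 0" "snd t = snd u"
    using hausdorff_dist_nonneg[of "fst t" "fst u"] by (auto intro: antisym)
  with Metric_space.zero[OF Metric_space_hausdorff, of "fst t" "fst u"] assms(2,3) show ?thesis
    by (simp add: proper_tile_def prod_eq_iff)
qed

lemma tile_near_point:
  assumes "tile_near \<delta> t u" "proper_tile t" "proper_tile u" "a \<in> fst t"
  obtains b where "b \<in> fst u" "dist a b < \<delta>"
proof -
  obtain b where "b \<in> fst u" "dist a b \<le> hausdorff_dist (fst t) (fst u)"
    using hausdorff_dist_near[of "fst t" "fst u" a] assms(2-4) by (auto simp: proper_tile_def)
  with assms(1) that show ?thesis by (auto simp: tile_near_def)
qed

lemma tile_near_meets:
  assumes "tile_near \<delta> t u" "proper_tile t" "proper_tile u" "t \<in> patch T x r" "u \<in> T'"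
    "r + \<delta> \<le> R"
  shows "u \<in> patch T' x R"
proof -
  obtain a where a: "a \<in> fst t" "dist x a < r" using assms(4) by (auto simp: in_patch_iff)
  obtain b where b: "b \<in> fst u" "dist a b < \<delta>" using tile_near_point[OF assms(1-3) a(1)] .
  have "dist x b < R" using a(2) b(2) assms(6) dist_triangle[of x b a] by simp
  with b(1) assms(5) show ?thesis by (auto simp: in_patch_iff)
qed

definition proper_tiles :: "('d::finite, 'l) tiling \<Rightarrow> bool" where
  "proper_tiles T \<longleftrightarrow> (\<forall>t\<in>T. proper_tile t)"

lemma proper_tilesD: "proper_tiles T \<Longrightarrow> t \<in> T \<Longrightarrow> proper_tile t"
  by (simp add: proper_tiles_def)

lemma eps_close_alt:
  "eps_close \<epsilon> T T' \<longleftrightarrow>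
     (\<exists>b Q Q'. patch T 0 (1/\<epsilon>) \<subseteq> Q \<and> Q \<subseteq> T \<and> patch T' 0 (1/\<epsilon>) \<subseteq> Q' \<and> Q' \<subseteq> T' \<and>
        bij_betw b Q Q' \<and> (\<forall>t\<in>Q. tile_near \<epsilon> t (b t)))"
  by (simp add: eps_close_def tile_near_def)

lemma eps_closeI:
  assumes "patch T 0 (1/\<epsilon>) \<subseteq> Q" "Q \<subseteq> T" "patch T' 0 (1/\<epsilon>) \<subseteq> Q'" "Q' \<subseteq> T'"
    "bij_betw b Q Q'" "\<And>t. t \<in> Q \<Longrightarrow> tile_near \<epsilon> t (b t)"
  shows "eps_close \<epsilon> T T'"
  unfolding eps_close_alt using assms by (intro exI[of _ b] exI[of _ Q] exI[of _ Q'] conjI ballI)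

lemma eps_closeE:
  assumes "eps_close \<epsilon> T T'"
  obtains b Q Q' where "patch T 0 (1/\<epsilon>) \<subseteq> Q" "Q \<subseteq> T" "patch T' 0 (1/\<epsilon>) \<subseteq> Q'" "Q' \<subseteq> T'"
    "bij_betw b Q Q'" "\<And>t. t \<in> Q \<Longrightarrow> tile_near \<epsilon> t (b t)"
  using assms unfolding eps_close_alt by (elim exE conjE) (rule that, auto)

lemma eps_close_refl: "0 < \<epsilon> \<Longrightarrow> eps_close \<epsilon> T T"
  by (rule eps_closeI[where b=id and Q=T and Q'=T]) (auto simp: patch_subset tile_near_refl)

lemma eps_close_sym:
  assumes "eps_close \<epsilon> T T'"
  shows "eps_close \<epsilon> T' T"
  using assms
proof (rule eps_closeE)
  fix b Q Q'
  assume *: "patch T 0 (1/\<epsilon>) \<subseteq> Q" "Q \<subseteq> T" "patch T' 0 (1/\<epsilon>) \<subseteq> Q'" "Q' \<subseteq> T'"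
    and b: "bij_betw b Q Q'" "\<And>t. t \<in> Q \<Longrightarrow> tile_near \<epsilon> t (b t)"
  have "tile_near \<epsilon> u (inv_into Q b u)" if "u \<in> Q'" for u
    using b(2)[of "inv_into Q b u"] that bij_betw_inv_into_right[OF b(1) that]
      bij_betwE[OF bij_betw_inv_into[OF b(1)]]
    by (auto intro: tile_near_sym)
  then show ?thesis
    by (rule eps_closeI[OF *(3,4,1,2) bij_betw_inv_into[OF b(1)]])
qed

text \<open>The relations \<^const>\<open>eps_close\<close> form a uniform structure. The ball of radius \<open>1/\<delta>\<close> has to
  exceed that of radius \<open>1/\<epsilon>\<close>, because a tile may leave the latter when it is moved.\<close>

lemma eps_close_trans:
  assumes TU: "eps_close \<delta> T U" and UV: "eps_close \<delta> U V"
    and proper: "proper_tiles T" "proper_tiles U" "proper_tiles V"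
    and \<delta>: "0 < \<delta>" "\<delta> \<le> \<epsilon>/2" "\<delta> \<le> 1/\<epsilon>"
  shows "eps_close \<epsilon> T V"
  using TU
proof (rule eps_closeE)
  fix b Q Q'
  assume Q: "patch T 0 (1/\<delta>) \<subseteq> Q" "Q \<subseteq> T" "patch U 0 (1/\<delta>) \<subseteq> Q'" "Q' \<subseteq> U"
    and b: "bij_betw b Q Q'" "\<And>t. t \<in> Q \<Longrightarrow> tile_near \<delta> t (b t)"
  have \<epsilon>: "0 < \<epsilon>" using \<delta> by simp
  have "2 * (1/\<epsilon>) \<le> 1/\<delta>" using \<delta> \<epsilon> by (simp add: field_simps)
  with \<delta> have R: "1/\<epsilon> + \<delta> \<le> 1/\<delta>" "1/\<epsilon> \<le> 1/\<delta>" by auto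
  from UV show ?thesis
  proof (rule eps_closeE)
    fix c P P'
    assume P: "patch U 0 (1/\<delta>) \<subseteq> P" "P \<subseteq> U" "patch V 0 (1/\<delta>) \<subseteq> P'" "P' \<subseteq> V"
      and c: "bij_betw c P P'" "\<And>t. t \<in> P \<Longrightarrow> tile_near \<delta> t (c t)"
    define N where "N = {t \<in> Q. b t \<in> P}"
    have "b ` N = Q' \<inter> P" using b(1) unfolding N_def bij_betw_def by blast
    then have bN: "bij_betw b N (Q' \<inter> P)"
      using b(1) unfolding bij_betw_def N_def by (auto intro: inj_on_subset)
    have cN: "bij_betw c (Q' \<inter> P) (c ` (Q' \<inter> P))"
      using c(1) unfolding bij_betw_def by (auto intro: inj_on_subset)
    show ?thesis
    proof (rule eps_closeI[OF _ _ _ _ bij_betw_trans[OF bN cN]])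
      show "patch T 0 (1/\<epsilon>) \<subseteq> N"
      proof
        fix t assume t: "t \<in> patch T 0 (1/\<epsilon>)"
        then have tQ: "t \<in> Q" using Q(1) patch_mono[of 0 0 "1/\<epsilon>" "1/\<delta>" T] R(2) by auto
        then have "b t \<in> U" using b(1) Q(4) by (auto simp: bij_betw_def)
        then have "b t \<in> patch U 0 (1/\<delta>)"
          using tile_near_meets[OF b(2)[OF tQ] _ _ t] R(1) proper Q(2) tQ
          by (meson proper_tilesD subsetD)
        then show "t \<in> N" using P(1) tQ by (auto simp: N_def)
      qed
      show "N \<subseteq> T" using Q(2) by (auto simp: N_def)
      show "patch V 0 (1/\<epsilon>) \<subseteq> c ` (Q' \<inter> P)"
      proof
        fix v assume v: "v \<in> patch V 0 (1/\<epsilon>)"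
        then have "v \<in> P'" using P(3) patch_mono[of 0 0 "1/\<epsilon>" "1/\<delta>" V] R(2) by auto
        then obtain u where u: "u \<in> P" "v = c u" using c(1) by (auto simp: bij_betw_def)
        have "u \<in> patch U 0 (1/\<delta>)"
          using tile_near_meets[OF tile_near_sym[OF c(2)[OF u(1)]] _ _ v[unfolded u(2)]] R(1) proper
            P(2) u patch_subset v by (metis proper_tilesD subsetD)
        then show "v \<in> c ` (Q' \<inter> P)" using Q(3) u by blast
      qed
      show "c ` (Q' \<inter> P) \<subseteq> V" using P(4) c(1) by (auto simp: bij_betw_def)
      fix t assume t: "t \<in> N"
      then have "t \<in> Q" "b t \<in> P" by (auto simp: N_def)
      moreover have "t \<in> T" "b t \<in> U" "c (b t) \<in> V"
        using calculation Q(2) P(2,4) bij_betwE[OF c(1)] by blast+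
      ultimately have "tile_near (\<delta> + \<delta>) t (c (b t))"
        using proper by (intro tile_near_trans[OF b(2) c(2)]) (auto dest: proper_tilesD)
      then show "tile_near \<epsilon> t ((c \<circ> b) t)" using \<delta>(2) by (auto simp: tile_near_def)
    qed
  qed
qed

lemma eps_close_translate:
  assumes TU: "eps_close \<delta> T U" and proper: "proper_tiles T" "proper_tiles U"
    and \<delta>: "0 < \<epsilon>" "norm (v - w) + \<delta> \<le> \<epsilon>" "norm v + norm w + 1/\<epsilon> \<le> 1/\<delta>"
  shows "eps_close \<epsilon> (T \<ominus> v) (U \<ominus> w)"
  using TU
proof (rule eps_closeE)
  fix b Q Q'
  assume Q: "patch T 0 (1/\<delta>) \<subseteq> Q" "Q \<subseteq> T" "patch U 0 (1/\<delta>) \<subseteq> Q'" "Q' \<subseteq> U"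
    and b: "bij_betw b Q Q'" "\<And>t. t \<in> Q \<Longrightarrow> tile_near \<delta> t (b t)"
  define c where "c t = translate_tile (b (translate_tile t (-v))) w" for t
  have "bij_betw (\<lambda>t. translate_tile t (-v)) (Q \<ominus> v) Q"
    by (rule bij_betw_byWitness[where f' = "\<lambda>t. translate_tile t v"]) (auto simp: translate_def)
  moreover have "bij_betw (\<lambda>t. translate_tile t w) Q' (Q' \<ominus> w)"
    unfolding translate_def by (rule inj_on_imp_bij_betw[OF inj_translate_tile])
  ultimately have c: "bij_betw c (Q \<ominus> v) (Q' \<ominus> w)"
    unfolding c_def using bij_betw_trans[OF bij_betw_trans[OF _ b(1)]] by (simp add: comp_def)
  have sub: "patch S x (1/\<epsilon>) \<subseteq> patch S 0 (1/\<delta>)" if "norm x \<le> norm v + norm w"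
    for S :: "('a, 'b) tiling" and x
    using \<delta>(3) that by (intro patch_mono) simp
  show ?thesis
  proof (rule eps_closeI[OF _ _ _ _ c])
    show "patch (T \<ominus> v) 0 (1/\<epsilon>) \<subseteq> Q \<ominus> v"
      using sub[of v T] Q(1) by (simp add: patch_translate) (meson order_trans translate_mono)
    show "patch (U \<ominus> w) 0 (1/\<epsilon>) \<subseteq> Q' \<ominus> w"
      using sub[of w U] Q(3) by (simp add: patch_translate) (meson order_trans translate_mono)
    show "Q \<ominus> v \<subseteq> T \<ominus> v" "Q' \<ominus> w \<subseteq> U \<ominus> w" using Q by (simp_all add: translate_mono)
    fix t assume "t \<in> Q \<ominus> v"
    then obtain t' where t': "t' \<in> Q" "t = translate_tile t' v" by (auto simp: translate_def)
    moreover have "b t' \<in> U" using t' b(1) Q(4) by (auto simp: bij_betw_def)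
    ultimately show "tile_near \<epsilon> t (c t)"
      using tile_near_translate[OF b(2)[OF t'(1)] \<delta>(2)] proper Q(2)
      by (auto simp: c_def proper_tiles_def)
  qed
qed


section \<open>The topology of a tiling space\<close>

lemma finite_pos_lower_bound:
  fixes e :: "'a \<Rightarrow> real"
  assumes "finite F" "\<And>x. x \<in> F \<Longrightarrow> 0 < e x"
  obtains \<delta> where "0 < \<delta>" "\<And>x. x \<in> F \<Longrightarrow> \<delta> \<le> e x"
proof
  show "0 < Min (insert 1 (e ` F))" using assms by (subst Min_gr_iff) auto
  show "Min (insert 1 (e ` F)) \<le> e x" if "x \<in> F" for x
    using assms(1) that by (intro Min_le) auto
qed

text \<open>What spaces of tilings and spaces of Delone sets have in common; in this form both are treated
  at once.\<close>

locale compact_tiling_space =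
  fixes \<Omega> :: "('d::finite, 'l::metric_space) tiling set"
  assumes nonempty: "T \<in> \<Omega> \<Longrightarrow> T \<noteq> {}"
    and proper: "T \<in> \<Omega> \<Longrightarrow> proper_tiles T"
    and finite_patch: "T \<in> \<Omega> \<Longrightarrow> finite (patch T x R)"
    and translate_closed: "T \<in> \<Omega> \<Longrightarrow> T \<ominus> x \<in> \<Omega>"
    and compact: "compact_space (tiling_topology \<Omega>)"
begin

abbreviation X :: "('d, 'l) tiling topology" where "X \<equiv> tiling_topology \<Omega>"

lemma proper_tile: "T \<in> \<Omega> \<Longrightarrow> t \<in> T \<Longrightarrow> proper_tile t"
  using proper proper_tilesD by blast

lemma close_halve:
  assumes "0 < \<epsilon>"
  obtains \<delta> where "0 < \<delta>" "\<delta> \<le> \<epsilon>"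
    "\<And>T U V. T \<in> \<Omega> \<Longrightarrow> U \<in> \<Omega> \<Longrightarrow> V \<in> \<Omega> \<Longrightarrow> eps_close \<delta> T U \<Longrightarrow> eps_close \<delta> U V \<Longrightarrow> eps_close \<epsilon> T V"
proof (rule that)
  show "0 < min (\<epsilon>/2) (1/\<epsilon>)" "min (\<epsilon>/2) (1/\<epsilon>) \<le> \<epsilon>" using assms by auto
  show "eps_close \<epsilon> T V" if "T \<in> \<Omega>" "U \<in> \<Omega>" "V \<in> \<Omega>"
    "eps_close (min (\<epsilon>/2) (1/\<epsilon>)) T U" "eps_close (min (\<epsilon>/2) (1/\<epsilon>)) U V" for T U V
    using eps_close_trans[OF that(4,5)] that(1-3)[THEN proper] assms by simp
qed

lemma close_translate:
  assumes "0 < \<epsilon>"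
  obtains \<delta> where "0 < \<delta>"
    "\<And>T U v w. T \<in> \<Omega> \<Longrightarrow> U \<in> \<Omega> \<Longrightarrow> norm v \<le> \<rho> \<Longrightarrow> norm w \<le> \<rho> \<Longrightarrow> eps_close \<delta> T U \<Longrightarrow>
       norm (v - w) < \<delta> \<Longrightarrow> eps_close \<epsilon> (T \<ominus> v) (U \<ominus> w)"
proof
  define \<rho>' where "\<rho>' = max \<rho> 0"
  define \<delta> where "\<delta> = min (\<epsilon>/2) (1 / (2 * \<rho>' + 1/\<epsilon>))"
  have pos: "0 < 2 * \<rho>' + 1/\<epsilon>" using assms by (simp add: \<rho>'_def add_nonneg_pos)
  then show \<delta>: "0 < \<delta>" using assms by (simp add: \<delta>_def)
  have "\<delta> \<le> 1 / (2 * \<rho>' + 1/\<epsilon>)" by (simp add: \<delta>_def)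
  with pos \<delta> have \<delta>2: "2 * \<rho>' + 1/\<epsilon> \<le> 1/\<delta>" by (simp add: field_simps)
  fix T U :: "('d, 'l) tiling" and v w :: "real^'d"
  assume "T \<in> \<Omega>" "U \<in> \<Omega>" and *: "norm v \<le> \<rho>" "norm w \<le> \<rho>" "eps_close \<delta> T U" "norm (v - w) < \<delta>"
  moreover have "norm (v - w) + \<delta> \<le> \<epsilon>" using *(4) by (auto simp: \<delta>_def)
  moreover have "norm v + norm w + 1/\<epsilon> \<le> 1/\<delta>" using *(1,2) \<delta>2 by (simp add: \<rho>'_def)
  ultimately show "eps_close \<epsilon> (T \<ominus> v) (U \<ominus> w)"
    using assms by (intro eps_close_translate[where \<delta>=\<delta>] proper)
qed

text \<open>Only finitely many tiles of \<open>T'\<close> lie near a tile \<open>t\<close> of \<open>T\<close>. If none of them were \<open>t\<close>, they would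
  keep a positive distance from \<open>t\<close>.\<close>

lemma close_subset:
  assumes T: "T \<in> \<Omega>" "T' \<in> \<Omega>" and close: "\<And>\<epsilon>. 0 < \<epsilon> \<Longrightarrow> eps_close \<epsilon> T T'"
  shows "T \<subseteq> T'"
proof
  fix t assume t: "t \<in> T"
  then obtain a where a: "a \<in> fst t" using proper_tile[OF T(1) t] by (auto simp: proper_tile_def)
  define R where "R = norm a + 1"
  have R: "0 < R" by (simp add: R_def add_nonneg_pos)
  have tR: "t \<in> patch T 0 R" using t by (auto simp: in_patch_iff R_def intro!: bexI[OF _ a])
  have ex: "\<exists>u\<in>patch T' 0 (R + 1). tile_near \<epsilon> t u" if \<epsilon>: "0 < \<epsilon>" "\<epsilon> \<le> 1" "\<epsilon> \<le> 1/R" for \<epsilon>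
    using close[OF \<epsilon>(1)]
  proof (rule eps_closeE)
    fix b Q Q'
    assume b: "patch T 0 (1/\<epsilon>) \<subseteq> Q" "Q \<subseteq> T" "patch T' 0 (1/\<epsilon>) \<subseteq> Q'" "Q' \<subseteq> T'"
      "bij_betw b Q Q'" "\<And>t. t \<in> Q \<Longrightarrow> tile_near \<epsilon> t (b t)"
    have "R \<le> 1/\<epsilon>" using \<epsilon> R by (simp add: field_simps)
    then have tQ: "t \<in> Q" using patch_mono[of 0 0 R "1/\<epsilon>" T] b(1) tR by auto
    then have "b t \<in> T'" using b(4,5) by (auto simp: bij_betw_def)
    moreover have "b t \<in> patch T' 0 (R + 1)"
      by (rule tile_near_meets[OF b(6)[OF tQ] _ _ tR \<open>b t \<in> T'\<close>])
        (use T t \<open>b t \<in> T'\<close> \<epsilon> proper_tile in auto)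
    ultimately show ?thesis using b(6)[OF tQ] by blast
  qed
  show "t \<in> T'"
  proof (rule ccontr)
    assume nt: "t \<notin> T'"
    have "\<exists>e>0. \<not> tile_near e t u" if "u \<in> patch T' 0 (R + 1)" for u
      using tile_near_eqI[of t u] that patch_subset[of T'] nt t T proper_tile by blast
    then obtain e where e: "\<And>u. u \<in> patch T' 0 (R + 1) \<Longrightarrow> 0 < e u \<and> \<not> tile_near (e u) t u"
      by metis
    define \<epsilon> where "\<epsilon> = Min (insert 1 (insert (1/R) (e ` patch T' 0 (R + 1))))"
    have fin: "finite (insert 1 (insert (1/R) (e ` patch T' 0 (R + 1))))"
      using finite_patch[OF T(2)] by simp
    have "0 < \<epsilon>" unfolding \<epsilon>_def using fin e R by (subst Min_gr_iff) auto
    moreover have "\<epsilon> \<le> 1" "\<epsilon> \<le> 1/R" unfolding \<epsilon>_def by (rule Min_le[OF fin], simp)+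
    ultimately obtain u where u: "u \<in> patch T' 0 (R + 1)" "tile_near \<epsilon> t u" using ex by blast
    have "\<epsilon> \<le> e u" unfolding \<epsilon>_def using u(1) by (intro Min_le[OF fin]) simp
    then have "tile_near (e u) t u" using u(2) by (auto simp: tile_near_def)
    with e u(1) show False by blast
  qed
qed

lemma close_eqI:
  assumes "T \<in> \<Omega>" "T' \<in> \<Omega>" "\<And>\<epsilon>. 0 < \<epsilon> \<Longrightarrow> eps_close \<epsilon> T T'"
  shows "T = T'"
  using close_subset[OF assms(1,2)] close_subset[OF assms(2,1)] assms(3) eps_close_sym by blast

lemma close_nbhd:
  assumes "T \<in> \<Omega>" "0 < \<epsilon>"
  obtains U where "openin X U" "T \<in> U" "U \<subseteq> \<Omega>" "\<And>T'. T' \<in> U \<Longrightarrow> eps_close \<epsilon> T T'"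
proof
  define U where "U = {T' \<in> \<Omega>. \<exists>\<delta>>0. \<forall>V\<in>\<Omega>. eps_close \<delta> T' V \<longrightarrow> eps_close \<epsilon> T V}"
  show "U \<subseteq> \<Omega>" by (auto simp: U_def)
  show "T \<in> U" using assms by (auto simp: U_def)
  show "eps_close \<epsilon> T T'" if "T' \<in> U" for T'
    using that eps_close_refl[of _ T'] by (auto simp: U_def)
  have "\<exists>e>0. \<forall>W\<in>\<Omega>. eps_close e T' W \<longrightarrow> W \<in> U" if T': "T' \<in> U" for T'
  proof -
    obtain \<delta> where \<delta>: "0 < \<delta>" "\<And>V. V \<in> \<Omega> \<Longrightarrow> eps_close \<delta> T' V \<Longrightarrow> eps_close \<epsilon> T V"
      using T' by (auto simp: U_def)
    obtain e where e: "0 < e" "\<And>T U V. T \<in> \<Omega> \<Longrightarrow> U \<in> \<Omega> \<Longrightarrow> V \<in> \<Omega> \<Longrightarrow> eps_close e T U \<Longrightarrow>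
        eps_close e U V \<Longrightarrow> eps_close \<delta> T V"
      using close_halve[OF \<delta>(1)] by metis
    have "W \<in> U" if "W \<in> \<Omega>" "eps_close e T' W" for W
      using that e \<delta>(2) T' by (auto simp: U_def intro!: exI[of _ e])
    with e(1) show ?thesis by blast
  qed
  then show "openin X U" by (auto simp: openin_tiling_topology U_def)
qed

lemma open_close:
  assumes "openin X U" "T \<in> U"
  obtains \<epsilon> where "0 < \<epsilon>" "\<And>T'. T' \<in> \<Omega> \<Longrightarrow> eps_close \<epsilon> T T' \<Longrightarrow> T' \<in> U"
  using assms by (auto simp: openin_tiling_topology)

lemma Hausdorff: "Hausdorff_space X"
  unfolding Hausdorff_space_def
proof (intro allI impI)
  fix T T' assume "T \<in> topspace X \<and> T' \<in> topspace X \<and> T \<noteq> T'"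
  then have T: "T \<in> \<Omega>" "T' \<in> \<Omega>" "T \<noteq> T'" by auto
  then obtain \<epsilon> where \<epsilon>: "0 < \<epsilon>" "\<not> eps_close \<epsilon> T T'" using close_eqI by blast
  obtain \<delta> where \<delta>: "0 < \<delta>" "\<And>T U V. T \<in> \<Omega> \<Longrightarrow> U \<in> \<Omega> \<Longrightarrow> V \<in> \<Omega> \<Longrightarrow> eps_close \<delta> T U \<Longrightarrow>
      eps_close \<delta> U V \<Longrightarrow> eps_close \<epsilon> T V"
    using close_halve[OF \<epsilon>(1)] by metis
  obtain U where U: "openin X U" "T \<in> U" "U \<subseteq> \<Omega>" "\<And>V. V \<in> U \<Longrightarrow> eps_close \<delta> T V"
    using close_nbhd[OF T(1) \<delta>(1)] by metis
  obtain U' where U': "openin X U'" "T' \<in> U'" "U' \<subseteq> \<Omega>" "\<And>V. V \<in> U' \<Longrightarrow> eps_close \<delta> T' V"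
    using close_nbhd[OF T(2) \<delta>(1)] by metis
  have "disjnt U U'"
    unfolding disjnt_iff using \<delta>(2)[of T _ T'] U(3,4) U'(4) T \<epsilon>(2) eps_close_sym by blast
  with U U' show "\<exists>U V. openin X U \<and> openin X V \<and> T \<in> U \<and> T' \<in> V \<and> disjnt U V" by blast
qed

lemma continuous_map_into_iff:
  "continuous_map Z X f \<longleftrightarrow>
     (\<forall>z\<in>topspace Z. f z \<in> \<Omega> \<and>
        (\<forall>\<epsilon>>0. \<exists>U. openin Z U \<and> z \<in> U \<and> (\<forall>y\<in>U. eps_close \<epsilon> (f z) (f y))))" (is "?L \<longleftrightarrow> ?R")
proof
  assume L: ?L
  show ?R
  proof (intro ballI conjI allI impI)
    fix z assume z: "z \<in> topspace Z"
    then show fz: "f z \<in> \<Omega>" using L by (auto simp: continuous_map_def)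
    fix \<epsilon> :: real assume "0 < \<epsilon>"
    then obtain U where U: "openin X U" "f z \<in> U" "U \<subseteq> \<Omega>" "\<And>T'. T' \<in> U \<Longrightarrow> eps_close \<epsilon> (f z) T'"
      using close_nbhd[OF fz] by metis
    have "openin Z {y \<in> topspace Z. f y \<in> U}" using L U(1) by (simp add: continuous_map_def)
    with z U show "\<exists>U. openin Z U \<and> z \<in> U \<and> (\<forall>y\<in>U. eps_close \<epsilon> (f z) (f y))" by blast
  qed
next
  assume R: ?R
  show ?L
    unfolding continuous_map_eq_topcontinuous_at topcontinuous_at_def
  proof (intro ballI conjI allI impI)
    show "f \<in> topspace Z \<rightarrow> topspace X" using R by auto
    fix z V assume z: "z \<in> topspace Z" and V: "openin X V \<and> f z \<in> V"
    then obtain \<epsilon> where \<epsilon>: "0 < \<epsilon>" "\<And>T'. T' \<in> \<Omega> \<Longrightarrow> eps_close \<epsilon> (f z) T' \<Longrightarrow> T' \<in> V"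
      using open_close by metis
    obtain U where U: "openin Z U" "z \<in> U" "\<forall>y\<in>U. eps_close \<epsilon> (f z) (f y)" using R z \<epsilon>(1) by blast
    have "f y \<in> V" if "y \<in> U" for y
      using that U(3) openin_subset[OF U(1)] R by (intro \<epsilon>(2)) auto
    with U show "\<exists>U. openin Z U \<and> z \<in> U \<and> (\<forall>y\<in>U. f y \<in> V)" by blast
  qed
qed

lemma prod_nbhd:
  assumes "T \<in> \<Omega>" "0 < \<delta>"
  obtains W where "openin (prod_topology X euclidean) W" "(T, v) \<in> W"
    "\<And>T' v'. (T', v') \<in> W \<Longrightarrow> T' \<in> \<Omega> \<and> eps_close \<delta> T T' \<and> norm (v - v' :: real^'d) < \<delta>"
proof -
  obtain U where U: "openin X U" "T \<in> U" "U \<subseteq> \<Omega>" "\<And>T'. T' \<in> U \<Longrightarrow> eps_close \<delta> T T'"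
    using close_nbhd[OF assms] by metis
  have "openin (prod_topology X euclidean) (U \<times> ball v \<delta>)"
    using U(1) by (simp add: openin_prod_Times_iff)
  then show ?thesis
    by (rule that) (use U assms in \<open>auto simp: dist_norm\<close>)
qed

lemma continuous_translation:
  "continuous_map (prod_topology X euclidean) X (\<lambda>(T, v). T \<ominus> v)"
  unfolding continuous_map_into_iff
proof (intro ballI conjI allI impI)
  fix z assume "z \<in> topspace (prod_topology X (euclidean :: (real^'d) topology))"
  then obtain T v where z: "z = (T, v)" "T \<in> \<Omega>" by auto
  then show "(case z of (T, v) \<Rightarrow> T \<ominus> v) \<in> \<Omega>" by (simp add: translate_closed)
  fix \<epsilon> :: real assume "0 < \<epsilon>"
  then obtain \<delta> where \<delta>: "0 < \<delta>" "\<And>T U u w. T \<in> \<Omega> \<Longrightarrow> U \<in> \<Omega> \<Longrightarrow> norm u \<le> norm v + 1 \<Longrightarrow>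
      norm w \<le> norm v + 1 \<Longrightarrow> eps_close \<delta> T U \<Longrightarrow> norm (u - w) < \<delta> \<Longrightarrow> eps_close \<epsilon> (T \<ominus> u) (U \<ominus> w)"
    using close_translate by metis
  define \<delta>' where "\<delta>' = min \<delta> 1"
  have \<delta>': "0 < \<delta>'" "\<delta>' \<le> \<delta>" "\<delta>' \<le> 1" using \<delta>(1) by (auto simp: \<delta>'_def)
  obtain W where W: "openin (prod_topology X euclidean) W" "(T, v) \<in> W"
    "\<And>T' v'. (T', v') \<in> W \<Longrightarrow> T' \<in> \<Omega> \<and> eps_close \<delta>' T T' \<and> norm (v - v') < \<delta>'"
    using prod_nbhd[OF z(2) \<delta>'(1)] by metis
  have "eps_close \<epsilon> (T \<ominus> v) (T' \<ominus> v')" if "(T', v') \<in> W" for T' v'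
  proof -
    have *: "T' \<in> \<Omega>" "eps_close \<delta>' T T'" "norm (v - v') < \<delta>'" using W(3)[OF that] by auto
    have "norm v' \<le> norm v + norm (v - v')" using norm_triangle_ineq2[of v' v] by (simp add: norm_minus_commute)
    with * \<delta>' show ?thesis
      by (intro \<delta>(2) z(2)) (auto intro: eps_close_mono)
  qed
  with W z show "\<exists>U. openin (prod_topology X euclidean) U \<and> z \<in> U \<and>
      (\<forall>y\<in>U. eps_close \<epsilon> (case z of (T, v) \<Rightarrow> T \<ominus> v) (case y of (T, v) \<Rightarrow> T \<ominus> v))"
    by (intro exI[of _ W]) auto
qed

lemma finite_close_cover:
  assumes "\<And>T. T \<in> \<Omega> \<Longrightarrow> 0 < e T"
  obtains F where "finite F" "F \<subseteq> \<Omega>" "\<And>T. T \<in> \<Omega> \<Longrightarrow> \<exists>S\<in>F. eps_close (e S) S T"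
proof -
  have "\<exists>U. openin X U \<and> T \<in> U \<and> (\<forall>T'\<in>U. eps_close (e T) T T')" if "T \<in> \<Omega>" for T
    using close_nbhd[OF that assms[OF that]] by metis
  then obtain U where U: "\<And>T. T \<in> \<Omega> \<Longrightarrow> openin X (U T) \<and> T \<in> U T \<and> (\<forall>T'\<in>U T. eps_close (e T) T T')"
    by metis
  then have "\<And>V. V \<in> U ` \<Omega> \<Longrightarrow> openin X V" "topspace X \<subseteq> \<Union>(U ` \<Omega>)" by auto
  then obtain \<F> where "finite \<F>" "\<F> \<subseteq> U ` \<Omega>" "topspace X \<subseteq> \<Union>\<F>"
    using compact[unfolded compact_space_alt] by metis
  then obtain F where "finite F" "F \<subseteq> \<Omega>" "\<Omega> \<subseteq> \<Union>(U ` F)"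
    by (metis finite_subset_image topspace_tiling_topology)
  moreover have "\<exists>S\<in>F. eps_close (e S) S T" if "T \<in> \<Omega>" for T
    using that U calculation by blast
  ultimately show ?thesis using that by blast
qed

text \<open>The form in which compactness is used most often: an estimate with a constant that may depend
  on a neighbourhood holds with one constant for the whole space.\<close>

lemma uniform_if_local:
  assumes local: "\<And>T. T \<in> \<Omega> \<Longrightarrow> \<exists>e>0. \<forall>T'\<in>\<Omega>. eps_close e T T' \<longrightarrow> P T' e"
    and mono: "\<And>T d e. P T e \<Longrightarrow> 0 < d \<Longrightarrow> d \<le> (e::real) \<Longrightarrow> P T d"
  shows "\<exists>d>0. \<forall>T\<in>\<Omega>. P T d"
proof -
  obtain e where e: "\<And>T. T \<in> \<Omega> \<Longrightarrow> 0 < e T"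
    "\<And>T T'. T \<in> \<Omega> \<Longrightarrow> T' \<in> \<Omega> \<Longrightarrow> eps_close (e T) T T' \<Longrightarrow> P T' (e T)"
    using local by metis
  obtain F where F: "finite F" "F \<subseteq> \<Omega>" "\<And>T. T \<in> \<Omega> \<Longrightarrow> \<exists>S\<in>F. eps_close (e S) S T"
    using finite_close_cover[of e] e(1) by blast
  obtain d where d: "0 < d" "\<And>S. S \<in> F \<Longrightarrow> d \<le> e S"
    using finite_pos_lower_bound[OF F(1), of e] e(1) F(2) by blast
  have "P T d" if T: "T \<in> \<Omega>" for T
  proof -
    obtain S where "S \<in> F" "eps_close (e S) S T" using F(3)[OF T] by blast
    then have "d \<le> e S" "P T (e S)" using d(2) e(2) F(2) T by blast+
    with mono d(1) show ?thesis by blast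
  qed
  with d(1) show ?thesis by blast
qed

end


section \<open>Tilings and Delone sets are locally finite\<close>

lemma finite_if_separated:
  fixes p :: "'a \<Rightarrow> 'v::euclidean_space"
  assumes "0 < r" and sep: "\<And>s t. s \<in> S \<Longrightarrow> t \<in> S \<Longrightarrow> s \<noteq> t \<Longrightarrow> r \<le> dist (p s) (p t)"
    and "bounded (p ` S)"
  shows "finite S"
proof (rule ccontr)
  assume "infinite S"
  moreover have "inj_on p S" using sep assms(1) by (force simp: inj_on_def)
  ultimately have "infinite (p ` S)" by (simp add: finite_image_iff)
  moreover have "compact (closure (p ` S))" using assms(3) by (simp add: compact_closure)
  ultimately obtain x where x: "x islimpt p ` S"
    unfolding compact_eq_Bolzano_Weierstrass using closure_subset by metis
  obtain s where s: "s \<in> S" "p s \<noteq> x" "dist (p s) x < r/2"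
    using x[unfolded islimpt_approachable, rule_format, of "r/2"] assms(1) by auto
  obtain t where t: "t \<in> S" "p t \<noteq> x" "dist (p t) x < min (r/2) (dist (p s) x)"
    using x[unfolded islimpt_approachable, rule_format, of "min (r/2) (dist (p s) x)"] assms(1) s(2)
    by auto
  have "dist (p s) (p t) < r" using s(3) t(3) dist_triangle2[of "p s" "p t" x] by auto
  moreover have "s \<noteq> t" using t(3) by auto
  ultimately show False using sep[OF s(1) t(1)] by simp
qed

text \<open>A convex set that is Hausdorff close to one containing a ball contains a smaller concentric
  ball: a hyperplane separating it from a point \<open>y\<close> of the smaller ball would keep it away from the
  part of the larger ball that lies beyond \<open>y\<close>.\<close>

lemma ball_subset_near_convex:
  fixes A B :: "'v::euclidean_space set"
  assumes "ball c \<rho> \<subseteq> A" "compact A" "convex B" "compact B" "B \<noteq> {}" "hausdorff_dist A B < \<rho>/2"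
  shows "ball c (\<rho>/2) \<subseteq> B"
proof
  fix y assume y: "y \<in> ball c (\<rho>/2)"
  show "y \<in> B"
  proof (rule ccontr)
    assume "y \<notin> B"
    then obtain a b where ab: "a \<bullet> y < b" "\<And>x. x \<in> B \<Longrightarrow> b < a \<bullet> x"
      using separating_hyperplane_closed_point[OF assms(3) compact_imp_closed[OF assms(4)]] by blast
    have "a \<noteq> 0" using ab assms(5) by force
    define q where "q = y - (\<rho>/2) *\<^sub>R sgn a"
    have pos: "0 < \<rho>" using hausdorff_dist_nonneg[of A B] assms(6) by linarith
    have "dist y q = \<rho>/2" using pos \<open>a \<noteq> 0\<close> by (simp add: q_def dist_norm norm_sgn)
    then have "q \<in> ball c \<rho>" using y dist_triangle[of c q y] by auto
    then obtain x where x: "x \<in> B" "dist q x \<le> hausdorff_dist A B"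
      using hausdorff_dist_near[OF assms(2,4,5), of q] assms(1) by blast
    have "a \<bullet> (x - q) \<le> norm a * norm (x - q)" by (rule norm_cauchy_schwarz)
    also have "\<dots> \<le> norm a * (\<rho>/2)"
      using x(2) assms(6) by (intro mult_left_mono) (auto simp: dist_norm norm_minus_commute)
    finally have "a \<bullet> x \<le> a \<bullet> q + norm a * (\<rho>/2)" by (simp add: inner_diff_right)
    moreover have "a \<bullet> sgn a = norm a"
      using \<open>a \<noteq> 0\<close>
      by (simp add: sgn_div_norm power2_norm_eq_inner[symmetric] power2_eq_square divide_simps)
    then have "a \<bullet> q = a \<bullet> y - norm a * (\<rho>/2)"
      by (simp add: q_def inner_diff_right)
    ultimately show False using ab(1) ab(2)[OF x(1)] by simp
  qed
qed

lemma translate_tile_bound: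
  assumes "t = translate_tile u x" "t \<in> patch T 0 R" "fst u \<subseteq> cball 0 M"
  shows "norm x \<le> R + M"
proof -
  obtain a where a: "a \<in> fst u" "norm (a - x) < R"
    using assms(1,2) by (auto simp: in_patch_iff)
  then have "norm a \<le> M" using assms(3) by auto
  with a(2) norm_triangle_ineq4[of a "a - x"] show ?thesis by simp
qed

text \<open>Finitely many prototiles represent all up to a small Hausdorff error. The tiles near one of
  them contain a ball of fixed size around a marked point, so these points are separated.\<close>

lemma finite_patch_tiling:
  assumes P: "prototile_set P" and T: "is_tiling P T"
  shows "finite (patch T 0 R)"
proof -
  interpret H: Metric_space "{A::(real^'d) set. compact A \<and> A \<noteq> {}}" hausdorff_dist
    by (rule Metric_space_hausdorff)
  define P1 where "P1 = fst ` P"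
  have P1: "polytope A" "interior A \<noteq> {}" if "A \<in> P1" for A
    using P that by (auto simp: prototile_set_def P1_def)
  have carrier: "compact A \<and> A \<noteq> {}" if "A \<in> P1" for A
    using P1[OF that] polytope_imp_compact by auto
  have "\<exists>c \<rho>. 0 < \<rho> \<and> ball c \<rho> \<subseteq> A" if "A \<in> P1" for A
    using P1(2)[OF that] by (meson all_not_in_conv mem_interior)
  then obtain c \<rho> where c: "\<And>A. A \<in> P1 \<Longrightarrow> 0 < \<rho> A \<and> ball (c A) (\<rho> A) \<subseteq> A" by metis
  have "compactin (prod_topology hausdorff_topology euclidean) P"
    using P by (simp add: prototile_set_def)
  then have "compactin hausdorff_topology P1"
    unfolding P1_def by (rule image_compactin[OF _ continuous_map_fst])
  moreover have "P1 \<subseteq> (\<Union>A\<in>P1. H.mball A (\<rho> A / 2))"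
    using c carrier by (force simp: H.in_mball)
  ultimately obtain \<F> where "finite \<F>" "\<F> \<subseteq> (\<lambda>A. H.mball A (\<rho> A / 2)) ` P1" "P1 \<subseteq> \<Union>\<F>"
    using compactinD[of hausdorff_topology P1 "(\<lambda>A. H.mball A (\<rho> A / 2)) ` P1"] by blast
  moreover from calculation obtain F where "finite F" "F \<subseteq> P1" "\<F> = (\<lambda>A. H.mball A (\<rho> A / 2)) ` F"
    using finite_subset_image[of \<F> "\<lambda>A. H.mball A (\<rho> A / 2)" P1] by blast
  ultimately have F: "finite F" "F \<subseteq> P1" "P1 \<subseteq> (\<Union>A\<in>F. H.mball A (\<rho> A / 2))" by blast+
  define S where "S A = {t \<in> patch T 0 R. \<exists>u\<in>P. \<exists>x. t = translate_tile u x \<and>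
      hausdorff_dist A (fst u) < \<rho> A / 2}" for A
  have "finite (S A)" if "A \<in> F" for A
  proof -
    have A: "A \<in> P1" using that F by blast
    have \<rho>: "0 < \<rho> A" using c[OF A] by simp
    have "\<forall>t\<in>S A. \<exists>x u. u \<in> P \<and> t = translate_tile u x \<and> hausdorff_dist A (fst u) < \<rho> A / 2"
      unfolding S_def by blast
    then obtain p u where pu: "\<And>t. t \<in> S A \<Longrightarrow> u t \<in> P \<and> t = translate_tile (u t) (p t) \<and>
        hausdorff_dist A (fst (u t)) < \<rho> A / 2"
      by metis
    have uP1: "fst (u t) \<in> P1" if "t \<in> S A" for t using pu[OF that] by (auto simp: P1_def)
    have ball: "ball (c A) (\<rho> A / 2) \<subseteq> fst (u t)" if "t \<in> S A" for t
      using ball_subset_near_convex[of "c A" "\<rho> A" A "fst (u t)"] c[OF A] carrier[OF A]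
        carrier[OF uP1[OF that]] P1(1)[OF uP1[OF that]] pu[OF that] polytope_imp_convex by blast
    have int: "ball (c A - p t) (\<rho> A / 2) \<subseteq> interior (fst t)" if t: "t \<in> S A" for t
    proof (rule interior_maximal)
      have t': "fst t = (\<lambda>a. a - p t) ` fst (u t)" using pu[OF t] fst_translate_tile by metis
      show "ball (c A - p t) (\<rho> A / 2) \<subseteq> fst t"
      proof
        fix x assume "x \<in> ball (c A - p t) (\<rho> A / 2)"
        then have "x + p t \<in> ball (c A) (\<rho> A / 2)" by (simp add: dist_norm algebra_simps)
        with ball[OF t] show "x \<in> fst t"
          unfolding t' by (intro rev_image_eqI[of "x + p t"]) auto
      qed
    qed simp
    show ?thesis
    proof (rule finite_if_separated)
      show "0 < \<rho> A / 2" using \<rho> by simp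
      fix s t assume st: "s \<in> S A" "t \<in> S A" "s \<noteq> t"
      show "\<rho> A / 2 \<le> dist (p s) (p t)"
      proof (rule ccontr)
        assume "\<not> ?thesis"
        then have "c A - p s \<in> ball (c A - p t) (\<rho> A / 2)" by (simp add: dist_norm)
        then have "c A - p s \<in> interior (fst s)" "c A - p s \<in> interior (fst t)"
          using int[OF st(1)] int[OF st(2)] \<rho> by auto
        moreover have "fst s \<inter> fst t \<subseteq> frontier (fst s)"
        proof -
          have "s \<in> T" "t \<in> T" using st patch_subset[of T 0 R] unfolding S_def by blast+
          then show ?thesis using T st(3) unfolding is_tiling_def by blast
        qed
        ultimately show False using interior_subset[of "fst s"] interior_subset[of "fst t"]
          unfolding frontier_def by blast
      qed
    next
      obtain M where "\<forall>x\<in>A. norm x \<le> M"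
        using carrier[OF A] compact_imp_bounded[of A] unfolding bounded_iff by blast
      then have M: "A \<subseteq> cball 0 M" by auto
      have "norm (p t) \<le> R + (M + \<rho> A)" if t: "t \<in> S A" for t
      proof (rule translate_tile_bound)
        show "t = translate_tile (u t) (p t)" "t \<in> patch T 0 R" using pu[OF t] t by (auto simp: S_def)
        show "fst (u t) \<subseteq> cball 0 (M + \<rho> A)"
        proof
          fix x assume "x \<in> fst (u t)"
          then obtain a where "a \<in> A" "dist x a \<le> hausdorff_dist (fst (u t)) A"
            using hausdorff_dist_near[of "fst (u t)" A x] carrier[OF A] carrier[OF uP1[OF t]] by blast
          moreover have "norm a \<le> M" using M \<open>a \<in> A\<close> by auto
          ultimately show "x \<in> cball 0 (M + \<rho> A)"
            using pu[OF t] \<rho> norm_triangle_ineq2[of x a]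
            by (simp add: dist_norm hausdorff_dist_commute)
        qed
      qed
      then show "bounded (p ` S A)" by (intro boundedI) auto
    qed
  qed
  moreover have "patch T 0 R \<subseteq> (\<Union>A\<in>F. S A)"
  proof
    fix t assume t: "t \<in> patch T 0 R"
    then have "t \<in> T" by (simp add: in_patch_iff)
    then have "\<exists>u\<in>P. \<exists>x. t = translate_tile u x" using T by (simp add: is_tiling_def)
    then obtain u x where u: "u \<in> P" "t = translate_tile u x" by blast
    then have "fst u \<in> P1" by (auto simp: P1_def)
    then obtain A where "A \<in> F" "hausdorff_dist A (fst u) < \<rho> A / 2"
      using F(3) by (auto simp: H.in_mball)
    with u t show "t \<in> (\<Union>A\<in>F. S A)" unfolding S_def by blast
  qed
  ultimately show ?thesis using F(1) by (auto intro: finite_subset)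
qed

lemma finite_patch_delone:
  assumes "is_delone L T"
  shows "finite (patch T 0 R)"
proof -
  obtain r where r: "0 < r" "\<And>p l q m. ({p}, l) \<in> T \<Longrightarrow> ({q}, m) \<in> T \<Longrightarrow> ({p}, l) \<noteq> ({q}, m) \<Longrightarrow> r \<le> dist p q"
    using assms unfolding is_delone_def by blast
  have pt: "\<exists>p l. t = ({p}, l)" if "t \<in> T" for t
    using assms that unfolding is_delone_def by (metis prod.collapse)
  show ?thesis
  proof (rule finite_if_separated[OF r(1), where p = "\<lambda>t. the_elem (fst t)"])
    fix s t assume "s \<in> patch T 0 R" "t \<in> patch T 0 R" "s \<noteq> t"
    then show "r \<le> dist (the_elem (fst s)) (the_elem (fst t))"
      using pt[of s] pt[of t] r(2) patch_subset[of T 0 R] by force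
  next
    have "norm (the_elem (fst t)) \<le> R" if "t \<in> patch T 0 R" for t
      using that pt[of t] by (auto simp: in_patch_iff)
    then show "bounded ((\<lambda>t. the_elem (fst t)) ` patch T 0 R)" by (intro boundedI) auto
  qed
qed

lemma compact_tiling_space_if_tiling_space:
  fixes \<Omega> :: "('d::finite, 'l::metric_space) tiling set"
  assumes "tiling_space \<Omega>"
  shows "compact_tiling_space \<Omega>"
proof -
  have tc: "translation_compact \<Omega>" using assms by (auto simp: tiling_space_def delone_space_def)
  have "T \<noteq> {} \<and> proper_tiles T \<and> (\<forall>R. finite (patch T 0 R))" if T: "T \<in> \<Omega>" for T
    using assms unfolding tiling_space_def
  proof (elim disjE exE conjE)
    fix P assume P: "prototile_set P" "\<forall>T\<in>\<Omega>. is_tiling P T"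
    then have tl: "is_tiling P T" using T by blast
    have "proper_tile u" if "u \<in> P" for u
      using P(1) that polytope_imp_compact by (force simp: prototile_set_def proper_tile_def)
    then have "proper_tiles T" using tl by (force simp: is_tiling_def proper_tiles_def)
    moreover have "T \<noteq> {}" using tl by (auto simp: is_tiling_def)
    ultimately show ?thesis using finite_patch_tiling[OF P(1) tl] by blast
  next
    assume "delone_space \<Omega>"
    then obtain L where L: "is_delone L T" using T by (auto simp: delone_space_def)
    then have "proper_tiles T" by (force simp: is_delone_def proper_tiles_def proper_tile_def)
    moreover have "T \<noteq> {}" using L by (auto simp: is_delone_def)
    ultimately show ?thesis using finite_patch_delone[OF L] by blast
  qed
  note * = this
  show ?thesis
  proof
    fix T x R assume T: "T \<in> \<Omega>"
    show "T \<noteq> {}" "proper_tiles T" using *[OF T] by auto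
    have "patch T x R \<subseteq> patch T 0 (norm x + R)" by (rule patch_mono) simp
    then show "finite (patch T x R)" using *[OF T] finite_subset by blast
    show "T \<ominus> x \<in> \<Omega>" using tc T by (simp add: translation_compact_def)
  qed (use tc in \<open>simp add: translation_compact_def\<close>)
qed


section \<open>Continuity of the displacement\<close>

lemma continuous_map_euclideanI:
  fixes f :: "'a \<Rightarrow> 'v::metric_space"
  assumes "\<And>z \<epsilon>. z \<in> topspace Z \<Longrightarrow> 0 < \<epsilon> \<Longrightarrow> \<exists>U. openin Z U \<and> z \<in> U \<and> (\<forall>y\<in>U. dist (f z) (f y) < \<epsilon>)"
  shows "continuous_map Z euclidean f"
  unfolding continuous_map_eq_topcontinuous_at topcontinuous_at_def
proof (intro ballI conjI allI impI)
  fix z V assume z: "z \<in> topspace Z" and V: "openin euclidean V \<and> f z \<in> V"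
  then obtain \<epsilon> where \<epsilon>: "0 < \<epsilon>" "ball (f z) \<epsilon> \<subseteq> V"
    using open_contains_ball[of V] by auto
  obtain U where "openin Z U" "z \<in> U" "\<forall>y\<in>U. dist (f z) (f y) < \<epsilon>" using assms[OF z \<epsilon>(1)] by blast
  with \<epsilon>(2) show "\<exists>U. openin Z U \<and> z \<in> U \<and> (\<forall>y\<in>U. f y \<in> V)" by (intro exI[of _ U]) auto
qed auto

context compact_tiling_space
begin

lemma open_prod_close:
  assumes "openin (prod_topology X euclidean) W" "(T, v) \<in> W"
  obtains e where "0 < e"
    "\<And>T' v'. T' \<in> \<Omega> \<Longrightarrow> eps_close e T T' \<Longrightarrow> norm (v - v' :: real^'d) < e \<Longrightarrow> (T', v') \<in> W"
proof -
  obtain U V where UV: "openin X U" "open V" "T \<in> U" "v \<in> V" "U \<times> V \<subseteq> W"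
    using assms(1)[unfolded openin_prod_topology_alt, rule_format, OF assms(2)] by auto
  obtain e1 where e1: "0 < e1" "\<And>T'. T' \<in> \<Omega> \<Longrightarrow> eps_close e1 T T' \<Longrightarrow> T' \<in> U"
    using open_close[OF UV(1,3)] by blast
  obtain e2 where e2: "0 < e2" "ball v e2 \<subseteq> V" using UV(2,4) open_contains_ball by blast
  show ?thesis
  proof
    show "0 < min e1 e2" using e1(1) e2(1) by simp
    fix T' v' assume *: "T' \<in> \<Omega>" "eps_close (min e1 e2) T T'" "norm (v - v') < min e1 e2"
    then have "T' \<in> U" using e1 e2(1) eps_close_mono[of "min e1 e2" T T' e1] by auto
    moreover have "v' \<in> V" using e2(2) *(3) by (auto simp: dist_norm)
    ultimately show "(T', v') \<in> W" using UV(5) by blast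
  qed
qed

lemma free: "aperiodic \<Omega> \<Longrightarrow> T \<in> \<Omega> \<Longrightarrow> T \<ominus> x = T \<ominus> y \<Longrightarrow> x = y"
  unfolding translate_eq_iff aperiodic_def by (metis right_minus_eq)

text \<open>Freeness at one tiling \<open>T\<close> and one vector \<open>w\<close>; continuity of the action extends it to
  neighbourhoods of both.\<close>

lemma locally_no_return:
  assumes ap: "aperiodic \<Omega>" and T: "T \<in> \<Omega>" and w: "w \<noteq> 0"
  obtains \<eta> where "0 < \<eta>" "\<And>T' w'. T' \<in> \<Omega> \<Longrightarrow> eps_close \<eta> T T' \<Longrightarrow> norm (w - w') < \<eta> \<Longrightarrow>
      \<not> eps_close \<eta> T' (T' \<ominus> w')"
proof -
  have Tw: "T \<ominus> w \<in> \<Omega>" using T translate_closed by blast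
  have "T \<noteq> T \<ominus> w" using free[OF ap T, of 0 w] w by auto
  then obtain e where e: "0 < e" "\<not> eps_close e T (T \<ominus> w)" using close_eqI[OF T Tw] by blast
  obtain d1 where d1: "0 < d1" "d1 \<le> e" "\<And>T U V. T \<in> \<Omega> \<Longrightarrow> U \<in> \<Omega> \<Longrightarrow> V \<in> \<Omega> \<Longrightarrow> eps_close d1 T U \<Longrightarrow>
      eps_close d1 U V \<Longrightarrow> eps_close e T V"
    using close_halve[OF e(1)] by blast
  obtain d2 where d2: "0 < d2" "d2 \<le> d1" "\<And>T U V. T \<in> \<Omega> \<Longrightarrow> U \<in> \<Omega> \<Longrightarrow> V \<in> \<Omega> \<Longrightarrow> eps_close d2 T U \<Longrightarrow>
      eps_close d2 U V \<Longrightarrow> eps_close d1 T V"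
    using close_halve[OF d1(1)] by blast
  obtain d3 where d3: "0 < d3" "\<And>T U v u. T \<in> \<Omega> \<Longrightarrow> U \<in> \<Omega> \<Longrightarrow> norm v \<le> norm w + 1 \<Longrightarrow> norm u \<le> norm w + 1 \<Longrightarrow>
      eps_close d3 T U \<Longrightarrow> norm (v - u) < d3 \<Longrightarrow> eps_close d2 (T \<ominus> v) (U \<ominus> u)"
    using close_translate[OF d2(1)] by blast
  define \<eta> where "\<eta> = min 1 (min d2 d3)"
  have \<eta>: "0 < \<eta>" "\<eta> \<le> 1" "\<eta> \<le> d2" "\<eta> \<le> d3" using d2(1) d3(1) by (auto simp: \<eta>_def)
  show ?thesis
  proof (rule that[OF \<eta>(1)], rule notI)
    fix T' w' assume T': "T' \<in> \<Omega>" and TT': "eps_close \<eta> T T'" and ww': "norm (w - w') < \<eta>"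
      and ret: "eps_close \<eta> T' (T' \<ominus> w')"
    have Tw': "T' \<ominus> w' \<in> \<Omega>" using T' translate_closed by blast
    have "norm w' \<le> norm w + 1"
      using norm_triangle_ineq2[of w' w] ww' \<eta>(2) by (simp add: norm_minus_commute)
    then have "eps_close d2 (T \<ominus> w) (T' \<ominus> w')"
      using T T' TT' ww' \<eta> by (intro d3(2)) (auto intro: eps_close_mono)
    then have 1: "eps_close d1 (T' \<ominus> w') (T \<ominus> w)"
      using eps_close_sym eps_close_mono d2(1,2) by blast
    have "eps_close d1 T (T' \<ominus> w')"
      using T T' Tw' TT' ret \<eta> by (intro d2(3)[of T T']) (auto intro: eps_close_mono)
    then have "eps_close e T (T \<ominus> w)" using d1(3)[OF T Tw' Tw] 1 by blast
    with e(2) show False by blast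
  qed
qed

text \<open>The uniform version, by compactness of \<open>\<Omega> \<times> {w. \<epsilon> \<le> \<bar>w\<bar> \<le> r}\<close>. It plays the role of flow boxes:
  whatever returns close to its starting point after a bounded time has moved only a little.\<close>

lemma no_return:
  assumes ap: "aperiodic \<Omega>" and "0 < \<epsilon>"
  obtains \<delta> where "0 < \<delta>"
    "\<And>T w. T \<in> \<Omega> \<Longrightarrow> norm w \<le> r \<Longrightarrow> eps_close \<delta> T (T \<ominus> w) \<Longrightarrow> norm w < \<epsilon>"
proof -
  define K where "K = cball (0::real^'d) r - ball 0 \<epsilon>"
  have K: "compact K" "0 \<notin> K" using assms(2) by (auto simp: K_def intro: compact_diff)
  have "\<exists>\<delta>>0. \<forall>T\<in>\<Omega>. \<forall>w\<in>K. \<not> eps_close \<delta> T (T \<ominus> w)"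
  proof (rule uniform_if_local)
    fix T assume T: "T \<in> \<Omega>"
    have "\<exists>\<eta>>0. \<forall>T' w'. T' \<in> \<Omega> \<longrightarrow> eps_close \<eta> T T' \<longrightarrow> norm (w - w') < \<eta> \<longrightarrow> \<not> eps_close \<eta> T' (T' \<ominus> w')"
      if "w \<in> K" for w
      using locally_no_return[OF ap T, of w] that K(2) by metis
    then obtain \<eta> where \<eta>: "\<And>w. w \<in> K \<Longrightarrow> 0 < \<eta> w" "\<And>w T' w'. w \<in> K \<Longrightarrow> T' \<in> \<Omega> \<Longrightarrow>
        eps_close (\<eta> w) T T' \<Longrightarrow> norm (w - w') < \<eta> w \<Longrightarrow> \<not> eps_close (\<eta> w) T' (T' \<ominus> w')"
      by metis
    have "K \<subseteq> (\<Union>w\<in>K. ball w (\<eta> w))" using \<eta>(1) by force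
    then obtain C where C: "C \<subseteq> K" "finite C" "K \<subseteq> (\<Union>w\<in>C. ball w (\<eta> w))"
      using compactE_image[OF K(1), of K "\<lambda>w. ball w (\<eta> w)"] by auto
    obtain e where e: "0 < e" "\<And>w. w \<in> C \<Longrightarrow> e \<le> \<eta> w"
      using finite_pos_lower_bound[OF C(2), of \<eta>] \<eta>(1) C(1) by blast
    have "\<not> eps_close e T' (T' \<ominus> w)" if *: "T' \<in> \<Omega>" "eps_close e T T'" "w \<in> K" for T' w
    proof
      assume ret: "eps_close e T' (T' \<ominus> w)"
      obtain c where c: "c \<in> C" "norm (c - w) < \<eta> c" using C(3) *(3) by (auto simp: dist_norm)
      then have "eps_close (\<eta> c) T T'" "eps_close (\<eta> c) T' (T' \<ominus> w)"
        using *(2) ret e eps_close_mono by blast+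
      with \<eta>(2) c C(1) *(1) show False by blast
    qed
    with e(1) show "\<exists>e>0. \<forall>T'\<in>\<Omega>. eps_close e T T' \<longrightarrow> (\<forall>w\<in>K. \<not> eps_close e T' (T' \<ominus> w))"
      by blast
  qed (use eps_close_mono in blast)
  then obtain \<delta> where \<delta>: "0 < \<delta>" "\<And>T w. T \<in> \<Omega> \<Longrightarrow> w \<in> K \<Longrightarrow> \<not> eps_close \<delta> T (T \<ominus> w)" by blast
  have "norm w < \<epsilon>" if "T \<in> \<Omega>" "norm w \<le> r" "eps_close \<delta> T (T \<ominus> w)" for T w
    using \<delta>(2)[OF that(1), of w] that(2,3) by (auto simp: K_def)
  with \<delta>(1) that show ?thesis by blast
qed

end

locale orbit_map = dom: compact_tiling_space \<Omega> + cod: compact_tiling_space \<Omega>'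
  for \<Omega> :: "('d::finite, 'l::metric_space) tiling set" and \<Omega>' :: "('d, 'm::metric_space) tiling set" +
  fixes h :: "('d, 'l) tiling \<Rightarrow> ('d, 'm) tiling"
  assumes continuous: "continuous_map (tiling_topology \<Omega>) (tiling_topology \<Omega>') h"
    and orbits: "preserves_orbits \<Omega> h"
    and aperiodic: "aperiodic \<Omega>'"
begin

lemma maps_to: "T \<in> \<Omega> \<Longrightarrow> h T \<in> \<Omega>'"
  using continuous by (auto simp: continuous_map_def)

lemma displacement_unique:
  assumes "T \<in> \<Omega>" "h (T \<ominus> v) = h T \<ominus> w"
  shows "displacement h T v = w"
  unfolding displacement_def
  using assms cod.free[OF aperiodic maps_to[OF assms(1)]] by (intro the_equality) auto

lemma displacement:
  assumes "T \<in> \<Omega>"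
  shows "h (T \<ominus> v) = h T \<ominus> displacement h T v"
proof -
  have "h (T \<ominus> v) \<in> orbit (h T)"
    using orbits assms translate_in_orbit[of T v] unfolding preserves_orbits_def by blast
  then obtain w where "h (T \<ominus> v) = h T \<ominus> w" by (auto simp: orbit_def)
  with displacement_unique[OF assms] show ?thesis by metis
qed

lemma displacement_0: "T \<in> \<Omega> \<Longrightarrow> displacement h T 0 = 0"
  by (rule displacement_unique) simp_all

lemma displacement_cocycle:
  assumes "T \<in> \<Omega>"
  shows "displacement h T x + displacement h (T \<ominus> x) y = displacement h T (x + y)"
proof -
  have "h (T \<ominus> (x + y)) = h (T \<ominus> x \<ominus> y)" by simp
  also have "\<dots> = h (T \<ominus> x) \<ominus> displacement h (T \<ominus> x) y"
    by (rule displacement[OF dom.translate_closed[OF assms]])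
  also have "\<dots> = h T \<ominus> (displacement h T x + displacement h (T \<ominus> x) y)"
    by (simp add: displacement[OF assms, of x])
  finally show ?thesis using displacement_unique[OF assms] by metis
qed

lemma continuous_path: "continuous_map (prod_topology dom.X euclidean) cod.X (\<lambda>(T, v). h (T \<ominus> v))"
  using continuous_map_compose[OF dom.continuous_translation continuous]
  by (simp add: comp_def case_prod_unfold)

lemma uniformly_small_steps:
  assumes "0 < \<epsilon>"
  obtains \<eta> where "0 < \<eta>" "\<And>T v. T \<in> \<Omega> \<Longrightarrow> norm v < \<eta> \<Longrightarrow> eps_close \<epsilon> (h T) (h (T \<ominus> v))"
proof -
  obtain \<delta> where \<delta>: "0 < \<delta>" "\<And>T U V. T \<in> \<Omega>' \<Longrightarrow> U \<in> \<Omega>' \<Longrightarrow> V \<in> \<Omega>' \<Longrightarrow> eps_close \<delta> T U \<Longrightarrow>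
      eps_close \<delta> U V \<Longrightarrow> eps_close \<epsilon> T V"
    using cod.close_halve[OF assms] by metis
  have "\<exists>\<eta>>0. \<forall>T\<in>\<Omega>. \<forall>v. norm v < \<eta> \<longrightarrow> eps_close \<epsilon> (h T) (h (T \<ominus> v))"
  proof (rule dom.uniform_if_local)
    fix T assume T: "T \<in> \<Omega>"
    have "(T, 0) \<in> topspace (prod_topology dom.X (euclidean :: (real^'d) topology))" using T by simp
    then obtain W where W: "openin (prod_topology dom.X euclidean) W" "(T, 0) \<in> W"
      "\<forall>y\<in>W. eps_close \<delta> (case (T, 0) of (T, v) \<Rightarrow> h (T \<ominus> v)) (case y of (T, v) \<Rightarrow> h (T \<ominus> v))"
      using continuous_path \<delta>(1) unfolding cod.continuous_map_into_iff by metis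
    obtain e where e: "0 < e" "\<And>T' v'. T' \<in> \<Omega> \<Longrightarrow> eps_close e T T' \<Longrightarrow> norm (0 - v') < e \<Longrightarrow> (T', v') \<in> W"
      using dom.open_prod_close[OF W(1,2)] by blast
    have near: "eps_close \<delta> (h T) (h (T' \<ominus> v))" if "T' \<in> \<Omega>" "eps_close e T T'" "norm v < e" for T' v
      using W(3) e(2)[of T' v] that by auto
    have "eps_close \<epsilon> (h T') (h (T' \<ominus> v))" if T': "T' \<in> \<Omega>" "eps_close e T T'" "norm v < e" for T' v
    proof -
      have "eps_close \<delta> (h T) (h T')" using near[OF T'(1,2), of 0] e(1) by simp
      then have "eps_close \<delta> (h T') (h T)" by (rule eps_close_sym)
      then show ?thesis
        using near[OF T'] by (rule \<delta>(2)[OF maps_to[OF T'(1)] maps_to[OF T] maps_to[OF dom.translate_closed[OF T'(1)]]])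
    qed
    with e(1) show "\<exists>e>0. \<forall>T'\<in>\<Omega>. eps_close e T T' \<longrightarrow>
        (\<forall>v. norm v < e \<longrightarrow> eps_close \<epsilon> (h T') (h (T' \<ominus> v)))" by blast
  qed force
  then show ?thesis using that by blast
qed

text \<open>A short path in an orbit could a priori jump between the countably many sheets of the orbit
  that pass near its starting point. The times spent in the different sheets are pairwise disjoint
  closed sets that cover the parameter interval; by a theorem of Sierpinski there is only one.\<close>

lemma small_displacement:
  assumes "0 < \<epsilon>"
  obtains \<eta> where "0 < \<eta>" "\<And>T v. T \<in> \<Omega> \<Longrightarrow> norm v < \<eta> \<Longrightarrow> norm (displacement h T v) < \<epsilon>"
proof -
  \<comment> \<open>With a gap between \<open>1/4\<close> and \<open>1\<close>, being at displacement at most \<open>1\<close> becomes transitive below.\<close>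
  define \<epsilon>' where "\<epsilon>' = min \<epsilon> (1/4)"
  have \<epsilon>': "0 < \<epsilon>'" "\<epsilon>' \<le> \<epsilon>" "\<epsilon>' \<le> 1/4" using assms by (auto simp: \<epsilon>'_def)
  obtain \<delta> where \<delta>: "0 < \<delta>" "\<And>T w. T \<in> \<Omega>' \<Longrightarrow> norm w \<le> 1 \<Longrightarrow> eps_close \<delta> T (T \<ominus> w) \<Longrightarrow> norm w < \<epsilon>'"
    using cod.no_return[OF aperiodic \<epsilon>'(1)] by blast
  obtain \<delta>' where \<delta>': "0 < \<delta>'" "\<And>T U V. T \<in> \<Omega>' \<Longrightarrow> U \<in> \<Omega>' \<Longrightarrow> V \<in> \<Omega>' \<Longrightarrow> eps_close \<delta>' T U \<Longrightarrow>
      eps_close \<delta>' U V \<Longrightarrow> eps_close \<delta> T V"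
    using cod.close_halve[OF \<delta>(1)] by metis
  obtain \<eta> where \<eta>: "0 < \<eta>" "\<And>T v. T \<in> \<Omega> \<Longrightarrow> norm v < \<eta> \<Longrightarrow> eps_close \<delta>' (h T) (h (T \<ominus> v))"
    using uniformly_small_steps[OF \<delta>'(1)] by blast
  have "norm (displacement h T v) < \<epsilon>" if T: "T \<in> \<Omega>" and v: "norm v < \<eta>" for T v
  proof -
    define w where "w t = displacement h T (t *\<^sub>R v)" for t
    define g where "g t = h (T \<ominus> t *\<^sub>R v)" for t
    have g: "g t = h T \<ominus> w t" for t using displacement[OF T] by (simp add: g_def w_def)
    have g\<Omega>: "g t \<in> \<Omega>'" for t using T dom.translate_closed maps_to by (simp add: g_def)
    have hT: "h T \<in> \<Omega>'" using T maps_to by blast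
    have near: "norm (w t - w t') < \<epsilon>'"
      if t: "t \<in> {0..1}" "t' \<in> {0..1}" and "norm (w t - w t') \<le> 1" for t t'
    proof -
      have step: "eps_close \<delta>' (h T) (g t)" if "t \<in> {0..1}" for t
      proof -
        have "norm (t *\<^sub>R v) \<le> 1 * norm v"
          unfolding norm_scaleR using that by (intro mult_right_mono) auto
        then show ?thesis unfolding g_def using \<eta>(2)[OF T, of "t *\<^sub>R v"] v by simp
      qed
      then have "eps_close \<delta> (g t') (g t)"
        using \<delta>'(2)[OF g\<Omega> hT g\<Omega>] t eps_close_sym by blast
      moreover have "g t = g t' \<ominus> (w t - w t')" by (simp add: g)
      ultimately show ?thesis using \<delta>(2)[OF g\<Omega>[of t']] that by simp
    qed
    \<comment> \<open>the times spent in the sheet visited at time \<open>t\<close>\<close>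
    define C where "C t = {t' \<in> {0..1}. norm (w t - w t') \<le> 1}" for t
    have C_eq: "C t = C t'" if "t \<in> {0..1}" "t' \<in> {0..1}" and meet: "C t \<inter> C t' \<noteq> {}" for t t'
    proof -
      obtain s where s: "s \<in> {0..1}" "norm (w t - w s) \<le> 1" "norm (w t' - w s) \<le> 1"
        using meet by (auto simp: C_def)
      have tt': "norm (w t - w t') < 1/2"
        using near[OF that(1) s(1) s(2)] near[OF that(2) s(1) s(3)] \<epsilon>'(3)
          norm_triangle_ineq4[of "w t - w s" "w t' - w s"] by simp
      have "norm (w t - w u) \<le> 1 \<longleftrightarrow> norm (w t' - w u) \<le> 1" if u: "u \<in> {0..1}" for u
        using near[OF \<open>t \<in> {0..1}\<close> u] near[OF \<open>t' \<in> {0..1}\<close> u] tt' \<epsilon>'(3)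
          norm_triangle_ineq[of "w t - w t'" "w t' - w u"]
          norm_triangle_ineq[of "w t' - w t" "w t - w u"] by (auto simp: norm_minus_commute)
      then show ?thesis unfolding C_def by blast
    qed
    have C_self: "t \<in> C t" if "t \<in> {0..1}" for t using that by (simp add: C_def)
    have "C ` {0..1} = {{0..1}}"
    proof (rule real_Sierpinski_lemma)
      show "pairwise disjnt (C ` {0..1})"
        using C_eq unfolding pairwise_def disjnt_def by blast
      show "\<Union> (C ` {0..1}) = {0..1}" using C_self by (auto simp: C_def)
      show "countable (C ` {0..1})"
      proof -
        \<comment> \<open>Different sheets have disjoint open neighbourhoods in the space of displacements.\<close>
        define N where "N S = (\<Union>t\<in>S. ball (w t) (1/4))" for S
        have disj: "disjnt (N (C s)) (N (C t))" if "s \<in> {0..1}" "t \<in> {0..1}" "C s \<noteq> C t" for s t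
        proof (rule ccontr)
          assume "\<not> ?thesis"
          then obtain x s' t' where x: "s' \<in> C s" "t' \<in> C t" "dist (w s') x < 1/4" "dist (w t') x < 1/4"
            by (auto simp: N_def disjnt_iff)
          then have "norm (w s' - w t') \<le> 1"
            using dist_triangle2[of "w s'" "w t'" x] by (simp add: dist_norm)
          moreover have mem: "s' \<in> {0..1}" "t' \<in> {0..1}" using x(1,2) by (auto simp: C_def)
          ultimately have "t' \<in> C s'" by (simp add: C_def)
          then have "C s' = C t'" using C_eq[OF mem] C_self[OF mem(2)] by blast
          moreover have "C s' = C s" using C_eq[OF mem(1) that(1)] C_self[OF mem(1)] x(1) by blast
          moreover have "C t' = C t" using C_eq[OF mem(2) that(2)] C_self[OF mem(2)] x(2) by blast
          ultimately show False using that(3) by simp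
        qed
        have "countable (N ` C ` {0..1})"
        proof (rule countable_disjoint_open_subsets)
          show "pairwise disjnt (N ` C ` {0..1})"
          proof (rule pairwiseI)
            fix A B assume AB: "A \<in> N ` C ` {0..1}" "B \<in> N ` C ` {0..1}" "A \<noteq> B"
            then obtain s t where st: "s \<in> {0..1}" "t \<in> {0..1}" "A = N (C s)" "B = N (C t)" by blast
            with AB(3) have "C s \<noteq> C t" by auto
            then show "disjnt A B" unfolding st(3,4) by (rule disj[OF st(1,2)])
          qed
        qed (auto simp: N_def)
        moreover have "inj_on N (C ` {0..1})"
        proof (rule inj_onI)
          fix A B assume AB: "A \<in> C ` {0..1}" "B \<in> C ` {0..1}" "N A = N B"
          then obtain s t where st: "s \<in> {0..1}" "t \<in> {0..1}" "A = C s" "B = C t" by blast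
          have "w s \<in> N A" using C_self[OF st(1)] by (auto simp: N_def st(3) intro!: bexI[of _ s])
          then have "\<not> disjnt (N (C s)) (N (C t))" using AB(3) st(3,4) unfolding disjnt_def by blast
          then show "A = B" using disj[OF st(1,2)] st(3,4) by blast
        qed
        ultimately show ?thesis by (rule countable_image_inj_on)
      qed
      fix D assume "D \<in> C ` {0..1}"
      then obtain t where t: "t \<in> {0..1}" "D = C t" by blast
      define K where "K = (\<lambda>u. h T \<ominus> u) ` cball (w t) 1"
      have "continuous_map euclidean (prod_topology cod.X euclidean) (\<lambda>u::real^'d. (h T, u))"
        using hT by (intro continuous_map_pairedI) (auto simp: continuous_map_id[unfolded id_def])
      from continuous_map_compose[OF this cod.continuous_translation]
      have orb: "continuous_map euclidean cod.X (\<lambda>u. h T \<ominus> u)" by (simp add: comp_def)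
      then have "compactin cod.X K"
        unfolding K_def by (intro image_compactin[of euclidean]) simp_all
      then have K: "closedin cod.X K" using cod.Hausdorff by (rule compactin_imp_closedin[rotated])
      have "continuous_map euclidean (prod_topology dom.X euclidean) (\<lambda>s. (T, s *\<^sub>R v))"
        using T by (intro continuous_map_pairedI) (auto simp: continuous_map_iff_continuous2 intro!: continuous_intros)
      from continuous_map_compose[OF this continuous_path]
      have "continuous_map euclidean cod.X g" by (simp add: comp_def g_def[abs_def])
      then have "closed {s. g s \<in> K}"
        using closedin_continuous_map_preimage[OF _ K] by fastforce
      moreover have "D = {0..1} \<inter> {s. g s \<in> K}"
      proof -
        have "h T \<ominus> x = h T \<ominus> y \<longleftrightarrow> x = y" for x y
          using cod.free[OF aperiodic hT] by blast
        then have "g s \<in> K \<longleftrightarrow> norm (w t - w s) \<le> 1" for s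
          by (auto simp: K_def g dist_norm)
        then show ?thesis by (auto simp: t(2) C_def)
      qed
      ultimately show "closed D \<and> D \<noteq> {}" using C_self[OF t(1)] t(2) by auto
    qed simp
    moreover have "C 0 \<in> C ` {0..1}" by (rule imageI) simp
    ultimately have "1 \<in> C 0" by auto
    then have "norm (w 0 - w 1) < \<epsilon>'" by (intro near) (auto simp: C_def)
    then show ?thesis using displacement_0[OF T] \<epsilon>'(2) by (simp add: w_def)
  qed
  with \<eta>(1) that show ?thesis by blast
qed

lemma bounded_displacement:
  obtains C where "\<And>T v. T \<in> \<Omega> \<Longrightarrow> norm v \<le> \<rho> \<Longrightarrow> norm (displacement h T v) \<le> C"
proof -
  obtain \<eta> where \<eta>: "0 < \<eta>" "\<And>T v. T \<in> \<Omega> \<Longrightarrow> norm v < \<eta> \<Longrightarrow> norm (displacement h T v) < 1"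
    using small_displacement[of 1] by auto
  obtain n :: nat where n: "\<rho> / \<eta> < n" using reals_Archimedean2 by blast
  have "norm (displacement h T (real k *\<^sub>R u)) \<le> k" if "T \<in> \<Omega>" "norm u < \<eta>" for T u k
  proof (induction k)
    case (Suc k)
    have "displacement h T (real (Suc k) *\<^sub>R u) =
        displacement h T (real k *\<^sub>R u) + displacement h (T \<ominus> real k *\<^sub>R u) u"
      using displacement_cocycle[OF that(1)] by (simp add: algebra_simps)
    moreover have "norm (displacement h (T \<ominus> real k *\<^sub>R u) u) < 1"
      using \<eta>(2) dom.translate_closed that by blast
    ultimately show ?case using Suc norm_triangle_ineq
      by (smt (verit) of_nat_Suc)
  qed (simp add: displacement_0 that)
  note * = this
  show ?thesis
  proof
    fix T and v :: "real^'d" assume T: "T \<in> \<Omega>" and v: "norm v \<le> \<rho>"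
    show "norm (displacement h T v) \<le> Suc n"
    proof -
      have "\<rho> < n * \<eta>" using n \<eta>(1) by (simp add: field_simps)
      also have "\<dots> < Suc n * \<eta>" using \<eta>(1) by simp
      finally have "norm (v /\<^sub>R real (Suc n)) < \<eta>" using v by (simp add: field_simps)
      from *[OF T this, of "Suc n"] show ?thesis by simp
    qed
  qed
qed

text \<open>Once displacements are bounded, \<open>no_return\<close> turns closeness of the images into closeness of the
  displacements: \<open>h T - a0\<close> and \<open>h T - a\<close> are both close to \<open>h T0 - a0\<close>, so \<open>a - a0\<close> is small.\<close>

lemma continuous_displacement:
  "continuous_map (prod_topology dom.X euclidean) euclidean (\<lambda>(T, v). displacement h T v)"
proof (rule continuous_map_euclideanI)
  fix z and \<epsilon> :: real
  assume "z \<in> topspace (prod_topology dom.X (euclidean :: (real^'d) topology))" and \<epsilon>: "0 < \<epsilon>"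
  then obtain T0 v0 where z: "z = (T0, v0)" and T0: "T0 \<in> \<Omega>" by auto
  define a0 where "a0 = displacement h T0 v0"
  obtain C where C: "\<And>T v. T \<in> \<Omega> \<Longrightarrow> norm v \<le> norm v0 + 1 \<Longrightarrow> norm (displacement h T v) \<le> C"
    using bounded_displacement by blast
  obtain \<delta> where \<delta>: "0 < \<delta>" "\<And>T w. T \<in> \<Omega>' \<Longrightarrow> norm w \<le> 2 * C \<Longrightarrow> eps_close \<delta> T (T \<ominus> w) \<Longrightarrow> norm w < \<epsilon>"
    using cod.no_return[OF aperiodic \<epsilon>] by blast
  obtain d where d: "0 < d" "\<And>T U V. T \<in> \<Omega>' \<Longrightarrow> U \<in> \<Omega>' \<Longrightarrow> V \<in> \<Omega>' \<Longrightarrow> eps_close d T U \<Longrightarrow>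
      eps_close d U V \<Longrightarrow> eps_close \<delta> T V"
    using cod.close_halve[OF \<delta>(1)] by metis
  have "z \<in> topspace (prod_topology dom.X (euclidean :: (real^'d) topology))" using T0 z by simp
  then obtain W1 where W1: "openin (prod_topology dom.X euclidean) W1" "z \<in> W1"
    "\<forall>y\<in>W1. eps_close d (case z of (T, v) \<Rightarrow> h (T \<ominus> v)) (case y of (T, v) \<Rightarrow> h (T \<ominus> v))"
    using continuous_path d(1) unfolding cod.continuous_map_into_iff by metis
  have "continuous_map dom.X (prod_topology cod.X euclidean) (\<lambda>T. (h T, a0))"
    using continuous by (intro continuous_map_pairedI) auto
  from continuous_map_compose[OF this cod.continuous_translation]
  have "continuous_map dom.X cod.X (\<lambda>T. h T \<ominus> a0)" by (simp add: comp_def)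
  then obtain U2 where U2: "openin dom.X U2" "T0 \<in> U2" "\<forall>T\<in>U2. eps_close d (h T0 \<ominus> a0) (h T \<ominus> a0)"
    using T0 d(1) unfolding cod.continuous_map_into_iff by (metis topspace_tiling_topology)
  define W where "W = W1 \<inter> (U2 \<times> ball v0 1)"
  have "openin (prod_topology dom.X euclidean) W"
    unfolding W_def using W1(1) U2(1) by (intro openin_Int) (auto simp: openin_prod_Times_iff)
  moreover have "z \<in> W" using W1(2) U2(2) by (simp add: W_def z)
  moreover have "dist (displacement h T0 v0) (displacement h T v) < \<epsilon>" if Tv: "(T, v) \<in> W" for T v
  proof -
    have T: "T \<in> \<Omega>" using Tv openin_subset[OF U2(1)] by (auto simp: W_def)
    define a where "a = displacement h T v"
    have "norm v \<le> norm v0 + 1"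
      using Tv norm_triangle_ineq2[of v v0] by (auto simp: W_def dist_norm norm_minus_commute)
    then have "norm (a - a0) \<le> 2 * C"
      using C[OF T, of v] C[OF T0, of v0] norm_triangle_ineq4[of a a0] by (simp add: a_def a0_def)
    moreover have "eps_close \<delta> (h T \<ominus> a0) (h T \<ominus> a0 \<ominus> (a - a0))"
    proof (rule d(2))
      show "h T \<ominus> a0 \<in> \<Omega>'" "h T0 \<ominus> a0 \<in> \<Omega>'" "h T \<ominus> a0 \<ominus> (a - a0) \<in> \<Omega>'"
        using T T0 maps_to cod.translate_closed by blast+
      show "eps_close d (h T \<ominus> a0) (h T0 \<ominus> a0)"
        using U2(3) Tv by (auto simp: W_def intro: eps_close_sym)
      have "eps_close d (h (T0 \<ominus> v0)) (h (T \<ominus> v))" using W1(3) Tv by (auto simp: W_def z)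
      then show "eps_close d (h T0 \<ominus> a0) (h T \<ominus> a0 \<ominus> (a - a0))"
        using displacement[OF T] displacement[OF T0] by (simp add: a_def a0_def)
    qed
    ultimately have "norm (a - a0) < \<epsilon>"
      using \<delta>(2)[of "h T \<ominus> a0"] T maps_to cod.translate_closed by blast
    then show ?thesis by (simp add: a_def a0_def dist_norm norm_minus_commute)
  qed
  ultimately show "\<exists>U. openin (prod_topology dom.X euclidean) U \<and> z \<in> U \<and>
      (\<forall>y\<in>U. dist (case z of (T, v) \<Rightarrow> displacement h T v) (case y of (T, v) \<Rightarrow> displacement h T v) < \<epsilon>)"
    by (intro exI[of _ W]) (auto simp: z)
qed

lemma weak_cocycle_displacement: "weak_cocycle \<Omega> (displacement h)"
  using continuous_displacement displacement_cocycle by (auto simp: weak_cocycle_def)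

end


section \<open>Factor maps from cobounding functions\<close>

text \<open>If \<open>s\<close> cobounds the difference of the two displacements, then moving \<open>h2 T\<close> by \<open>s T\<close> makes its
  displacement equal to that of \<open>h1\<close>. Moving it by \<open>t s(T)\<close> with \<open>0 \<le> t \<le> 1\<close> gives the homotopy.\<close>

lemma factor_map_if_displacements_cohomologous:
  fixes \<Omega> :: "('d::finite, 'l::metric_space) tiling set"
    and \<Omega>1 :: "('d, 'm::metric_space) tiling set"
    and \<Omega>2 :: "('d, 'n::metric_space) tiling set"
  assumes h1: "orbit_map \<Omega> \<Omega>1 h1" and h2: "orbit_map \<Omega> \<Omega>2 h2"
    and equiv: "orbit_equivalence \<Omega> \<Omega>1 h1" and onto: "h2 ` \<Omega> = \<Omega>2" and minimal: "minimal_space \<Omega>2"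
    and s: "continuous_map (tiling_topology \<Omega>) euclidean s"
    and cob: "\<And>T v. T \<in> \<Omega> \<Longrightarrow> displacement h1 T v - displacement h2 T v = s (T \<ominus> v) - s T"
  obtains \<phi> where "factor_map \<Omega>1 \<Omega>2 \<phi>"
    "homotopic_with (\<lambda>_. True) (tiling_topology \<Omega>) (tiling_topology \<Omega>2) h2 (\<phi> \<circ> h1)"
    "\<And>T. T \<in> \<Omega> \<Longrightarrow> \<phi> (h1 T) = h2 T \<ominus> s T"
proof -
  interpret h1: orbit_map \<Omega> \<Omega>1 h1 by (rule h1)
  interpret h2: orbit_map \<Omega> \<Omega>2 h2 by (rule h2)
  let ?X = "tiling_topology \<Omega>" and ?X1 = "tiling_topology \<Omega>1" and ?X2 = "tiling_topology \<Omega>2"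
  have "homeomorphic_map ?X ?X1 h1" using equiv by (simp add: orbit_equivalence_def)
  then obtain k where k: "homeomorphic_maps ?X ?X1 h1 k" by (auto simp: homeomorphic_map_maps)
  then have k_cont: "continuous_map ?X1 ?X k"
    and k_h1: "\<And>T. T \<in> \<Omega> \<Longrightarrow> k (h1 T) = T" and h1_k: "\<And>S. S \<in> \<Omega>1 \<Longrightarrow> h1 (k S) = S"
    by (auto simp: homeomorphic_maps_def)
  have k_in: "k S \<in> \<Omega>" if "S \<in> \<Omega>1" for S using k_cont that by (auto simp: continuous_map_def)
  define \<psi> where "\<psi> T = h2 T \<ominus> s T" for T
  define \<phi> where "\<phi> = \<psi> \<circ> k"
  have move: "continuous_map Z ?X2 (\<lambda>z. f z \<ominus> g z)"
    if "continuous_map Z ?X2 f" "continuous_map Z euclidean g" for Z :: "'z topology" and f g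
    using continuous_map_compose[OF continuous_map_pairedI[OF that] h2.cod.continuous_translation]
    by (simp add: comp_def)
  have \<psi>: "continuous_map ?X ?X2 \<psi>"
    unfolding \<psi>_def[abs_def] by (rule move[OF h2.continuous s])
  have \<phi>_cont: "continuous_map ?X1 ?X2 \<phi>"
    unfolding \<phi>_def by (rule continuous_map_compose[OF k_cont \<psi>])
  have \<psi>_translate: "\<psi> (T \<ominus> v) = \<psi> T \<ominus> displacement h1 T v" if T: "T \<in> \<Omega>" for T v
    using cob[OF T, of v] by (simp add: \<psi>_def h2.displacement[OF T] algebra_simps)
  have equivariant: "\<phi> (S \<ominus> w) = \<phi> S \<ominus> w" if S: "S \<in> \<Omega>1" for S w
  proof -
    define T where "T = k S"
    have T: "T \<in> \<Omega>" "h1 T = S" using S k_in h1_k by (auto simp: T_def)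
    have "S \<ominus> w \<in> h1 ` orbit T"
      using equiv T translate_in_orbit[of S w] by (auto simp: orbit_equivalence_def)
    then obtain v where v: "S \<ominus> w = h1 (T \<ominus> v)" by (auto simp: orbit_def)
    then have "displacement h1 T v = w" using h1.displacement_unique[OF T(1)] T(2) by auto
    then show ?thesis
      using \<psi>_translate[OF T(1), of v] T h1.dom.translate_closed k_h1 v by (simp add: \<phi>_def T_def)
  qed
  have "\<phi> ` \<Omega>1 = \<Omega>2"
  proof
    show "\<phi> ` \<Omega>1 \<subseteq> \<Omega>2" using \<phi>_cont by (auto simp: continuous_map_def)
    show "\<Omega>2 \<subseteq> \<phi> ` \<Omega>1"
    proof (cases "\<Omega> = {}")
      case False
      then obtain T where T: "T \<in> \<Omega>" by blast
      then have S: "h1 T \<in> \<Omega>1" by (rule h1.maps_to)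
      have "compactin ?X1 \<Omega>1" using h1.cod.compact by (simp add: compact_space_def)
      then have "compactin ?X2 (\<phi> ` \<Omega>1)" using \<phi>_cont by (rule image_compactin)
      then have closed: "closedin ?X2 (\<phi> ` \<Omega>1)" by (rule compactin_imp_closedin[OF h2.cod.Hausdorff])
      have "orbit (\<phi> (h1 T)) \<subseteq> \<phi> ` \<Omega>1"
        using equivariant[OF S] h1.cod.translate_closed[OF S] by (fastforce simp: orbit_def)
      then have "?X2 closure_of orbit (\<phi> (h1 T)) \<subseteq> \<phi> ` \<Omega>1" using closed by (rule closure_of_minimal)
      moreover have "\<phi> (h1 T) \<in> \<Omega>2" using \<phi>_cont S by (auto simp: continuous_map_def)
      ultimately show ?thesis using minimal by (auto simp: minimal_space_def)
    qed (use onto in auto)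
  qed
  then have "factor_map \<Omega>1 \<Omega>2 \<phi>" using \<phi>_cont equivariant by (simp add: factor_map_def)
  moreover have \<phi>_h1: "\<phi> (h1 T) = h2 T \<ominus> s T" if "T \<in> \<Omega>" for T
    using that k_h1 by (simp add: \<phi>_def \<psi>_def)
  moreover have "homotopic_with (\<lambda>_. True) ?X ?X2 h2 (\<phi> \<circ> h1)"
  proof (rule homotopic_with_eq)
    define H where "H = (\<lambda>(t::real, T). h2 T \<ominus> (t *\<^sub>R s T))"
    let ?I = "prod_topology (top_of_set {0..1::real}) ?X"
    have snd: "continuous_map ?I ?X snd" by (rule continuous_map_snd)
    have fst: "continuous_map ?I euclidean fst"
      using continuous_map_fst continuous_map_into_fulltopology by blast
    have "continuous_map ?I euclidean (\<lambda>z. fst z *\<^sub>R s (snd z))"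
      using fst continuous_map_compose[OF snd s]
      by (auto simp: continuous_map_atin limitin_canonical_iff comp_def intro!: tendsto_scaleR)
    moreover have "continuous_map ?I ?X2 (\<lambda>z. h2 (snd z))"
      using continuous_map_compose[OF snd h2.continuous] by (simp add: comp_def)
    ultimately have "continuous_map ?I ?X2 H"
      unfolding H_def case_prod_unfold by (intro move)
    then show "homotopic_with (\<lambda>_. True) ?X ?X2 (\<lambda>T. H (0, T)) (\<lambda>T. H (1, T))"
      by (auto simp: homotopic_with_def)
    show "h2 T = H (0, T)" if "T \<in> topspace ?X" for T by (simp add: H_def)
    show "(\<phi> \<circ> h1) T = H (1, T)" if "T \<in> topspace ?X" for T using that \<phi>_h1 by (simp add: H_def)
  qed simp_all
  ultimately show ?thesis using that by blast
qed

text \<open>The continuity of the displacement enters here: it puts the displacement into its own coset.\<close>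

lemma cohomologous_if_weak_class_eq:
  assumes h1: "orbit_map \<Omega> \<Omega>1 h1" and eq: "weak_class_of_map \<Omega> h1 = weak_class_of_map \<Omega> h2"
  obtains s where "continuous_map (tiling_topology \<Omega>) euclidean s"
    "\<And>T v. T \<in> \<Omega> \<Longrightarrow> displacement h1 T v - displacement h2 T v = s (T \<ominus> v) - s T"
proof -
  have "weak_coboundary \<Omega> (\<lambda>T v. 0)"
    unfolding weak_coboundary_def by (intro exI[of _ "\<lambda>_. 0"]) simp
  then have "displacement h1 \<in> weak_class_of_map \<Omega> h1"
    using orbit_map.weak_cocycle_displacement[OF h1] by (simp add: weak_class_of_map_def weak_class_def)
  then have "displacement h1 \<in> weak_class \<Omega> (displacement h2)" using eq by (simp add: weak_class_of_map_def)
  then show ?thesis using that unfolding weak_class_def weak_coboundary_def by blast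
qed


section \<open>Rigidity of patches under finite local complexity\<close>

text \<open>A fixed finite pattern that can be moved arbitrarily near to \<open>P\<close> is a translate of \<open>P\<close>: the
  translations involved are bounded, and a limit of them moves the pattern onto \<open>P\<close>.\<close>

lemma near_pattern_is_translate:
  assumes P: "P \<noteq> {}" "\<And>t. t \<in> P \<Longrightarrow> proper_tile t" "\<And>t. t \<in> P \<Longrightarrow> proper_tile (\<beta> t)" and \<epsilon>: "0 < \<epsilon>"
  obtains \<delta> where "0 < \<delta>" "\<And>y. (\<And>t. t \<in> P \<Longrightarrow> tile_near \<delta> t (translate_tile (\<beta> t) y)) \<Longrightarrow>
      \<exists>w. norm w < \<epsilon> \<and> (\<forall>t\<in>P. translate_tile (\<beta> t) y = translate_tile t w)"
proof -
  define near where "near \<delta> y \<longleftrightarrow> (\<forall>t\<in>P. tile_near \<delta> t (translate_tile (\<beta> t) y))" for \<delta> y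
  define moved where "moved y \<longleftrightarrow>
      (\<exists>w. norm w < \<epsilon> \<and> (\<forall>t\<in>P. translate_tile (\<beta> t) y = translate_tile t w))" for y
  have "\<exists>\<delta>>0. \<forall>y. near \<delta> y \<longrightarrow> moved y"
  proof (rule ccontr)
    assume neg: "\<not> (\<exists>\<delta>>0. \<forall>y. near \<delta> y \<longrightarrow> moved y)"
    have "\<exists>y. near (1 / real (Suc n)) y \<and> \<not> moved y" for n
    proof -
      have "0 < 1 / real (Suc n)" by simp
      with neg show ?thesis by blast
    qed
    then obtain y where "\<And>n. near (1 / real (Suc n)) (y n) \<and> \<not> moved (y n)" by metis
    then have y: "\<And>n t. t \<in> P \<Longrightarrow> tile_near (1 / real (Suc n)) t (translate_tile (\<beta> t) (y n))"
      "\<And>n. \<not> moved (y n)"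
      by (auto simp: near_def)
    obtain t0 where t0: "t0 \<in> P" using P(1) by blast
    then obtain a where "a \<in> fst t0" using P(2)[of t0] unfolding proper_tile_def by blast
    note t0 = t0 this
    obtain M where M: "\<And>b. b \<in> fst (\<beta> t0) \<Longrightarrow> norm b \<le> M"
      using P(3)[OF t0(1)] compact_imp_bounded[of "fst (\<beta> t0)"]
      unfolding proper_tile_def bounded_iff by blast
    have "norm (y n) \<le> M + norm a + 1" for n
    proof -
      obtain b where "b \<in> fst (translate_tile (\<beta> t0) (y n))" "dist a b < 1 / real (Suc n)"
        using tile_near_point[OF y(1)[OF t0(1), of n] P(2)[OF t0(1)] _ t0(2)] P(3)[OF t0(1)] by auto
      moreover have "1 / real (Suc n) \<le> 1" by simp
      ultimately have "b \<in> (\<lambda>x. x - y n) ` fst (\<beta> t0)" "norm (a - b) \<le> 1"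
        unfolding dist_norm by (simp, linarith)
      then obtain b' where "b' \<in> fst (\<beta> t0)" "norm (a - (b' - y n)) \<le> 1" by blast
      moreover have "norm (y n) \<le> norm (a - (b' - y n)) + norm b' + norm a"
        using norm_triangle_ineq4[of "(a - (b' - y n)) + b'" a] norm_triangle_ineq[of "a - (b' - y n)" b']
        by simp
      ultimately show ?thesis using M[of b'] by simp
    qed
    then have "bounded (range y)" by (intro boundedI) auto
    then obtain l r where r: "strict_mono r" "(y \<circ> r) \<longlonglongrightarrow> l" using bounded_imp_convergent_subsequence by blast
    have limit: "translate_tile (\<beta> t) l = t" if t: "t \<in> P" for t
    proof (rule sym, rule tile_near_eqI)
      fix e :: real assume e: "0 < e"
      obtain n1 where n1: "\<And>n. n \<ge> n1 \<Longrightarrow> norm (y (r n) - l) < e/4"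
        using r(2)[THEN LIMSEQ_D, of "e/4"] e by auto
      obtain n2 where n2: "1 / real (Suc n2) < e/2" using e nat_approx_posE[of "e/2"] by auto
      define n where "n = max n1 n2"
      have "n2 \<le> r n" using seq_suble[OF r(1), of n] by (simp add: n_def)
      then have "1 / real (Suc (r n)) \<le> 1 / real (Suc n2)" by (simp add: frac_le)
      then have "tile_near (e/2) t (translate_tile (\<beta> t) (y (r n)))"
        using y(1)[OF t, of "r n"] n2 by (auto simp: tile_near_def)
      moreover have "tile_near (e/2) (translate_tile (\<beta> t) (y (r n))) (translate_tile (\<beta> t) l)"
        using n1[of n] e P(3)[OF t]
        by (intro tile_near_translate[OF tile_near_refl[of "e/4"]]) (auto simp: n_def)
      ultimately have "tile_near (e/2 + e/2) t (translate_tile (\<beta> t) l)"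
        by (rule tile_near_trans) (use P(2)[OF t] P(3)[OF t] in simp_all)
      then show "tile_near e t (translate_tile (\<beta> t) l)" by simp
    qed (use P t in auto)
    obtain n where n: "norm (y (r n) - l) < \<epsilon>" using r(2)[THEN LIMSEQ_D, of \<epsilon>] \<epsilon> by auto
    have "translate_tile (\<beta> t) (y (r n)) = translate_tile t (y (r n) - l)" if "t \<in> P" for t
    proof -
      have "translate_tile (\<beta> t) (y (r n)) = translate_tile (translate_tile (\<beta> t) l) (y (r n) - l)" by simp
      then show ?thesis using limit[OF that] by metis
    qed
    with n have "moved (y (r n))" unfolding moved_def by blast
    with y(2) show False by blast
  qed
  then show ?thesis using that unfolding near_def moved_def by blast
qed

lemma eps_close_if_patch_eq:
  assumes T: "proper_tiles T" and eq: "patch (T \<ominus> w) 0 R = patch T' 0 R"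
    and w: "norm w < \<epsilon>" "1/\<epsilon> + norm w \<le> R"
  shows "eps_close \<epsilon> T T'"
proof (rule eps_closeI)
  show "patch T 0 (1/\<epsilon>) \<subseteq> patch T w R" using w(2) by (intro patch_mono) simp
  show "patch T' 0 (1/\<epsilon>) \<subseteq> patch T' 0 R"
    using w(2) norm_ge_zero[of w] by (intro patch_mono) (simp del: norm_ge_zero)
  have "patch T' 0 R = patch T w R \<ominus> w" using eq by (simp add: patch_translate)
  then show "bij_betw (\<lambda>t. translate_tile t w) (patch T w R) (patch T' 0 R)"
    unfolding translate_def by (simp add: inj_on_imp_bij_betw[OF inj_translate_tile])
  fix t assume "t \<in> patch T w R"
  then have "proper_tile t" using T patch_subset proper_tilesD by blast
  then show "tile_near \<epsilon> t (translate_tile t w)"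
    using tile_near_translate[OF tile_near_refl[of "\<epsilon> - norm w"], of 0 w \<epsilon> t] w(1) by simp
qed (rule patch_subset)+

context compact_tiling_space
begin

lemma FLC_patches:
  assumes "FLC \<Omega>"
  obtains F where "finite F" "\<And>Q. Q \<in> F \<Longrightarrow> finite Q \<and> (\<exists>S\<in>\<Omega>. Q \<subseteq> S)"
    "\<And>T x. T \<in> \<Omega> \<Longrightarrow> \<exists>Q\<in>F. \<exists>y. patch T x R = Q \<ominus> y"
proof -
  obtain F where F: "finite F" "\<And>T x. T \<in> \<Omega> \<Longrightarrow> \<exists>Q\<in>F. \<exists>y. patch T x R = Q \<ominus> y"
    using assms unfolding FLC_def by metis
  define F' where "F' = {Q \<in> F. \<exists>T\<in>\<Omega>. \<exists>x y. patch T x R = Q \<ominus> y}"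
  show ?thesis
  proof
    show "finite F'" using F(1) by (simp add: F'_def)
    show "\<exists>Q\<in>F'. \<exists>y. patch T x R = Q \<ominus> y" if "T \<in> \<Omega>" for T x
      using F(2)[OF that, of x] that unfolding F'_def by blast
    fix Q assume "Q \<in> F'"
    then obtain T x y where T: "T \<in> \<Omega>" "patch T x R = Q \<ominus> y" by (auto simp: F'_def)
    have "finite (Q \<ominus> y)" using finite_patch[OF T(1), of x R] T(2) by simp
    moreover have "Q \<ominus> y \<ominus> -y \<subseteq> T \<ominus> -y" using patch_subset[of T x R] T(2) by (intro translate_mono) simp
    ultimately show "finite Q \<and> (\<exists>S\<in>\<Omega>. Q \<subseteq> S)" using translate_closed[OF T(1), of "-y"] by auto
  qed
qed

text \<open>Under finite local complexity, closeness means exact agreement on a large ball up to a small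
  translation. The tiles near the origin are matched by one of finitely many patterns, and
  rigidity applies to each of these.\<close>

lemma close_imp_patch_eq:
  assumes flc: "FLC \<Omega>" and T0: "T0 \<in> \<Omega>" and \<epsilon>: "0 < \<epsilon>"
  obtains \<delta> where "0 < \<delta>"
    "\<And>T. T \<in> \<Omega> \<Longrightarrow> eps_close \<delta> T0 T \<Longrightarrow> \<exists>w. norm w < \<epsilon> \<and> patch (T \<ominus> w) 0 R = patch T0 0 R"
proof -
  obtain t0 a0 where t0: "t0 \<in> T0" "a0 \<in> fst t0"
    using nonempty[OF T0] proper_tile[OF T0] by (fastforce simp: proper_tile_def)
  \<comment> \<open>The radius is enlarged so that the pattern \<open>P\<close> is not empty; the margins of 1 and 2 make room for
    tiles that move by less than \<open>1/2\<close>.\<close>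
  define R' where "R' = max R (norm a0)"
  have R': "R \<le> R'" "0 \<le> R'" by (auto simp: R'_def le_max_iff_disj)
  define P where "P = patch T0 0 (R' + 1)"
  have "norm a0 < R' + 1" by (simp add: R'_def)
  then have "t0 \<in> P" using t0 by (auto simp: P_def in_patch_iff intro!: bexI[of _ a0])
  then have P: "finite P" "P \<noteq> {}" "P \<subseteq> T0" 
    using finite_patch[OF T0] patch_subset[of T0] unfolding P_def by blast+
  obtain F where F: "finite F" "\<And>Q. Q \<in> F \<Longrightarrow> finite Q \<and> (\<exists>S\<in>\<Omega>. Q \<subseteq> S)"
    "\<And>T x. T \<in> \<Omega> \<Longrightarrow> \<exists>Q\<in>F. \<exists>y. patch T x (R' + 2) = Q \<ominus> y"
    using FLC_patches[OF flc, of "R' + 2"] by blast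
  define B where "B = P \<rightarrow>\<^sub>E \<Union>F"
  define \<epsilon>' where "\<epsilon>' = min \<epsilon> (1/2)"
  have \<epsilon>': "0 < \<epsilon>'" "\<epsilon>' \<le> \<epsilon>" "\<epsilon>' \<le> 1/2" using \<epsilon> by (auto simp: \<epsilon>'_def)
  have "finite B" unfolding B_def using P(1) F(1,2) by (intro finite_PiE) auto
  have "\<exists>\<delta>>0. \<forall>y. (\<forall>t\<in>P. tile_near \<delta> t (translate_tile (\<beta> t) y)) \<longrightarrow>
      (\<exists>w. norm w < \<epsilon>' \<and> (\<forall>t\<in>P. translate_tile (\<beta> t) y = translate_tile t w))" if \<beta>: "\<beta> \<in> B" for \<beta>
  proof -
    have "proper_tile (\<beta> t)" if "t \<in> P" for t
    proof -
      have "\<beta> t \<in> \<Union>F" using \<beta> that by (auto simp: B_def)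
      then show ?thesis using F(2) proper_tile by blast
    qed
    then obtain \<delta> where "0 < \<delta>" "\<And>y. (\<And>t. t \<in> P \<Longrightarrow> tile_near \<delta> t (translate_tile (\<beta> t) y)) \<Longrightarrow>
        \<exists>w. norm w < \<epsilon>' \<and> (\<forall>t\<in>P. translate_tile (\<beta> t) y = translate_tile t w)"
      using near_pattern_is_translate[of P \<beta> \<epsilon>'] P \<epsilon>'(1) proper_tile[OF T0] by blast
    then show ?thesis by blast
  qed
  then obtain d where d: "\<And>\<beta>. \<beta> \<in> B \<Longrightarrow> 0 < d \<beta>"
    "\<And>\<beta> y. \<beta> \<in> B \<Longrightarrow> \<forall>t\<in>P. tile_near (d \<beta>) t (translate_tile (\<beta> t) y) \<Longrightarrow>
      \<exists>w. norm w < \<epsilon>' \<and> (\<forall>t\<in>P. translate_tile (\<beta> t) y = translate_tile t w)"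
    by metis
  obtain e where e: "0 < e" "\<And>\<beta>. \<beta> \<in> B \<Longrightarrow> e \<le> d \<beta>"
    using finite_pos_lower_bound[OF \<open>finite B\<close>, of d] d(1) by blast
  define \<delta> where "\<delta> = min e (min (1/2) (1 / (R' + 1)))"
  have \<delta>: "0 < \<delta>" "\<delta> \<le> e" "\<delta> \<le> 1/2" "\<delta> \<le> 1 / (R' + 1)" using e(1) R'(2) by (auto simp: \<delta>_def)
  have big: "R' + 1 \<le> 1/\<delta>" using \<delta>(1,4) R'(2) by (simp add: field_simps)
  show ?thesis
  proof (rule that[OF \<delta>(1)])
    fix T assume T: "T \<in> \<Omega>" and "eps_close \<delta> T0 T"
    from this(2) show "\<exists>w. norm w < \<epsilon> \<and> patch (T \<ominus> w) 0 R = patch T0 0 R"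
    proof (rule eps_closeE)
      fix b Q Q'
      assume Q: "patch T0 0 (1/\<delta>) \<subseteq> Q" "Q \<subseteq> T0" "patch T 0 (1/\<delta>) \<subseteq> Q'" "Q' \<subseteq> T"
        and b: "bij_betw b Q Q'" "\<And>t. t \<in> Q \<Longrightarrow> tile_near \<delta> t (b t)"
      have PQ: "P \<subseteq> Q" using Q(1) patch_mono[of 0 0 "R' + 1" "1/\<delta>" T0] big by (auto simp: P_def)
      have bT: "b t \<in> T" if "t \<in> Q" for t using b(1) Q(4) that by (auto simp: bij_betw_def)
      obtain K y where K: "K \<in> F" "patch T 0 (R' + 2) = K \<ominus> y" using F(3)[OF T] by blast
      define \<beta> where "\<beta> = restrict (\<lambda>t. translate_tile (b t) (-y)) P"
      have \<beta>: "translate_tile (\<beta> t) y = b t" if "t \<in> P" for t using that by (simp add: \<beta>_def)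
      have "translate_tile (b t) (-y) \<in> K" if t: "t \<in> P" for t
      proof -
        have tQ: "t \<in> Q" using t PQ by blast
        have "b t \<in> patch T 0 (R' + 2)"
        proof (rule tile_near_meets[OF b(2)[OF tQ]])
          show "t \<in> patch T0 0 (R' + 1)" using t by (simp add: P_def)
        qed (use tQ Q(2) bT \<delta>(3) proper_tile[OF T0, of t] proper_tile[OF T, of "b t"] in auto)
        then show ?thesis by (simp add: K(2) mem_translate)
      qed
      then have "\<beta> \<in> B" using K(1) by (auto simp: B_def \<beta>_def)
      moreover have "\<forall>t\<in>P. tile_near (d \<beta>) t (translate_tile (\<beta> t) y)"
      proof
        fix t assume t: "t \<in> P"
        then have "tile_near \<delta> t (b t)" using PQ b(2) by blast
        then show "tile_near (d \<beta>) t (translate_tile (\<beta> t) y)"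
          using e(2)[OF \<open>\<beta> \<in> B\<close>] \<delta>(2) by (auto simp: \<beta>[OF t] tile_near_def)
      qed
      ultimately obtain w where w: "norm w < \<epsilon>'" "\<forall>t\<in>P. translate_tile (\<beta> t) y = translate_tile t w"
        using d(2) by blast
      have bw: "b t = translate_tile t w" if "t \<in> P" for t using w(2) \<beta> that by metis
      have "patch (T \<ominus> -w) 0 R' = patch T0 0 R'"
      proof
        show "patch (T \<ominus> -w) 0 R' \<subseteq> patch T0 0 R'"
        proof
          fix u assume u: "u \<in> patch (T \<ominus> -w) 0 R'"
          define v where "v = translate_tile u w"
          have "v \<in> patch (T \<ominus> -w) 0 R' \<ominus> w" using u by (simp add: v_def)
          then have "v \<in> patch T (-w) R'" by (simp add: patch_translate)
          moreover have "patch T (-w) R' \<subseteq> patch T 0 (R' + 1/2)"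
            using w(1) \<epsilon>'(3) by (intro patch_mono) simp
          ultimately have v: "v \<in> patch T 0 (R' + 1/2)" by blast
          moreover have "patch T 0 (R' + 1/2) \<subseteq> patch T 0 (1/\<delta>)" using big by (intro patch_mono) simp
          ultimately have "v \<in> Q'" using Q(3) by blast
          then obtain t where t: "t \<in> Q" "v = b t" using b(1) by (auto simp: bij_betw_def)
          have "t \<in> P"
            unfolding P_def
          proof (rule tile_near_meets[OF tile_near_sym[OF b(2)[OF t(1)]]])
            show "b t \<in> patch T 0 (R' + 1/2)" using v t(2) by simp
          qed (use t(1) Q(2) bT \<delta>(3) proper_tile[OF T0, of t] proper_tile[OF T, of "b t"] in auto)
          then have "translate_tile u w = translate_tile t w" using bw t(2) v_def by simp
          then have "u = t" using inj_onD[OF inj_translate_tile[of w UNIV], of u t] by simp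
          with \<open>t \<in> P\<close> P(3) u show "u \<in> patch T0 0 R'" unfolding in_patch_iff by blast
        qed
        show "patch T0 0 R' \<subseteq> patch (T \<ominus> -w) 0 R'"
        proof
          fix t assume t: "t \<in> patch T0 0 R'"
          then have tP: "t \<in> P" using patch_mono[of 0 0 R' "R' + 1" T0] by (auto simp: P_def)
          then have "translate_tile t w \<in> T" using bw[of t] bT[of t] PQ by auto
          then have "t \<in> T \<ominus> -w" by (simp add: mem_translate)
          then show "t \<in> patch (T \<ominus> -w) 0 R'" using t unfolding in_patch_iff by blast
        qed
      qed
      then have "patch (T \<ominus> -w) 0 R = patch T0 0 R" by (rule patch_eq_mono) (use R'(1) in simp)
      with w(1) \<epsilon>'(2) show ?thesis by (intro exI[of _ "-w"]) simp
    qed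
  qed
qed

lemma nbhd_patch_eq:
  assumes "FLC \<Omega>" "T0 \<in> \<Omega>" "0 < \<epsilon>"
  obtains N where "openin X N" "T0 \<in> N" "N \<subseteq> \<Omega>"
    "\<And>T. T \<in> N \<Longrightarrow> \<exists>w. norm w < \<epsilon> \<and> patch (T \<ominus> w) 0 R = patch T0 0 R"
proof -
  obtain \<delta> where \<delta>: "0 < \<delta>"
    "\<And>T. T \<in> \<Omega> \<Longrightarrow> eps_close \<delta> T0 T \<Longrightarrow> \<exists>w. norm w < \<epsilon> \<and> patch (T \<ominus> w) 0 R = patch T0 0 R"
    using close_imp_patch_eq[OF assms] by blast
  obtain N where "openin X N" "T0 \<in> N" "N \<subseteq> \<Omega>" "\<And>T. T \<in> N \<Longrightarrow> eps_close \<delta> T0 T"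
    using close_nbhd[OF assms(2) \<delta>(1)] by blast
  with \<delta>(2) that show ?thesis by blast
qed

text \<open>A translation equivariant map given by a local rule is continuous, because closeness is exact
  agreement up to a small translation. This is how a derived point set, whose points may come from
  several tiles each, is seen to depend continuously on the tiling.\<close>

lemma continuous_map_if_local:
  assumes flc: "FLC \<Omega>" and maps: "D ` \<Omega> \<subseteq> \<Omega>0" and proper0: "\<And>T. T \<in> \<Omega> \<Longrightarrow> proper_tiles (D T)"
    and equivariant: "\<And>T x. T \<in> \<Omega> \<Longrightarrow> D (T \<ominus> x) = D T \<ominus> x"
    and local: "\<And>r. 0 < r \<Longrightarrow> \<exists>R. \<forall>T\<in>\<Omega>. \<forall>T'\<in>\<Omega>. patch T 0 R = patch T' 0 R \<longrightarrow>
        patch (D T) 0 r = patch (D T') 0 r"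
  shows "continuous_map X (tiling_topology \<Omega>0) D"
  unfolding continuous_map_eq_topcontinuous_at topcontinuous_at_def
proof (intro ballI conjI allI impI)
  fix T0 V assume "T0 \<in> topspace X" and V: "openin (tiling_topology \<Omega>0) V \<and> D T0 \<in> V"
  then have T0: "T0 \<in> \<Omega>" by simp
  obtain \<epsilon> where \<epsilon>: "0 < \<epsilon>" "\<And>S. S \<in> \<Omega>0 \<Longrightarrow> eps_close \<epsilon> (D T0) S \<Longrightarrow> S \<in> V"
    using V unfolding openin_tiling_topology by blast
  define r where "r = 1/\<epsilon> + \<epsilon>"
  have r: "0 < r" using \<epsilon>(1) by (simp add: r_def add_pos_pos)
  obtain R where R: "\<And>T T'. T \<in> \<Omega> \<Longrightarrow> T' \<in> \<Omega> \<Longrightarrow> patch T 0 R = patch T' 0 R \<Longrightarrow>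
      patch (D T) 0 r = patch (D T') 0 r"
    using local[OF r] by blast
  obtain N where N: "openin X N" "T0 \<in> N" "N \<subseteq> \<Omega>"
    "\<And>T. T \<in> N \<Longrightarrow> \<exists>w. norm w < \<epsilon> \<and> patch (T \<ominus> w) 0 R = patch T0 0 R"
    using nbhd_patch_eq[OF flc T0 \<epsilon>(1), of R] by blast
  have "D T \<in> V" if "T \<in> N" for T
  proof -
    have T: "T \<in> \<Omega>" using that N(3) by blast
    obtain w where w: "norm w < \<epsilon>" "patch (T \<ominus> w) 0 R = patch T0 0 R"
      using N(4) \<open>T \<in> N\<close> by blast
    then have "patch (D T \<ominus> w) 0 r = patch (D T0) 0 r"
      using R[OF translate_closed[OF T] T0 w(2)] by (simp add: equivariant[OF T])
    then have "eps_close \<epsilon> (D T) (D T0)"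
      using w(1) by (intro eps_close_if_patch_eq[OF proper0[OF T]]) (auto simp: r_def)
    then show ?thesis using \<epsilon>(2) maps T eps_close_sym by blast
  qed
  with N show "\<exists>U. openin X U \<and> T0 \<in> U \<and> (\<forall>y\<in>U. D y \<in> V)" by blast
qed (use maps in auto)

lemma uniformly_dense:
  obtains R0 where "0 < R0" "\<And>T x. T \<in> \<Omega> \<Longrightarrow> patch T x R0 \<noteq> {}"
proof -
  have "\<exists>e>0. \<forall>T\<in>\<Omega>. patch T 0 (1/e) \<noteq> {}"
  proof (rule uniform_if_local)
    fix T assume T: "T \<in> \<Omega>"
    obtain t a where t: "t \<in> T" "a \<in> fst t"
      using nonempty[OF T] proper_tile[OF T] by (fastforce simp: proper_tile_def)
    define R where "R = norm a + 1"
    have R: "0 < R" by (simp add: R_def add_nonneg_pos)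
    have tR: "t \<in> patch T 0 R" using t by (auto simp: in_patch_iff R_def intro!: bexI[of _ a])
    define e where "e = 1 / (R + 1)"
    have e: "0 < e" "e \<le> 1" "1/e = R + 1" using R by (simp_all add: e_def)
    have "patch T' 0 (1/e) \<noteq> {}" if T': "T' \<in> \<Omega>" and "eps_close e T T'" for T'
      using that(2)
    proof (rule eps_closeE)
      fix b Q Q'
      assume b: "patch T 0 (1/e) \<subseteq> Q" "Q \<subseteq> T" "patch T' 0 (1/e) \<subseteq> Q'" "Q' \<subseteq> T'"
        "bij_betw b Q Q'" "\<And>t. t \<in> Q \<Longrightarrow> tile_near e t (b t)"
      have tQ: "t \<in> Q" using tR b(1) patch_mono[of 0 0 R "1/e" T] e(3) by auto
      then have bT: "b t \<in> T'" using b(4,5) by (auto simp: bij_betw_def)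
      have "b t \<in> patch T' 0 (1/e)"
        by (rule tile_near_meets[OF b(6)[OF tQ] _ _ tR bT])
          (use t(1) bT e(2,3) proper_tile[OF T, of t] proper_tile[OF T', of "b t"] in auto)
      then show ?thesis by blast
    qed
    with e(1) show "\<exists>e>0. \<forall>T'\<in>\<Omega>. eps_close e T T' \<longrightarrow> patch T' 0 (1/e) \<noteq> {}" by blast
  next
    fix T and d e :: real assume "patch T 0 (1/e) \<noteq> {}" "0 < d" "d \<le> e"
    moreover from this have "1/e \<le> 1/d" by (simp add: frac_le)
    ultimately show "patch T 0 (1/d) \<noteq> {}" using patch_mono[of 0 0 "1/e" "1/d" T] by auto
  qed
  then obtain e where e: "0 < e" "\<And>T. T \<in> \<Omega> \<Longrightarrow> patch T 0 (1/e) \<noteq> {}" by blast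
  show ?thesis
  proof
    show "0 < 1/e" using e(1) by simp
    fix T and x :: "real^'d" assume "T \<in> \<Omega>"
    then have "patch (T \<ominus> x) 0 (1/e) \<noteq> {}" using e(2) translate_closed by blast
    then have "patch T x (1/e) \<ominus> x \<noteq> {}" by (simp add: patch_translate)
    then show "patch T x (1/e) \<noteq> {}" by (auto simp: translate_def)
  qed
qed

end


section \<open>A Delone set derived from the tiles\<close>

text \<open>The lowest corner of the bounding box. It may lie outside the set, but it is chosen in a
  translation equivariant way and at bounded distance.\<close>

definition corner :: "(real^'d) set \<Rightarrow> real^'d" where
  "corner A = (\<chi> i. INF a\<in>A. a $ i)"

lemma bdd_below_coordinate: "bounded A \<Longrightarrow> bdd_below ((\<lambda>a::real^'d. a $ i) ` A)"
  by (intro bounded_imp_bdd_below bounded_component_cart)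

lemma corner_translate:
  assumes "bounded A" "A \<noteq> {}"
  shows "corner ((\<lambda>a. a - x) ` A) = corner A - x"
proof -
  have "(INF a\<in>A. a $ i) - x $ i = (INF a\<in>A. a $ i - x $ i)" for i
  proof -
    have "continuous (at_right (INF a\<in>A. a $ i)) (\<lambda>y. y - x $ i)" by (intro continuous_intros)
    moreover have "mono (\<lambda>y. y - x $ i)" by (simp add: mono_def)
    ultimately show ?thesis
      using continuous_at_Inf_mono[of "\<lambda>y. y - x $ i" "(\<lambda>a. a $ i) ` A"] assms
        bdd_below_coordinate[OF assms(1)] by (simp add: image_image)
  qed
  then show ?thesis by (simp add: corner_def vec_eq_iff image_image)
qed

lemma dist_corner_le:
  fixes A :: "(real^'d) set" and M :: real
  assumes "bounded A" "a \<in> A" "\<And>b. b \<in> A \<Longrightarrow> dist a b \<le> M"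
  shows "dist a (corner A) \<le> CARD('d) * M"
proof -
  have "\<bar>a $ i - corner A $ i\<bar> \<le> M" for i
  proof -
    have "(INF b\<in>A. b $ i) \<le> a $ i"
      using bdd_below_coordinate[OF assms(1)] assms(2) by (rule cINF_lower)
    moreover have "a $ i - M \<le> (INF b\<in>A. b $ i)"
    proof (rule cINF_greatest)
      fix b assume "b \<in> A"
      then have "\<bar>(a - b) $ i\<bar> \<le> M"
        using assms(3)[of b] component_le_norm_cart[of "a - b" i] by (simp add: dist_norm)
      then show "a $ i - M \<le> b $ i" by simp
    qed (use assms(2) in auto)
    ultimately show ?thesis by (simp add: corner_def)
  qed
  then have "(\<Sum>i\<in>UNIV. \<bar>(a - corner A) $ i\<bar>) \<le> (\<Sum>i\<in>(UNIV::'d set). M)"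
    by (intro sum_mono) simp
  with norm_le_l1_cart[of "a - corner A"] show ?thesis by (simp add: dist_norm)
qed

definition corner_points :: "('d::finite, 'l) tiling \<Rightarrow> ('d, real) tiling" where
  "corner_points T = (\<lambda>t. ({corner (fst t)}, 0)) ` T"

lemma mem_corner_points: "({p}, l) \<in> corner_points T \<longleftrightarrow> l = 0 \<and> (\<exists>t\<in>T. p = corner (fst t))"
  by (auto simp: corner_points_def)

lemma corner_points_translate:
  assumes "proper_tiles T"
  shows "corner_points (T \<ominus> x) = corner_points T \<ominus> x"
proof -
  have "corner (fst (translate_tile t x)) = corner (fst t) - x" if "t \<in> T" for t
    using proper_tilesD[OF assms that] corner_translate compact_imp_bounded
    by (auto simp: proper_tile_def)
  then show ?thesis
    by (auto simp: corner_points_def translate_def image_image translate_tile_def)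
qed

lemma corner_points_mono: "S \<subseteq> T \<Longrightarrow> corner_points S \<subseteq> corner_points T"
  by (auto simp: corner_points_def)

lemma mem_patch_point: "({p}, l) \<in> patch T x r \<longleftrightarrow> ({p}, l) \<in> T \<and> dist x p < r"
  by (simp add: in_patch_iff)

lemma proper_corner_points: "proper_tiles (corner_points T)"
  by (auto simp: proper_tiles_def proper_tile_def corner_points_def)

context compact_tiling_space
begin

lemma bounded_tiles:
  assumes "FLC \<Omega>"
  obtains M where "\<And>T t a b. T \<in> \<Omega> \<Longrightarrow> t \<in> T \<Longrightarrow> a \<in> fst t \<Longrightarrow> b \<in> fst t \<Longrightarrow> dist a b \<le> M"
proof -
  obtain F where F: "finite F" "\<And>Q. Q \<in> F \<Longrightarrow> finite Q \<and> (\<exists>S\<in>\<Omega>. Q \<subseteq> S)"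
    "\<And>T x. T \<in> \<Omega> \<Longrightarrow> \<exists>Q\<in>F. \<exists>y. patch T x 1 = Q \<ominus> y"
    using FLC_patches[OF assms, of 1] by blast
  have "finite (\<Union>F)" using F(1,2) by blast
  then have "bdd_above ((\<lambda>t. diameter (fst t)) ` \<Union>F)" by simp
  then obtain M where M: "\<And>t. t \<in> \<Union>F \<Longrightarrow> diameter (fst t) \<le> M" by (auto simp: bdd_above_def)
  show ?thesis
  proof
    fix T t a b assume T: "T \<in> \<Omega>" and t: "t \<in> T" and ab: "a \<in> fst t" "b \<in> fst t"
    obtain Q y where Q: "Q \<in> F" "patch T a 1 = Q \<ominus> y" using F(3)[OF T] by blast
    have "t \<in> patch T a 1" using t ab(1) unfolding in_patch_iff by (auto intro!: bexI[of _ a])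
    then have u: "translate_tile t (-y) \<in> Q" by (simp add: Q(2) mem_translate)
    then have "proper_tile (translate_tile t (-y))" using F(2)[OF Q(1)] proper_tile by blast
    then have "bounded (fst (translate_tile t (-y)))" by (simp add: proper_tile_def compact_imp_bounded)
    then have "dist (a - - y) (b - - y) \<le> diameter (fst (translate_tile t (-y)))"
      by (rule diameter_bounded_bound) (use ab in auto)
    also have "\<dots> \<le> M" using M u Q(1) by blast
    finally show "dist a b \<le> M" by (simp add: dist_norm)
  qed
qed

text \<open>Only finitely many vectors between corners of tiles in a common patch occur; this makes the set
  of corners uniformly discrete.\<close>

lemma corner_points_derivation:
  assumes flc: "FLC \<Omega>"
  shows "delone_space (corner_points ` \<Omega>)" "local_derivation \<Omega> (corner_points ` \<Omega>) corner_points"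
    "\<exists>r>0. \<forall>T\<in>\<Omega>. \<forall>p l q m. ({p}, l) \<in> corner_points T \<longrightarrow> ({q}, m) \<in> corner_points T \<longrightarrow>
        dist p q < r \<longrightarrow> p = q"
proof -
  let ?D = "corner_points" and ?\<Omega>0 = "corner_points ` \<Omega>"
  obtain M where M: "\<And>T t a b. T \<in> \<Omega> \<Longrightarrow> t \<in> T \<Longrightarrow> a \<in> fst t \<Longrightarrow> b \<in> fst t \<Longrightarrow> dist a b \<le> M"
    using bounded_tiles[OF flc] by blast
  define N where "N = CARD('d) * M"
  have N: "dist a (corner (fst t)) \<le> N" if "T \<in> \<Omega>" "t \<in> T" "a \<in> fst t" for T t a
    unfolding N_def
  proof (rule dist_corner_le)
    show "bounded (fst t)" using proper_tile[OF that(1,2)] by (simp add: proper_tile_def compact_imp_bounded)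
    show "dist a b \<le> M" if "b \<in> fst t" for b
      using M \<open>T \<in> \<Omega>\<close> \<open>t \<in> T\<close> \<open>a \<in> fst t\<close> that by blast
  qed (rule that(3))
  have equivariant: "?D (T \<ominus> x) = ?D T \<ominus> x" if "T \<in> \<Omega>" for T x
    using corner_points_translate proper that by blast
  have restrict: "patch (?D T) x r = patch (?D (patch T x (r + N + 1))) x r" if T: "T \<in> \<Omega>" for T x r
  proof
    show "patch (?D T) x r \<subseteq> patch (?D (patch T x (r + N + 1))) x r"
    proof
      fix u assume u: "u \<in> patch (?D T) x r"
      then obtain t where t: "t \<in> T" "u = ({corner (fst t)}, 0)" by (auto simp: in_patch_iff corner_points_def)
      obtain a where a: "a \<in> fst t" using proper_tile[OF T t(1)] unfolding proper_tile_def by blast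
      have "dist x a < r + N + 1"
        using u t(2) N[OF T t(1) a] dist_triangle2[of x a "corner (fst t)"] by (simp add: in_patch_iff)
      then have "t \<in> patch T x (r + N + 1)" using a t(1) unfolding in_patch_iff by blast
      then show "u \<in> patch (?D (patch T x (r + N + 1))) x r"
        using u t(2) by (auto simp: in_patch_iff corner_points_def)
    qed
    show "patch (?D (patch T x (r + N + 1))) x r \<subseteq> patch (?D T) x r"
      using corner_points_mono[OF patch_subset[of T x "r + N + 1"]] unfolding in_patch_iff subset_iff by blast
  qed
  have local: "\<exists>R>0. \<forall>T\<in>\<Omega>. \<forall>T'\<in>\<Omega>. patch T 0 R = patch T' 0 R \<longrightarrow> patch (?D T) 0 r = patch (?D T') 0 r"
    for r
  proof (intro exI[of _ "max 1 (r + N + 1)"] conjI ballI impI)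
    fix T T' assume T: "T \<in> \<Omega>" "T' \<in> \<Omega>"
      and eq: "patch T 0 (max 1 (r + N + 1)) = patch T' 0 (max 1 (r + N + 1))"
    have "patch T 0 (r + N + 1) = patch T' 0 (r + N + 1)" by (rule patch_eq_mono[OF eq]) simp
    then show "patch (?D T) 0 r = patch (?D T') 0 r"
      using restrict[OF T(1), of 0 r] restrict[OF T(2), of 0 r] by simp
  qed simp
  have cont: "continuous_map X (tiling_topology ?\<Omega>0) ?D"
  proof (rule continuous_map_if_local[OF flc])
    fix r :: real
    show "\<exists>R. \<forall>T\<in>\<Omega>. \<forall>T'\<in>\<Omega>. patch T 0 R = patch T' 0 R \<longrightarrow> patch (?D T) 0 r = patch (?D T') 0 r"
      using local by blast
  qed (use equivariant proper_corner_points in auto)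
  have flc0: "FLC ?\<Omega>0"
    unfolding FLC_def
  proof
    fix R
    obtain F where F: "finite F" "\<And>Q. Q \<in> F \<Longrightarrow> finite Q \<and> (\<exists>S\<in>\<Omega>. Q \<subseteq> S)"
      "\<And>T x. T \<in> \<Omega> \<Longrightarrow> \<exists>Q\<in>F. \<exists>y. patch T x (R + N + 1) = Q \<ominus> y"
      using FLC_patches[OF flc, of "R + N + 1"] by blast
    have "\<exists>A\<in>(\<Union>Q\<in>F. Pow (?D Q)). \<exists>y. patch (?D T) x R = A \<ominus> y" if T: "T \<in> \<Omega>" for T x
    proof -
      obtain Q y where Q: "Q \<in> F" "patch T x (R + N + 1) = Q \<ominus> y" using F(3)[OF T] by blast
      have "proper_tiles Q" using F(2)[OF Q(1)] proper_tile by (auto simp: proper_tiles_def)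
      then have "patch (?D T) x R \<subseteq> ?D Q \<ominus> y"
        using restrict[OF T, of x R] patch_subset Q(2) corner_points_translate by metis
      then have "patch (?D T) x R \<ominus> -y \<subseteq> ?D Q \<ominus> y \<ominus> -y" by (rule translate_mono)
      then have "patch (?D T) x R \<ominus> -y \<in> (\<Union>Q\<in>F. Pow (?D Q))" using Q(1) by auto
      moreover have "patch (?D T) x R = patch (?D T) x R \<ominus> -y \<ominus> y" by simp
      ultimately show ?thesis by blast
    qed
    moreover have "finite (\<Union>Q\<in>F. Pow (?D Q))" using F(1,2) by (auto simp: corner_points_def)
    ultimately show "\<exists>F. finite F \<and> (\<forall>T\<in>?\<Omega>0. \<forall>x. \<exists>Q\<in>F. \<exists>y. patch T x R = Q \<ominus> y)" by blast
  qed
  have "factor_map \<Omega> ?\<Omega>0 ?D" using cont equivariant by (simp add: factor_map_def)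
  then show "local_derivation \<Omega> ?\<Omega>0 ?D" using flc flc0 local by (simp add: local_derivation_def)
  obtain F where F: "finite F" "\<And>Q. Q \<in> F \<Longrightarrow> finite Q \<and> (\<exists>S\<in>\<Omega>. Q \<subseteq> S)"
    "\<And>T x. T \<in> \<Omega> \<Longrightarrow> \<exists>Q\<in>F. \<exists>y. patch T x (N + 2) = Q \<ominus> y"
    using FLC_patches[OF flc, of "N + 2"] by blast
  define P where "P = {(t, u). t \<in> \<Union>F \<and> u \<in> \<Union>F \<and> corner (fst t) \<noteq> corner (fst u)}"
  have "P \<subseteq> \<Union>F \<times> \<Union>F" by (auto simp: P_def)
  moreover have "finite (\<Union>F)" using F(1,2) by blast
  ultimately have P: "finite P" using finite_subset by blast
  have "0 < dist (corner (fst (fst z))) (corner (fst (snd z)))" if "z \<in> P" for z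
    using that by (auto simp: P_def)
  then obtain r0 where r0: "0 < r0" "\<And>z. z \<in> P \<Longrightarrow> r0 \<le> dist (corner (fst (fst z))) (corner (fst (snd z)))"
    using finite_pos_lower_bound[OF P, of "\<lambda>z. dist (corner (fst (fst z))) (corner (fst (snd z)))"]
    by blast
  define r where "r = min 1 r0"
  have sep: "p = q" if T: "T \<in> \<Omega>" and pq: "({p}, l) \<in> ?D T" "({q}, m) \<in> ?D T" "dist p q < r" for T p l q m
  proof (rule ccontr)
    assume "p \<noteq> q"
    obtain t u where t: "t \<in> T" "p = corner (fst t)" and u: "u \<in> T" "q = corner (fst u)"
      using pq by (auto simp: mem_corner_points)
    obtain Q y where Q: "Q \<in> F" "patch T p (N + 2) = Q \<ominus> y" using F(3)[OF T] by blast
    have inQ: "translate_tile v (-y) \<in> \<Union>F \<and> corner (fst (translate_tile v (-y))) = corner (fst v) + y"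
      if v: "v \<in> T" "dist p (corner (fst v)) < 1" for v
    proof -
      obtain a where a: "a \<in> fst v" using proper_tile[OF T v(1)] unfolding proper_tile_def by blast
      have "dist p a < N + 2"
        using N[OF T v(1) a] v(2) dist_triangle2[of p a "corner (fst v)"] by simp
      then have "v \<in> patch T p (N + 2)" using a v(1) unfolding in_patch_iff by blast
      then have "translate_tile v (-y) \<in> Q" by (simp add: Q(2) mem_translate)
      moreover have "corner ((\<lambda>a. a - - y) ` fst v) = corner (fst v) - - y"
        using proper_tile[OF T v(1)] by (intro corner_translate) (auto simp: proper_tile_def compact_imp_bounded)
      ultimately show ?thesis using Q(1) by auto
    qed
    have tF: "translate_tile t (-y) \<in> \<Union>F \<and> corner (fst (translate_tile t (-y))) = p + y"
      using inQ[OF t(1)] t(2) by simp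
    have uF: "translate_tile u (-y) \<in> \<Union>F \<and> corner (fst (translate_tile u (-y))) = q + y"
      using inQ[OF u(1)] u(2) pq(3) by (simp add: r_def)
    have "(translate_tile t (-y), translate_tile u (-y)) \<in> P"
      unfolding P_def using tF uF \<open>p \<noteq> q\<close> by simp
    from r0(2)[OF this] have "r0 \<le> dist (p + y) (q + y)" using tF uF by simp
    then show False using pq(3) by (simp add: r_def dist_norm)
  qed
  have r: "0 < r" using r0(1) by (simp add: r_def)
  show "\<exists>r>0. \<forall>T\<in>\<Omega>. \<forall>p l q m. ({p}, l) \<in> ?D T \<longrightarrow> ({q}, m) \<in> ?D T \<longrightarrow> dist p q < r \<longrightarrow> p = q"
    using sep r by blast
  obtain R0 where R0: "0 < R0" "\<And>T x. T \<in> \<Omega> \<Longrightarrow> patch T x R0 \<noteq> {}" using uniformly_dense by blast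
  have "is_delone {0} (?D T)" if T: "T \<in> \<Omega>" for T
    unfolding is_delone_def
  proof (intro conjI)
    show "\<forall>t\<in>?D T. (\<exists>p. fst t = {p}) \<and> snd t \<in> {0}" by (auto simp: corner_points_def)
    have "r \<le> dist p q" if "({p}, l) \<in> ?D T" "({q}, m) \<in> ?D T" "({p}, l) \<noteq> ({q}, m)" for p l q m
    proof -
      have "p \<noteq> q" using that by (auto simp: mem_corner_points)
      then show ?thesis using sep[OF T that(1,2)] by force
    qed
    then show "\<exists>r>0. \<forall>p l q m. ({p}, l) \<in> ?D T \<and> ({q}, m) \<in> ?D T \<and> ({p}, l) \<noteq> ({q}, m) \<longrightarrow> r \<le> dist p q"
      using r by blast
    have "\<exists>p l. ({p}, l) \<in> ?D T \<and> dist x p \<le> R0 + \<bar>N\<bar>" for x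
    proof -
      obtain t a where t: "t \<in> T" "a \<in> fst t" "dist x a < R0"
        using R0(2)[OF T, of x] by (auto simp: in_patch_iff)
      have "dist x (corner (fst t)) \<le> R0 + \<bar>N\<bar>"
        using t(3) N[OF T t(1,2)] dist_triangle[of x "corner (fst t)" a] by simp
      moreover have "({corner (fst t)}, 0) \<in> ?D T" using t(1) by (auto simp: mem_corner_points)
      ultimately show ?thesis by blast
    qed
    then show "\<exists>R>0. \<forall>x. \<exists>p l. ({p}, l) \<in> ?D T \<and> dist x p \<le> R"
      using R0(1) by (intro exI[of _ "R0 + \<bar>N\<bar>"]) auto
  qed
  moreover have "translation_compact ?\<Omega>0"
    unfolding translation_compact_def
  proof
    show "\<forall>T\<in>?\<Omega>0. \<forall>x. T \<ominus> x \<in> ?\<Omega>0"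
      by (auto simp: equivariant[symmetric] translate_closed)
    have "compactin (tiling_topology ?\<Omega>0) (?D ` \<Omega>)"
      using compact cont by (intro image_compactin[of X]) (simp_all add: compact_space_def)
    then show "compact_space (tiling_topology ?\<Omega>0)" by (simp add: compact_space_def)
  qed
  ultimately show "delone_space ?\<Omega>0" unfolding delone_space_def by (blast intro: compact_sing)
qed

end


section \<open>Flow boxes\<close>

text \<open>What an FLC transversal inherits from the local derivation that defines it: membership is
  decided by a patch of fixed radius around the origin.\<close>

definition locally_determined :: "('d::finite, 'l) tiling set \<Rightarrow> ('d, 'l) tiling set \<Rightarrow> bool" where
  "locally_determined \<Omega> \<Xi> \<longleftrightarrow> \<Xi> \<subseteq> \<Omega> \<and>
     (\<exists>R. \<forall>T\<in>\<Omega>. \<forall>T'\<in>\<Omega>. patch T 0 R = patch T' 0 R \<longrightarrow> (T \<in> \<Xi> \<longleftrightarrow> T' \<in> \<Xi>))"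

lemma locally_determined_if_FLC_transversal:
  assumes "FLC_transversal \<Omega> \<Xi>"
  shows "locally_determined \<Omega> \<Xi>"
proof -
  obtain \<Omega>0 :: "('a, real) tiling set" and D where D: "local_derivation \<Omega> \<Omega>0 D"
    "\<Xi> = {T \<in> \<Omega>. D T \<in> canonical_transversal \<Omega>0}"
    using assms unfolding FLC_transversal_def by blast
  have iff: "T \<in> \<Xi> \<longleftrightarrow> (\<exists>l. ({0}, l) \<in> patch (D T) 0 1)" if "T \<in> \<Omega>" for T
  proof -
    have "D T \<in> \<Omega>0" using D(1) that by (auto simp: local_derivation_def factor_map_def)
    then show ?thesis using that by (auto simp: D(2) canonical_transversal_def mem_patch_point)
  qed
  obtain R where R: "\<forall>T\<in>\<Omega>. \<forall>T'\<in>\<Omega>. patch T 0 R = patch T' 0 R \<longrightarrow> patch (D T) 0 1 = patch (D T') 0 1"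
    using D(1) unfolding local_derivation_def by (meson zero_less_one)
  have "T \<in> \<Xi> \<longleftrightarrow> T' \<in> \<Xi>" if "T \<in> \<Omega>" "T' \<in> \<Omega>" "patch T 0 R = patch T' 0 R" for T T'
  proof -
    have "patch (D T) 0 1 = patch (D T') 0 1" using R that by blast
    then show ?thesis using iff[OF that(1)] iff[OF that(2)] by simp
  qed
  then show ?thesis unfolding locally_determined_def D(2) by blast
qed

text \<open>A flow box is the product of a transversal and a ball; this is the component in the ball.\<close>

definition flow_coordinate :: "('d::finite, 'l) tiling set \<times> real \<Rightarrow> ('d, 'l) tiling \<Rightarrow> real^'d" where
  "flow_coordinate B = flow_box_primitive (\<lambda>T v. v) B"

lemma mem_flow_box: "T \<in> flow_box (\<Xi>, \<epsilon>) \<longleftrightarrow> (\<exists>c. norm c < \<epsilon> \<and> T \<ominus> -c \<in> \<Xi>)"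
proof
  assume "T \<in> flow_box (\<Xi>, \<epsilon>)"
  then show "\<exists>c. norm c < \<epsilon> \<and> T \<ominus> -c \<in> \<Xi>" by (auto simp: flow_box_def)
next
  assume "\<exists>c. norm c < \<epsilon> \<and> T \<ominus> -c \<in> \<Xi>"
  then obtain c where c: "norm c < \<epsilon>" "T \<ominus> -c \<in> \<Xi>" by blast
  have "T = T \<ominus> -c \<ominus> c" by simp
  with c show "T \<in> flow_box (\<Xi>, \<epsilon>)" unfolding flow_box_def by blast
qed

lemma flow_coordinate_eqI:
  assumes "(\<Xi>, \<epsilon>) \<in> open_flow_boxes \<Omega>" "norm c < \<epsilon>" "T \<ominus> -c \<in> \<Xi>"
  shows "flow_coordinate (\<Xi>, \<epsilon>) T = c"
proof -
  have inj: "inj_on (\<lambda>(S, x). S \<ominus> x) (\<Xi> \<times> ball 0 \<epsilon>)" using assms(1) by (simp add: open_flow_boxes_def)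
  have "w = c" if w: "S \<in> \<Xi>" "norm w < \<epsilon>" "T = S \<ominus> w" for w S
    using inj_onD[OF inj, of "(S, w)" "(T \<ominus> -c, c)"] assms w by simp
  note unique = this
  have "T = T \<ominus> -c \<ominus> c" by simp
  then have ex: "\<exists>S x. S \<in> \<Xi> \<and> norm x < \<epsilon> \<and> T = S \<ominus> x \<and> c = x" using assms(2,3) by blast
  show ?thesis
    unfolding flow_coordinate_def flow_box_primitive_def prod.case
  proof (rule the_equality)
    show "\<exists>S x. S \<in> \<Xi> \<and> norm x < \<epsilon> \<and> T = S \<ominus> x \<and> c = x" by (rule ex)
  qed (use unique in blast)
qed

lemma flow_coordinate:
  assumes "(\<Xi>, \<epsilon>) \<in> open_flow_boxes \<Omega>" "T \<in> flow_box (\<Xi>, \<epsilon>)"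
  shows "norm (flow_coordinate (\<Xi>, \<epsilon>) T) < \<epsilon>" "T \<ominus> - flow_coordinate (\<Xi>, \<epsilon>) T \<in> \<Xi>"
proof -
  obtain c where "norm c < \<epsilon>" "T \<ominus> -c \<in> \<Xi>" using assms(2) unfolding mem_flow_box by blast
  with flow_coordinate_eqI[OF assms(1)]
  show "norm (flow_coordinate (\<Xi>, \<epsilon>) T) < \<epsilon>" "T \<ominus> - flow_coordinate (\<Xi>, \<epsilon>) T \<in> \<Xi>" by auto
qed

text \<open>Two returns at a distance less than \<open>\<epsilon>\<close> would give one tiling two positions in the product.\<close>

lemma flow_box_returns:
  assumes "(\<Xi>, \<epsilon>) \<in> open_flow_boxes \<Omega>" "T \<ominus> a \<in> \<Xi>" "T \<ominus> b \<in> \<Xi>" "norm (b - a) < \<epsilon>"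
  shows "a = b"
proof -
  have inj: "inj_on (\<lambda>(S, x). S \<ominus> x) (\<Xi> \<times> ball 0 \<epsilon>)" and "0 < \<epsilon>"
    using assms(1) by (simp_all add: open_flow_boxes_def)
  have "(\<lambda>(S, x). S \<ominus> x) (T \<ominus> a, b - a) = (\<lambda>(S, x). S \<ominus> x) (T \<ominus> b, 0)" by simp
  moreover have "(T \<ominus> a, b - a) \<in> \<Xi> \<times> ball 0 \<epsilon>" using assms(2,4) by simp
  moreover have "(T \<ominus> b, 0) \<in> \<Xi> \<times> ball 0 \<epsilon>" using assms(3) \<open>0 < \<epsilon>\<close> by simp
  ultimately have "(T \<ominus> a, b - a) = (T \<ominus> b, 0)" by (rule inj_onD[OF inj])
  then show ?thesis by simp
qed

lemma flow_coordinate_translate: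
  assumes B: "(\<Xi>, \<epsilon>) \<in> open_flow_boxes \<Omega>" "T \<in> flow_box (\<Xi>, \<epsilon>)"
    and v: "norm (flow_coordinate (\<Xi>, \<epsilon>) T + v) < \<epsilon>"
  shows "flow_coordinate (\<Xi>, \<epsilon>) (T \<ominus> v) = flow_coordinate (\<Xi>, \<epsilon>) T + v"
proof (rule flow_coordinate_eqI[OF B(1) v])
  have "T \<ominus> v \<ominus> - (flow_coordinate (\<Xi>, \<epsilon>) T + v) = T \<ominus> - flow_coordinate (\<Xi>, \<epsilon>) T" by simp
  then show "T \<ominus> v \<ominus> - (flow_coordinate (\<Xi>, \<epsilon>) T + v) \<in> \<Xi>"
    using flow_coordinate(2)[OF B] by metis
qed

text \<open>If \<open>T - w\<close> looks like \<open>T0\<close> around the origin, then it returns to the transversal where \<open>T0\<close> does.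
  Both the openness of flow boxes and the local behaviour of their coordinates rest on this.\<close>

lemma return_patch_eq:
  assumes \<Xi>: "locally_determined \<Omega> \<Xi>" and inv: "\<And>T x. T \<in> \<Omega> \<Longrightarrow> T \<ominus> x \<in> \<Omega>"
    and T0: "T0 \<in> \<Omega>" and c: "norm c < \<epsilon>" "T0 \<ominus> -c \<in> \<Xi>"
  obtains R where "\<And>T w. T \<in> \<Omega> \<Longrightarrow> norm w < \<epsilon> - norm c \<Longrightarrow> patch (T \<ominus> w) 0 R = patch T0 0 R \<Longrightarrow>
      norm (c - w) < \<epsilon> \<and> T \<ominus> - (c - w) \<in> \<Xi>"
proof -
  obtain R where R: "\<And>T T'. T \<in> \<Omega> \<Longrightarrow> T' \<in> \<Omega> \<Longrightarrow> patch T 0 R = patch T' 0 R \<Longrightarrow> T \<in> \<Xi> \<longleftrightarrow> T' \<in> \<Xi>"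
    using \<Xi> unfolding locally_determined_def by blast
  show ?thesis
  proof (rule that, rule conjI)
    fix T w assume T: "T \<in> \<Omega>" and w: "norm w < \<epsilon> - norm c"
      and eq: "patch (T \<ominus> w) 0 (norm c + R) = patch T0 0 (norm c + R)"
    show "norm (c - w) < \<epsilon>" using w norm_triangle_ineq4[of c w] by simp
    have "patch (T \<ominus> w \<ominus> -c) 0 R = patch (T0 \<ominus> -c) 0 R" by (rule patch_eq_translate[OF eq]) simp
    then have "T \<ominus> w \<ominus> -c \<in> \<Xi>" using R[of "T \<ominus> w \<ominus> -c" "T0 \<ominus> -c"] inv T T0 c(2) by blast
    then show "T \<ominus> - (c - w) \<in> \<Xi>" by simp
  qed
qed

lemma flow_coordinate_patch_eq:
  assumes B: "(\<Xi>, \<epsilon>) \<in> open_flow_boxes \<Omega>" and inv: "\<And>T x. T \<in> \<Omega> \<Longrightarrow> T \<ominus> x \<in> \<Omega>"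
    and T0: "T0 \<in> \<Omega>" "T0 \<in> flow_box (\<Xi>, \<epsilon>)"
  obtains R \<eta> where "0 < \<eta>" "\<And>T w. T \<in> \<Omega> \<Longrightarrow> norm w < \<eta> \<Longrightarrow> patch (T \<ominus> w) 0 R = patch T0 0 R \<Longrightarrow>
      T \<in> flow_box (\<Xi>, \<epsilon>) \<and> flow_coordinate (\<Xi>, \<epsilon>) T = flow_coordinate (\<Xi>, \<epsilon>) T0 - w"
proof -
  define c where "c = flow_coordinate (\<Xi>, \<epsilon>) T0"
  have c: "norm c < \<epsilon>" "T0 \<ominus> -c \<in> \<Xi>" using flow_coordinate[OF B T0(2)] by (simp_all add: c_def)
  have "FLC_transversal \<Omega> \<Xi>" using B by (simp add: open_flow_boxes_def)
  then have \<Xi>: "locally_determined \<Omega> \<Xi>" by (rule locally_determined_if_FLC_transversal)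
  obtain R where R: "\<And>T w. T \<in> \<Omega> \<Longrightarrow> norm w < \<epsilon> - norm c \<Longrightarrow> patch (T \<ominus> w) 0 R = patch T0 0 R \<Longrightarrow>
      norm (c - w) < \<epsilon> \<and> T \<ominus> - (c - w) \<in> \<Xi>"
    by (rule return_patch_eq[OF \<Xi> inv T0(1) c]) (assumption, rule that)
  show ?thesis
  proof
    show "0 < \<epsilon> - norm c" using c(1) by simp
    show "T \<in> flow_box (\<Xi>, \<epsilon>) \<and> flow_coordinate (\<Xi>, \<epsilon>) T = flow_coordinate (\<Xi>, \<epsilon>) T0 - w"
      if "T \<in> \<Omega>" "norm w < \<epsilon> - norm c" "patch (T \<ominus> w) 0 R = patch T0 0 R" for T w
    proof -
      have *: "norm (c - w) < \<epsilon>" "T \<ominus> - (c - w) \<in> \<Xi>" using R[OF that] by blast+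
      from flow_coordinate_eqI[OF B *] * show ?thesis unfolding mem_flow_box c_def[symmetric] by blast
    qed
  qed
qed

context compact_tiling_space
begin

lemma local_derivation_translate:
  assumes "local_derivation \<Omega> \<Omega>0 D"
  shows "local_derivation \<Omega> \<Omega>0 (\<lambda>T. D (T \<ominus> u))"
proof -
  have D: "FLC \<Omega>" "FLC \<Omega>0" "continuous_map X (tiling_topology \<Omega>0) D" "D ` \<Omega> = \<Omega>0"
    "\<And>T x. T \<in> \<Omega> \<Longrightarrow> D (T \<ominus> x) = D T \<ominus> x"
    and local: "\<And>r. 0 < r \<Longrightarrow> \<exists>R>0. \<forall>T\<in>\<Omega>. \<forall>T'\<in>\<Omega>. patch T 0 R = patch T' 0 R \<longrightarrow>
        patch (D T) 0 r = patch (D T') 0 r"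
    using assms by (auto simp: local_derivation_def factor_map_def)
  have "continuous_map X (prod_topology X euclidean) (\<lambda>T. (T, u))"
    by (intro continuous_map_pairedI) (auto simp: continuous_map_id[unfolded id_def])
  from continuous_map_compose[OF this continuous_translation]
  have "continuous_map X X (\<lambda>T. T \<ominus> u)" by (simp add: comp_def)
  from continuous_map_compose[OF this D(3)]
  have "continuous_map X (tiling_topology \<Omega>0) (\<lambda>T. D (T \<ominus> u))" by (simp add: comp_def)
  moreover have "(\<lambda>T. D (T \<ominus> u)) ` \<Omega> = \<Omega>0"
  proof
    show "(\<lambda>T. D (T \<ominus> u)) ` \<Omega> \<subseteq> \<Omega>0" using D(4) translate_closed by blast
    show "\<Omega>0 \<subseteq> (\<lambda>T. D (T \<ominus> u)) ` \<Omega>"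
    proof
      fix S assume "S \<in> \<Omega>0"
      then obtain T where T: "T \<in> \<Omega>" "S = D T" using D(4) by blast
      then have "S = D (T \<ominus> -u \<ominus> u)" by simp
      then show "S \<in> (\<lambda>T. D (T \<ominus> u)) ` \<Omega>" using translate_closed[OF T(1)] by blast
    qed
  qed
  moreover have "D (T \<ominus> x \<ominus> u) = D (T \<ominus> u) \<ominus> x" if "T \<in> \<Omega>" for T x
  proof -
    have "T \<ominus> x \<ominus> u = T \<ominus> u \<ominus> x" by (simp add: add.commute)
    then show ?thesis using D(5)[OF translate_closed[OF that], of u x] by simp
  qed
  ultimately have "factor_map \<Omega> \<Omega>0 (\<lambda>T. D (T \<ominus> u))" by (simp add: factor_map_def)
  moreover have "\<exists>R>0. \<forall>T\<in>\<Omega>. \<forall>T'\<in>\<Omega>. patch T 0 R = patch T' 0 R \<longrightarrow>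
      patch (D (T \<ominus> u)) 0 r = patch (D (T' \<ominus> u)) 0 r" if r: "0 < r" for r
  proof -
    obtain R where R: "0 < R" "\<forall>T\<in>\<Omega>. \<forall>T'\<in>\<Omega>. patch T 0 R = patch T' 0 R \<longrightarrow>
        patch (D T) 0 r = patch (D T') 0 r"
      using local[OF r] by blast
    have "patch (D (T \<ominus> u)) 0 r = patch (D (T' \<ominus> u)) 0 r"
      if T: "T \<in> \<Omega>" "T' \<in> \<Omega>" "patch T 0 (norm u + R) = patch T' 0 (norm u + R)" for T T'
      using R(2) translate_closed T(1,2) patch_eq_translate[OF T(3), of u R] by auto
    moreover have "0 < norm u + R" using R(1) by (simp add: add_nonneg_pos)
    ultimately show ?thesis by blast
  qed
  ultimately show ?thesis using D(1,2) by (simp add: local_derivation_def)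
qed

lemma flow_box_open:
  assumes flc: "FLC \<Omega>" and \<Xi>: "locally_determined \<Omega> \<Xi>"
  shows "openin X (flow_box (\<Xi>, \<epsilon>))"
  unfolding openin_tiling_topology
proof (intro conjI ballI)
  have \<Xi>\<Omega>: "\<Xi> \<subseteq> \<Omega>" using \<Xi> by (simp add: locally_determined_def)
  then show sub: "flow_box (\<Xi>, \<epsilon>) \<subseteq> \<Omega>" using translate_closed by (auto simp: flow_box_def)
  fix T assume T: "T \<in> flow_box (\<Xi>, \<epsilon>)"
  then have T\<Omega>: "T \<in> \<Omega>" using sub by blast
  obtain c where c: "norm c < \<epsilon>" "T \<ominus> -c \<in> \<Xi>" using T unfolding mem_flow_box by blast
  obtain R where R: "\<And>T' w. T' \<in> \<Omega> \<Longrightarrow> norm w < \<epsilon> - norm c \<Longrightarrow> patch (T' \<ominus> w) 0 R = patch T 0 R \<Longrightarrow>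
      norm (c - w) < \<epsilon> \<and> T' \<ominus> - (c - w) \<in> \<Xi>"
    by (rule return_patch_eq[OF \<Xi> translate_closed T\<Omega> c]) (assumption, rule that)
  have "0 < \<epsilon> - norm c" using c(1) by simp
  then obtain \<delta> where \<delta>: "0 < \<delta>" "\<And>T'. T' \<in> \<Omega> \<Longrightarrow> eps_close \<delta> T T' \<Longrightarrow>
      \<exists>w. norm w < \<epsilon> - norm c \<and> patch (T' \<ominus> w) 0 R = patch T 0 R"
    using close_imp_patch_eq[OF flc T\<Omega>, of "\<epsilon> - norm c" R] by blast
  have "T' \<in> flow_box (\<Xi>, \<epsilon>)" if T': "T' \<in> \<Omega>" "eps_close \<delta> T T'" for T'
  proof -
    obtain w where "norm w < \<epsilon> - norm c" "patch (T' \<ominus> w) 0 R = patch T 0 R" using \<delta>(2)[OF T'] by blast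
    from R[OF T'(1) this] show ?thesis unfolding mem_flow_box by blast
  qed
  with \<delta>(1) show "\<exists>\<epsilon>'>0. \<forall>T'\<in>\<Omega>. eps_close \<epsilon>' T T' \<longrightarrow> T' \<in> flow_box (\<Xi>, \<epsilon>)" by blast
qed

text \<open>The transversal through \<open>T\<close> belongs to the derived point set shifted by one of the points of \<open>T\<close>. The
  box is a product because its diameter does not exceed the distance between points.\<close>

lemma flow_boxes_cover:
  assumes flc: "FLC \<Omega>" and T: "T \<in> \<Omega>"
  obtains B where "B \<in> open_flow_boxes \<Omega>" "T \<in> flow_box B"
proof -
  let ?D = "corner_points" and ?\<Omega>0 = "corner_points ` \<Omega>"
  obtain r where r: "0 < r" "\<And>T p l q m. T \<in> \<Omega> \<Longrightarrow> ({p}, l) \<in> ?D T \<Longrightarrow> ({q}, m) \<in> ?D T \<Longrightarrow>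
      dist p q < r \<Longrightarrow> p = q"
    using corner_points_derivation(3)[OF flc] by metis
  obtain t where t: "t \<in> T" using nonempty[OF T] by blast
  define u where "u = corner (fst t)"
  define \<Xi> where "\<Xi> = {S \<in> \<Omega>. ?D (S \<ominus> u) \<in> canonical_transversal ?\<Omega>0}"
  have \<Xi>: "S \<in> \<Xi> \<longleftrightarrow> S \<in> \<Omega> \<and> (\<exists>l. ({u}, l) \<in> ?D S)" for S
  proof (cases "S \<in> \<Omega>")
    case True
    then have "?D (S \<ominus> u) = ?D S \<ominus> u" using corner_points_translate proper by blast
    moreover have "({0}, l) \<in> ?D S \<ominus> u \<longleftrightarrow> ({u}, l) \<in> ?D S" for l
      by (simp add: mem_translate translate_tile_def)
    ultimately show ?thesis using True translate_closed[OF True, of u]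
      by (auto simp: \<Xi>_def canonical_transversal_def)
  qed (simp add: \<Xi>_def)
  have transversal: "FLC_transversal \<Omega> \<Xi>"
    unfolding FLC_transversal_def \<Xi>_def
    using corner_points_derivation(1)[OF flc] local_derivation_translate[OF corner_points_derivation(2)[OF flc], of u]
    by blast
  have "inj_on (\<lambda>(S, x). S \<ominus> x) (\<Xi> \<times> ball 0 (r/2))"
  proof (rule inj_onI, clarsimp)
    fix S x S' x'
    assume S: "S \<in> \<Xi>" "S' \<in> \<Xi>" and x: "norm x * 2 < r" "norm x' * 2 < r" and eq: "S \<ominus> x = S' \<ominus> x'"
    have S\<Omega>: "S \<in> \<Omega>" "S' \<in> \<Omega>" using S \<Xi> by auto
    have S': "S = S' \<ominus> (x' - x)" using eq by (simp add: translate_eq_iff)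
    then have "?D S = ?D S' \<ominus> (x' - x)" using corner_points_translate proper[OF S\<Omega>(2)] by metis
    moreover obtain l m where "({u}, l) \<in> ?D S" "({u}, m) \<in> ?D S'" using S \<Xi> by blast
    ultimately have "({u - (x - x')}, l) \<in> ?D S'" "({u}, m) \<in> ?D S'"
      by (simp_all add: mem_translate translate_tile_def)
    moreover have "dist (u - (x - x')) u < r"
      using x norm_triangle_ineq4[of x' x] by (simp add: dist_norm)
    ultimately have "u - (x - x') = u" using r(2)[OF S\<Omega>(2)] by blast
    then show "S = S' \<and> x = x'" using S' by simp
  qed
  then have "(\<Xi>, r/2) \<in> open_flow_boxes \<Omega>"
    using transversal r(1) flow_box_open[OF flc locally_determined_if_FLC_transversal[OF transversal]]
    by (simp add: open_flow_boxes_def)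
  moreover have "T \<ominus> - 0 \<in> \<Xi>" using T t by (auto simp: \<Xi> mem_corner_points u_def)
  then have "T \<in> flow_box (\<Xi>, r/2)" unfolding mem_flow_box using r(1) by (intro exI[of _ 0]) simp
  ultimately show ?thesis using that by blast
qed

lemma flow_box_subset: "B \<in> open_flow_boxes \<Omega> \<Longrightarrow> flow_box B \<subseteq> \<Omega>"
  using openin_subset[of X "flow_box B"] by (cases B) (simp add: open_flow_boxes_def)

text \<open>Near \<open>T0\<close> the coordinates in two boxes change by one and the same small vector, namely the
  translation that restores the patch of \<open>T0\<close>. So each is continuous, and their difference is locally
  constant.\<close>

lemma flow_coordinate_local:
  assumes flc: "FLC \<Omega>" and B: "B \<in> open_flow_boxes \<Omega>" "T0 \<in> flow_box B"
    and C: "C \<in> open_flow_boxes \<Omega>" "T0 \<in> flow_box C" and \<epsilon>: "0 < \<epsilon>"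
  obtains N where "openin X N" "T0 \<in> N" "\<And>T. T \<in> N \<Longrightarrow> T \<in> flow_box B \<and> T \<in> flow_box C \<and>
      (\<exists>w. norm w < \<epsilon> \<and> flow_coordinate B T = flow_coordinate B T0 - w \<and>
           flow_coordinate C T = flow_coordinate C T0 - w)"
proof -
  have T0: "T0 \<in> \<Omega>" using flow_box_subset B by blast
  obtain R1 e1 where 1: "0 < e1" "\<And>T w. T \<in> \<Omega> \<Longrightarrow> norm w < e1 \<Longrightarrow> patch (T \<ominus> w) 0 R1 = patch T0 0 R1 \<Longrightarrow>
      T \<in> flow_box B \<and> flow_coordinate B T = flow_coordinate B T0 - w"
    by (rule flow_coordinate_patch_eq[of "fst B" "snd B" \<Omega> T0, unfolded prod.collapse,
          OF B(1) translate_closed T0 B(2)]) (assumption, rule that)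
  obtain R2 e2 where 2: "0 < e2" "\<And>T w. T \<in> \<Omega> \<Longrightarrow> norm w < e2 \<Longrightarrow> patch (T \<ominus> w) 0 R2 = patch T0 0 R2 \<Longrightarrow>
      T \<in> flow_box C \<and> flow_coordinate C T = flow_coordinate C T0 - w"
    by (rule flow_coordinate_patch_eq[of "fst C" "snd C" \<Omega> T0, unfolded prod.collapse,
          OF C(1) translate_closed T0 C(2)]) (assumption, rule that)
  define R where "R = max R1 R2"
  have "0 < min \<epsilon> (min e1 e2)" using \<epsilon> 1(1) 2(1) by simp
  then obtain N where N: "openin X N" "T0 \<in> N" "N \<subseteq> \<Omega>"
    "\<And>T. T \<in> N \<Longrightarrow> \<exists>w. norm w < min \<epsilon> (min e1 e2) \<and> patch (T \<ominus> w) 0 R = patch T0 0 R"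
    using nbhd_patch_eq[OF flc T0, of "min \<epsilon> (min e1 e2)" R] by blast
  show ?thesis
  proof (rule that[OF N(1,2)])
    fix T assume T: "T \<in> N"
    then obtain w where w: "norm w < min \<epsilon> (min e1 e2)" "patch (T \<ominus> w) 0 R = patch T0 0 R"
      using N(4) by blast
    have "patch (T \<ominus> w) 0 R1 = patch T0 0 R1" "patch (T \<ominus> w) 0 R2 = patch T0 0 R2"
      by (rule patch_eq_mono[OF w(2)], simp add: R_def)+
    with 1(2) 2(2) T N(3) w(1) show "T \<in> flow_box B \<and> T \<in> flow_box C \<and>
      (\<exists>w. norm w < \<epsilon> \<and> flow_coordinate B T = flow_coordinate B T0 - w \<and>
           flow_coordinate C T = flow_coordinate C T0 - w)"
      by (auto intro!: exI[of _ w])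
  qed
qed

end


section \<open>Cech cocycles with a primitive\<close>

lemma locally_constant_on_const: "locally_constant_on Z (S :: 'a set) (\<lambda>_. c)" if "S \<subseteq> topspace Z"
  using that unfolding locally_constant_on_def by (auto simp: constant_on_def)

text \<open>A primitive is a family of functions, not necessarily locally constant, on the members of the
  cover. On a member \<open>W k\<close> of the common refinement, the old primitive minus the cochain \<open>b k\<close> is one for
  the new cocycle; the cocycle identity extends it to all of \<open>V j\<close>. Both corrections are locally
  constant.\<close>

lemma cech_primitive_transport:
  fixes Z :: "'a topology" and g :: "'i \<Rightarrow> 'i \<Rightarrow> 'a \<Rightarrow> 'v::ab_group_add" and h :: "'j \<Rightarrow> 'j \<Rightarrow> 'a \<Rightarrow> 'v"
  assumes coh: "cech_cohomologous Z (I, U, g) (J, V, h)" and coc: "cech_cocycle Z (J, V, h)"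
    and c: "\<And>i j x. i \<in> I \<Longrightarrow> j \<in> I \<Longrightarrow> x \<in> U i \<Longrightarrow> x \<in> U j \<Longrightarrow> g i j x = c i x - c j x"
  obtains d where "\<And>i j x. i \<in> J \<Longrightarrow> j \<in> J \<Longrightarrow> x \<in> V i \<Longrightarrow> x \<in> V j \<Longrightarrow> h i j x = d i x - d j x"
    "\<And>j x. j \<in> J \<Longrightarrow> x \<in> V j \<Longrightarrow> \<exists>i\<in>I. \<exists>N k. openin Z N \<and> x \<in> N \<and> N \<subseteq> U i \<and> N \<subseteq> V j \<and>
        (\<forall>y\<in>N. d j y = c i y + k)"
proof -
  obtain K W r s b where cover: "open_cover Z (K :: 'a set) W"
    and K: "\<forall>k\<in>K. r k \<in> I \<and> W k \<subseteq> U (r k) \<and> s k \<in> J \<and> W k \<subseteq> V (s k) \<and>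
               locally_constant_on Z (W k) (b k)"
    and gh: "\<forall>k\<in>K. \<forall>l\<in>K. \<forall>x\<in>W k \<inter> W l.
           g (r k) (r l) x - h (s k) (s l) x = b k x - b l x"
    using coh unfolding cech_cohomologous_def prod.case by blast
  note K = K[rule_format]
  have V: "\<And>j. j \<in> J \<Longrightarrow> openin Z (V j)"
    and lc: "\<And>i j. i \<in> J \<Longrightarrow> j \<in> J \<Longrightarrow> locally_constant_on Z (V i \<inter> V j) (h i j)"
    and h: "\<And>i j k x. i \<in> J \<Longrightarrow> j \<in> J \<Longrightarrow> k \<in> J \<Longrightarrow> x \<in> V i \<Longrightarrow> x \<in> V j \<Longrightarrow> x \<in> V k \<Longrightarrow>
        h i j x + h j k x = h i k x"
    using coc unfolding cech_cocycle_def open_cover_def by auto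
  define \<kappa> where "\<kappa> x = (SOME k. k \<in> K \<and> x \<in> W k)" for x
  have \<kappa>: "\<kappa> x \<in> K" "x \<in> W (\<kappa> x)" if "x \<in> topspace Z" for x
  proof -
    have "\<exists>k. k \<in> K \<and> x \<in> W k" using cover that unfolding open_cover_def by blast
    then have "\<kappa> x \<in> K \<and> x \<in> W (\<kappa> x)" unfolding \<kappa>_def by (rule someI_ex)
    then show "\<kappa> x \<in> K" "x \<in> W (\<kappa> x)" by auto
  qed
  define d where "d j x = c (r (\<kappa> x)) x - b (\<kappa> x) x + h j (s (\<kappa> x)) x" for j x
  have top: "x \<in> topspace Z" if "j \<in> J" "x \<in> V j" for j x using openin_subset[OF V] that by blast
  have d: "d j x = c (r k) x - b k x + h j (s k) x" if j: "j \<in> J" "x \<in> V j" and k: "k \<in> K" "x \<in> W k" for j k x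
  proof -
    note l = \<kappa>[OF top[OF j]]
    have "x \<in> U (r k)" "x \<in> U (r (\<kappa> x))" using K[OF k(1)] K[OF l(1)] k(2) l(2) by blast+
    then have "g (r k) (r (\<kappa> x)) x = c (r k) x - c (r (\<kappa> x)) x"
      using K[OF k(1)] K[OF l(1)] c by blast
    then have "c (r k) x - c (r (\<kappa> x)) x - h (s k) (s (\<kappa> x)) x = b k x - b (\<kappa> x) x"
      using gh[rule_format, OF k(1) l(1), of x] k(2) l(2) by simp
    then have 1: "c (r k) x = (b k x - b (\<kappa> x) x) + c (r (\<kappa> x)) x + h (s k) (s (\<kappa> x)) x"
      by (simp add: algebra_simps)
    have 2: "h j (s k) x + h (s k) (s (\<kappa> x)) x = h j (s (\<kappa> x)) x"
      using K[OF k(1)] K[OF l(1)] k(2) l(2) j by (intro h) auto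
    show ?thesis unfolding d_def 1 2[symmetric] by (simp add: algebra_simps)
  qed
  show ?thesis
  proof
    fix i j x assume ij: "i \<in> J" "j \<in> J" "x \<in> V i" "x \<in> V j"
    note l = \<kappa>[OF top[OF ij(1,3)]]
    have "h i j x + h j (s (\<kappa> x)) x = h i (s (\<kappa> x)) x" using K[OF l(1)] l(2) ij by (intro h) auto
    then show "h i j x = d i x - d j x" unfolding d_def by (simp add: algebra_simps)
  next
    fix j x assume j: "j \<in> J" "x \<in> V j"
    define k where "k = \<kappa> x"
    have k: "k \<in> K" "x \<in> W k" using \<kappa>[OF top[OF j]] by (auto simp: k_def)
    note Kk = K[OF k(1)]
    obtain N1 where N1: "openin Z N1" "x \<in> N1" "b k constant_on (N1 \<inter> W k)"
      using Kk k(2) unfolding locally_constant_on_def by blast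
    have "x \<in> V j \<inter> V (s k)" using Kk k(2) j(2) by blast
    then obtain N2 where N2: "openin Z N2" "x \<in> N2" "h j (s k) constant_on (N2 \<inter> (V j \<inter> V (s k)))"
      using lc[OF j(1), of "s k"] Kk unfolding locally_constant_on_def by blast
    define N where "N = N1 \<inter> N2 \<inter> W k \<inter> V j"
    have "openin Z (W k)" using cover k(1) by (auto simp: open_cover_def)
    then have N: "openin Z N" "x \<in> N" "N \<subseteq> U (r k)" "N \<subseteq> V j"
      using N1 N2 V[OF j(1)] j k Kk unfolding N_def by auto
    obtain k1 where k1: "\<And>y. y \<in> N \<Longrightarrow> b k y = k1"
      using N1(3) unfolding constant_on_def N_def by blast
    obtain k2 where k2: "\<And>y. y \<in> N \<Longrightarrow> h j (s k) y = k2"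
      using N2(3) Kk unfolding constant_on_def N_def by blast
    have "d j y = c (r k) y + (k2 - k1)" if "y \<in> N" for y
      using d[OF j(1) _ k(1), of y] k1[OF that] k2[OF that] that by (simp add: N_def algebra_simps)
    with N Kk show "\<exists>i\<in>I. \<exists>N k. openin Z N \<and> x \<in> N \<and> N \<subseteq> U i \<and> N \<subseteq> V j \<and> (\<forall>y\<in>N. d j y = c i y + k)"
      by blast
  qed
qed

text \<open>The elements of a class live on covers indexed by points, so the given cover is refined by choosing
  one of its members around each point.\<close>

lemma cech_class_nonempty:
  fixes Z :: "'a topology" and z :: "('i, 'a, 'v::ab_group_add) cech"
  assumes "cech_cocycle Z z"
  shows "cech_class Z z \<noteq> {}"
proof -
  obtain I U g where z: "z = (I, U, g)" by (cases z)
  have U: "\<And>i. i \<in> I \<Longrightarrow> openin Z (U i)" "(\<Union>i\<in>I. U i) = topspace Z"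
    and lc: "\<And>i j. i \<in> I \<Longrightarrow> j \<in> I \<Longrightarrow> locally_constant_on Z (U i \<inter> U j) (g i j)"
    and g: "\<And>i j k x. i \<in> I \<Longrightarrow> j \<in> I \<Longrightarrow> k \<in> I \<Longrightarrow> x \<in> U i \<Longrightarrow> x \<in> U j \<Longrightarrow> x \<in> U k \<Longrightarrow>
        g i j x + g j k x = g i k x"
    using assms unfolding z cech_cocycle_def open_cover_def by auto
  have "\<forall>x\<in>topspace Z. \<exists>i. i \<in> I \<and> x \<in> U i" using U(2) by blast
  then obtain r where r: "\<And>x. x \<in> topspace Z \<Longrightarrow> r x \<in> I \<and> x \<in> U (r x)" by metis
  have cover: "open_cover Z (topspace Z) (\<lambda>x. U (r x))"
    unfolding open_cover_def using r U(1) openin_subset by blast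
  define z' where "z' = (topspace Z, (\<lambda>x. U (r x)), (\<lambda>x y. g (r x) (r y)))"
  have "cech_cocycle Z z'"
    unfolding z'_def cech_cocycle_def using cover r lc g by auto
  moreover have "cech_cohomologous Z z z'"
    unfolding z z'_def cech_cohomologous_def prod.case
  proof (intro exI conjI ballI)
    show "open_cover Z (topspace Z) (\<lambda>x. U (r x))" by (rule cover)
    fix k assume k: "k \<in> topspace Z"
    show "r k \<in> I" "k \<in> topspace Z" "U (r k) \<subseteq> U (r k)" "U (r k) \<subseteq> U (r k)" using r k by auto
    show "locally_constant_on Z (U (r k)) ((\<lambda>_ _. 0) k)"
      using openin_subset[OF U(1)] r[OF k] by (intro locally_constant_on_const) blast
    fix l x
    show "g (r k) (r l) x - g (r k) (r l) x = (\<lambda>_ _. 0) k x - (\<lambda>_ _. 0) l x" by simp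
  qed
  ultimately show ?thesis unfolding cech_class_def by blast
qed

lemma cech_cocycle_pull:
  assumes f: "continuous_map Z Y f" and z: "cech_cocycle Y z"
  shows "cech_cocycle Z (cech_pull_cocycle Z f z)"
proof -
  obtain I U g where z': "z = (I, U, g)" by (cases z)
  have U: "\<And>i. i \<in> I \<Longrightarrow> openin Y (U i)" "(\<Union>i\<in>I. U i) = topspace Y"
    and lc: "\<And>i j. i \<in> I \<Longrightarrow> j \<in> I \<Longrightarrow> locally_constant_on Y (U i \<inter> U j) (g i j)"
    and g: "\<forall>i\<in>I. \<forall>j\<in>I. \<forall>k\<in>I. \<forall>x\<in>U i \<inter> U j \<inter> U k. g i j x + g j k x = g i k x"
    using z unfolding z' cech_cocycle_def open_cover_def by auto
  have pre: "openin Z {x \<in> topspace Z. f x \<in> N}" if "openin Y N" for N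
    using f that by (simp add: continuous_map_def)
  have fY: "f x \<in> topspace Y" if "x \<in> topspace Z" for x using f that by (auto simp: continuous_map_def)
  let ?V = "\<lambda>i. {x \<in> topspace Z. f x \<in> U i}"
  have "open_cover Z I ?V"
    unfolding open_cover_def
  proof
    show "\<forall>i\<in>I. openin Z (?V i)" using pre U(1) by blast
    show "(\<Union>i\<in>I. ?V i) = topspace Z" using fY U(2) by blast
  qed
  moreover have "locally_constant_on Z (?V i \<inter> ?V j) (\<lambda>x. g i j (f x))" if ij: "i \<in> I" "j \<in> I" for i j
    unfolding locally_constant_on_def
  proof
    fix x assume x: "x \<in> ?V i \<inter> ?V j"
    then obtain N where N: "openin Y N" "f x \<in> N" "g i j constant_on (N \<inter> (U i \<inter> U j))"
      using lc[OF ij] unfolding locally_constant_on_def by blast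
    have "(\<lambda>x. g i j (f x)) constant_on ({x \<in> topspace Z. f x \<in> N} \<inter> (?V i \<inter> ?V j))"
      using N(3) unfolding constant_on_def by blast
    with pre[OF N(1)] N(2) x
    show "\<exists>N. openin Z N \<and> x \<in> N \<and> (\<lambda>x. g i j (f x)) constant_on (N \<inter> (?V i \<inter> ?V j))" by blast
  qed
  moreover have "\<forall>i\<in>I. \<forall>j\<in>I. \<forall>k\<in>I. \<forall>x\<in>?V i \<inter> ?V j \<inter> ?V k. g i j (f x) + g j k (f x) = g i k (f x)"
    using g by blast
  ultimately show ?thesis
    unfolding z' cech_pull_cocycle_def cech_cocycle_def prod.case by blast
qed

context compact_tiling_space
begin

lemma shape_cocycle:
  assumes flc: "FLC \<Omega>"
  shows "cech_cocycle X (open_flow_boxes \<Omega>, flow_box, \<lambda>B C T. flow_coordinate B T - flow_coordinate C T)"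
  unfolding cech_cocycle_def prod.case
proof (intro conjI ballI)
  show "open_cover X (open_flow_boxes \<Omega>) flow_box"
    unfolding open_cover_def
  proof
    show "\<forall>B\<in>open_flow_boxes \<Omega>. openin X (flow_box B)" by (auto simp: open_flow_boxes_def)
    show "(\<Union>B\<in>open_flow_boxes \<Omega>. flow_box B) = topspace X"
    proof
      show "(\<Union>B\<in>open_flow_boxes \<Omega>. flow_box B) \<subseteq> topspace X" using flow_box_subset by auto
      show "topspace X \<subseteq> (\<Union>B\<in>open_flow_boxes \<Omega>. flow_box B)"
      proof
        fix T assume "T \<in> topspace X"
        then have "T \<in> \<Omega>" by simp
        from flow_boxes_cover[OF flc this] show "T \<in> (\<Union>B\<in>open_flow_boxes \<Omega>. flow_box B)" by blast
      qed
    qed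
  qed
  fix B C assume BC: "B \<in> open_flow_boxes \<Omega>" "C \<in> open_flow_boxes \<Omega>"
  show "locally_constant_on X (flow_box B \<inter> flow_box C) (\<lambda>T. flow_coordinate B T - flow_coordinate C T)"
    unfolding locally_constant_on_def
  proof
    fix T0 assume "T0 \<in> flow_box B \<inter> flow_box C"
    then have T0: "T0 \<in> flow_box B" "T0 \<in> flow_box C" by auto
    obtain N where N: "openin X N" "T0 \<in> N" "\<And>T. T \<in> N \<Longrightarrow> T \<in> flow_box B \<and> T \<in> flow_box C \<and>
      (\<exists>w. norm w < 1 \<and> flow_coordinate B T = flow_coordinate B T0 - w \<and>
           flow_coordinate C T = flow_coordinate C T0 - w)"
      by (rule flow_coordinate_local[OF flc BC(1) T0(1) BC(2) T0(2) zero_less_one]) (rule that)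
    have "flow_coordinate B T - flow_coordinate C T = flow_coordinate B T0 - flow_coordinate C T0"
      if "T \<in> N" for T
      using N(3)[OF that] by force
    then have "(\<lambda>T. flow_coordinate B T - flow_coordinate C T) constant_on (N \<inter> (flow_box B \<inter> flow_box C))"
      unfolding constant_on_def by blast
    with N show "\<exists>N. openin X N \<and> T0 \<in> N \<and>
        (\<lambda>T. flow_coordinate B T - flow_coordinate C T) constant_on (N \<inter> (flow_box B \<inter> flow_box C))"
      by blast
  qed
qed simp

lemma shape_class_eq:
  "shape_class \<Omega> = cech_class X (open_flow_boxes \<Omega>, flow_box, \<lambda>B C T. flow_coordinate B T - flow_coordinate C T)"
  unfolding shape_class_def cech_class_of_cocycle_def flow_coordinate_def ..

lemma strong_class_nonempty:
  assumes flc: "FLC \<Omega>" and f: "continuous_map (tiling_topology \<Omega>') X f"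
  shows "strong_class_of_map \<Omega>' \<Omega> f \<noteq> {}"
proof -
  obtain z where z: "z \<in> shape_class \<Omega>"
    using cech_class_nonempty[OF shape_cocycle[OF flc]] unfolding shape_class_eq by blast
  then have "cech_cocycle X z" unfolding shape_class_eq cech_class_def by blast
  from cech_class_nonempty[OF cech_cocycle_pull[OF f this]] z show ?thesis
    unfolding strong_class_of_map_def cech_pullback_def by blast
qed

text \<open>The primitive is transported twice: from the flow boxes of \<open>\<Omega>\<close> to a representative \<open>z\<close> of the shape
  class and, after composition with \<open>f\<close>, from the pullback of \<open>z\<close> to the given cocycle.\<close>

lemma strong_class_primitive:
  assumes f: "continuous_map (tiling_topology \<Omega>') X f" and y: "(J, V, h) \<in> strong_class_of_map \<Omega>' \<Omega> f"
  obtains e where "\<And>i j T. i \<in> J \<Longrightarrow> j \<in> J \<Longrightarrow> T \<in> V i \<Longrightarrow> T \<in> V j \<Longrightarrow> h i j T = e i T - e j T"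
    "\<And>j T. j \<in> J \<Longrightarrow> T \<in> V j \<Longrightarrow> \<exists>B\<in>open_flow_boxes \<Omega>. \<exists>N k. openin (tiling_topology \<Omega>') N \<and> T \<in> N \<and>
        N \<subseteq> V j \<and> (\<forall>S\<in>N. f S \<in> flow_box B \<and> e j S = flow_coordinate B (f S) + k)"
proof -
  let ?X' = "tiling_topology \<Omega>'"
  obtain z where z: "z \<in> shape_class \<Omega>" "(J, V, h) \<in> cech_class ?X' (cech_pull_cocycle ?X' f z)"
    using y unfolding strong_class_of_map_def cech_pullback_def by blast
  obtain I U g where z': "z = (I, U, g)" by (cases z)
  have zc: "cech_cocycle X (I, U, g)" "cech_cohomologous X (open_flow_boxes \<Omega>, flow_box,
      \<lambda>B C T. flow_coordinate B T - flow_coordinate C T) (I, U, g)"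
    using z(1) unfolding z' shape_class_eq cech_class_def by auto
  obtain d where d: "\<And>i j x. i \<in> I \<Longrightarrow> j \<in> I \<Longrightarrow> x \<in> U i \<Longrightarrow> x \<in> U j \<Longrightarrow> g i j x = d i x - d j x"
    "\<And>j x. j \<in> I \<Longrightarrow> x \<in> U j \<Longrightarrow> \<exists>B\<in>open_flow_boxes \<Omega>. \<exists>N k. openin X N \<and> x \<in> N \<and> N \<subseteq> flow_box B \<and>
        N \<subseteq> U j \<and> (\<forall>y\<in>N. d j y = flow_coordinate B y + k)"
    by (rule cech_primitive_transport[OF zc(2,1) refl]) (rule that)
  let ?W = "\<lambda>i. {x \<in> topspace ?X'. f x \<in> U i}"
  have yc: "cech_cocycle ?X' (J, V, h)" "cech_cohomologous ?X' (I, ?W, \<lambda>i j x. g i j (f x)) (J, V, h)"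
    using z(2) unfolding z' cech_class_def cech_pull_cocycle_def by auto
  have gd: "g i j (f x) = d i (f x) - d j (f x)"
    if "i \<in> I" "j \<in> I" "x \<in> ?W i" "x \<in> ?W j" for i j x using that d(1) by blast
  obtain e where e: "\<And>i j x. i \<in> J \<Longrightarrow> j \<in> J \<Longrightarrow> x \<in> V i \<Longrightarrow> x \<in> V j \<Longrightarrow> h i j x = e i x - e j x"
    "\<And>j x. j \<in> J \<Longrightarrow> x \<in> V j \<Longrightarrow> \<exists>i\<in>I. \<exists>N k. openin ?X' N \<and> x \<in> N \<and> N \<subseteq> ?W i \<and>
        N \<subseteq> V j \<and> (\<forall>y\<in>N. e j y = d i (f y) + k)"
    by (rule cech_primitive_transport[OF yc(2,1), of "\<lambda>i x. d i (f x)", OF gd]) (assumption+, rule that)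
  show ?thesis
  proof (rule that[OF e(1)])
    fix j T assume j: "j \<in> J" "T \<in> V j"
    obtain i N k where i: "i \<in> I" "openin ?X' N" "T \<in> N" "N \<subseteq> ?W i" "N \<subseteq> V j"
      "\<And>y. y \<in> N \<Longrightarrow> e j y = d i (f y) + k"
      using e(2)[OF j] by blast
    then have fT: "f T \<in> U i" by blast
    obtain B N' k' where B: "B \<in> open_flow_boxes \<Omega>" "openin X N'" "f T \<in> N'" "N' \<subseteq> flow_box B"
      "\<And>y. y \<in> N' \<Longrightarrow> d i y = flow_coordinate B y + k'"
      using d(2)[OF i(1) fT] by blast
    define M where "M = N \<inter> {S \<in> topspace ?X'. f S \<in> N'}"
    have "openin ?X' {S \<in> topspace ?X'. f S \<in> N'}" using f B(2) by (simp add: continuous_map_def)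
    then have "openin ?X' M" using i(2) unfolding M_def by blast
    moreover have "T \<in> M" "M \<subseteq> V j" using i(3,4,5) B(3) unfolding M_def by blast+
    moreover have "f S \<in> flow_box B \<and> e j S = flow_coordinate B (f S) + (k' + k)" if "S \<in> M" for S
      using that i(6)[of S] B(4) B(5)[of "f S"] by (auto simp: M_def)
    ultimately show "\<exists>B\<in>open_flow_boxes \<Omega>. \<exists>N k. openin ?X' N \<and> T \<in> N \<and> N \<subseteq> V j \<and>
        (\<forall>S\<in>N. f S \<in> flow_box B \<and> e j S = flow_coordinate B (f S) + k)"
      using B(1) by blast
  qed
qed

end

text \<open>The function by which two primitives of one Cech cocycle differ has this shape, when one comes
  from the flow coordinate on \<open>\<Omega>1\<close> and the other from that on \<open>\<Omega>2\<close>.\<close>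

definition coordinate_difference ::
    "('d::finite, 'l::metric_space) tiling set \<Rightarrow> ('d, 'm::metric_space) tiling set \<Rightarrow>
     ('d, 'n::metric_space) tiling set \<Rightarrow> (('d, 'l) tiling \<Rightarrow> ('d, 'm) tiling) \<Rightarrow>
     (('d, 'l) tiling \<Rightarrow> ('d, 'n) tiling) \<Rightarrow> (('d, 'l) tiling \<Rightarrow> real^'d) \<Rightarrow> bool" where
  "coordinate_difference \<Omega> \<Omega>1 \<Omega>2 h1 h2 s \<longleftrightarrow>
     (\<forall>T0\<in>\<Omega>. \<exists>B\<in>open_flow_boxes \<Omega>1. \<exists>C\<in>open_flow_boxes \<Omega>2. \<exists>N k.
        openin (tiling_topology \<Omega>) N \<and> T0 \<in> N \<and>
        (\<forall>T\<in>N. h1 T \<in> flow_box B \<and> h2 T \<in> flow_box C \<and>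
           s T = flow_coordinate B (h1 T) - flow_coordinate C (h2 T) + k))"

lemma flow_coordinate_difference_if_strong_class_eq:
  fixes h1 :: "('d::finite, 'l::metric_space) tiling \<Rightarrow> ('d, 'm::metric_space) tiling"
    and h2 :: "('d, 'l) tiling \<Rightarrow> ('d, 'n::metric_space) tiling"
  assumes \<Omega>1: "compact_tiling_space \<Omega>1" "FLC \<Omega>1" and \<Omega>2: "compact_tiling_space \<Omega>2"
    and h1: "continuous_map (tiling_topology \<Omega>) (tiling_topology \<Omega>1) h1"
    and h2: "continuous_map (tiling_topology \<Omega>) (tiling_topology \<Omega>2) h2"
    and eq: "strong_class_of_map \<Omega> \<Omega>1 h1 = strong_class_of_map \<Omega> \<Omega>2 h2"
  obtains s where "coordinate_difference \<Omega> \<Omega>1 \<Omega>2 h1 h2 s"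
proof -
  let ?X = "tiling_topology \<Omega>"
  obtain y where "y \<in> strong_class_of_map \<Omega> \<Omega>1 h1"
    using compact_tiling_space.strong_class_nonempty[OF \<Omega>1 h1] by blast
  then obtain J V h where y1: "(J, V, h) \<in> strong_class_of_map \<Omega> \<Omega>1 h1" by (cases y) blast
  then have y2: "(J, V, h) \<in> strong_class_of_map \<Omega> \<Omega>2 h2" using eq by simp
  have "cech_cocycle ?X (J, V, h)"
    using y1 unfolding strong_class_of_map_def cech_pullback_def cech_class_def by blast
  then have cover: "(\<Union>j\<in>J. V j) = \<Omega>" by (simp add: cech_cocycle_def open_cover_def)
  obtain e1 where e1: "\<And>i j T. i \<in> J \<Longrightarrow> j \<in> J \<Longrightarrow> T \<in> V i \<Longrightarrow> T \<in> V j \<Longrightarrow> h i j T = e1 i T - e1 j T"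
    "\<And>j T. j \<in> J \<Longrightarrow> T \<in> V j \<Longrightarrow> \<exists>B\<in>open_flow_boxes \<Omega>1. \<exists>N k. openin ?X N \<and> T \<in> N \<and>
        N \<subseteq> V j \<and> (\<forall>S\<in>N. h1 S \<in> flow_box B \<and> e1 j S = flow_coordinate B (h1 S) + k)"
    by (rule compact_tiling_space.strong_class_primitive[OF \<Omega>1(1) h1 y1]) (rule that)
  obtain e2 where e2: "\<And>i j T. i \<in> J \<Longrightarrow> j \<in> J \<Longrightarrow> T \<in> V i \<Longrightarrow> T \<in> V j \<Longrightarrow> h i j T = e2 i T - e2 j T"
    "\<And>j T. j \<in> J \<Longrightarrow> T \<in> V j \<Longrightarrow> \<exists>B\<in>open_flow_boxes \<Omega>2. \<exists>N k. openin ?X N \<and> T \<in> N \<and>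
        N \<subseteq> V j \<and> (\<forall>S\<in>N. h2 S \<in> flow_box B \<and> e2 j S = flow_coordinate B (h2 S) + k)"
    by (rule compact_tiling_space.strong_class_primitive[OF \<Omega>2(1) h2 y2]) (rule that)
  define \<iota> where "\<iota> T = (SOME j. j \<in> J \<and> T \<in> V j)" for T
  define s where "s T = e1 (\<iota> T) T - e2 (\<iota> T) T" for T
  have s: "s T = e1 j T - e2 j T" if "j \<in> J" "T \<in> V j" for j T
  proof -
    have "\<exists>j. j \<in> J \<and> T \<in> V j" using that by blast
    then have "\<iota> T \<in> J \<and> T \<in> V (\<iota> T)" unfolding \<iota>_def by (rule someI_ex)
    then have "e1 (\<iota> T) T - e1 j T = e2 (\<iota> T) T - e2 j T"
      using e1(1)[of "\<iota> T" j T] e2(1)[of "\<iota> T" j T] that by simp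
    then show ?thesis by (simp add: s_def algebra_simps)
  qed
  have "coordinate_difference \<Omega> \<Omega>1 \<Omega>2 h1 h2 s"
    unfolding coordinate_difference_def
  proof
    fix T0 assume "T0 \<in> \<Omega>"
    then obtain j where j: "j \<in> J" "T0 \<in> V j" using cover by blast
    obtain B N1 k1 where B: "B \<in> open_flow_boxes \<Omega>1" "openin ?X N1" "T0 \<in> N1" "N1 \<subseteq> V j"
      "\<And>S. S \<in> N1 \<Longrightarrow> h1 S \<in> flow_box B \<and> e1 j S = flow_coordinate B (h1 S) + k1"
      using e1(2)[OF j] by blast
    obtain C N2 k2 where C: "C \<in> open_flow_boxes \<Omega>2" "openin ?X N2" "T0 \<in> N2" "N2 \<subseteq> V j"
      "\<And>S. S \<in> N2 \<Longrightarrow> h2 S \<in> flow_box C \<and> e2 j S = flow_coordinate C (h2 S) + k2"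
      using e2(2)[OF j] by blast
    have "h1 T \<in> flow_box B \<and> h2 T \<in> flow_box C \<and>
         s T = flow_coordinate B (h1 T) - flow_coordinate C (h2 T) + (k1 - k2)" if "T \<in> N1 \<inter> N2" for T
      using B(5)[of T] C(5)[of T] that s[OF j(1), of T] B(4) by auto
    moreover have "openin ?X (N1 \<inter> N2)" using B(2) C(2) by blast
    ultimately show "\<exists>B\<in>open_flow_boxes \<Omega>1. \<exists>C\<in>open_flow_boxes \<Omega>2. \<exists>N k. openin ?X N \<and> T0 \<in> N \<and>
      (\<forall>T\<in>N. h1 T \<in> flow_box B \<and> h2 T \<in> flow_box C \<and>
         s T = flow_coordinate B (h1 T) - flow_coordinate C (h2 T) + k)"
      using B(1,3) C(1,3) by blast
  qed
  then show ?thesis by (rule that)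
qed


section \<open>From the strong class to a cobounding function\<close>

lemma (in compact_tiling_space) small_translation:
  assumes "openin X N" "T \<in> N"
  obtains e where "0 < e" "\<And>v. norm v < e \<Longrightarrow> T \<ominus> v \<in> N"
proof -
  let ?W = "{z \<in> topspace (prod_topology X euclidean). (\<lambda>(T, v). T \<ominus> v) z \<in> N}"
  have T: "T \<in> \<Omega>" using openin_subset[OF assms(1)] assms(2) by auto
  have "openin (prod_topology X euclidean) ?W"
    using continuous_translation assms(1) unfolding continuous_map_def by blast
  moreover have "(T, 0) \<in> ?W" using T assms(2) by simp
  ultimately obtain e where e: "0 < e"
    "\<And>T' v'. T' \<in> \<Omega> \<Longrightarrow> eps_close e T T' \<Longrightarrow> norm (0 - v') < e \<Longrightarrow> (T', v') \<in> ?W"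
    by (rule open_prod_close) (rule that)
  have "T \<ominus> v \<in> N" if "norm v < e" for v
    using e(2)[OF T eps_close_refl[OF e(1)], of v] that by simp
  with e(1) that show ?thesis by blast
qed

text \<open>For small \<open>v\<close> the displacement is so small that the image of \<open>T - v\<close> stays in the box, in the same
  plaque.\<close>

lemma (in orbit_map) flow_coordinate_displacement:
  assumes T: "T \<in> \<Omega>" and B: "B \<in> open_flow_boxes \<Omega>'" "h T \<in> flow_box B"
  obtains \<eta> where "0 < \<eta>" "\<And>v. norm v < \<eta> \<Longrightarrow>
    flow_coordinate B (h (T \<ominus> v)) = flow_coordinate B (h T) + displacement h T v"
proof -
  obtain \<Xi> \<epsilon> where B': "B = (\<Xi>, \<epsilon>)" by (cases B)
  let ?c = "flow_coordinate B (h T)"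
  have "norm ?c < \<epsilon>" using flow_coordinate(1)[OF B[unfolded B']] by (simp add: B')
  then have "0 < \<epsilon> - norm ?c" by simp
  then obtain \<eta> where \<eta>: "0 < \<eta>" "\<And>T v. T \<in> \<Omega> \<Longrightarrow> norm v < \<eta> \<Longrightarrow> norm (displacement h T v) < \<epsilon> - norm ?c"
    using small_displacement by blast
  have "flow_coordinate B (h (T \<ominus> v)) = ?c + displacement h T v" if "norm v < \<eta>" for v
  proof -
    have "norm (?c + displacement h T v) < \<epsilon>"
      using \<eta>(2)[OF T that] norm_triangle_ineq[of ?c "displacement h T v"] by simp
    then show ?thesis
      unfolding displacement[OF T] B' using B unfolding B' by (intro flow_coordinate_translate)
  qed
  with \<eta>(1) that show ?thesis by blast
qed

text \<open>The defect \<open>\<gamma>\<close> of the coboundary equation is itself a cocycle and vanishes for small vectors, so it is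
  locally constant along every line through the origin; at the origin it is \<open>0\<close>.\<close>

lemma cobounding_if_coordinate_difference:
  assumes h1: "orbit_map \<Omega> \<Omega>1 h1" and h2: "orbit_map \<Omega> \<Omega>2 h2" and flc: "FLC \<Omega>1" "FLC \<Omega>2"
    and diff: "coordinate_difference \<Omega> \<Omega>1 \<Omega>2 h1 h2 s"
  shows "continuous_map (tiling_topology \<Omega>) euclidean s"
    and "\<And>T v. T \<in> \<Omega> \<Longrightarrow> displacement h1 T v - displacement h2 T v = s (T \<ominus> v) - s T"
proof -
  interpret h1: orbit_map \<Omega> \<Omega>1 h1 by (rule h1)
  interpret h2: orbit_map \<Omega> \<Omega>2 h2 by (rule h2)
  note s = bspec[OF diff[unfolded coordinate_difference_def]]
  let ?X = "tiling_topology \<Omega>"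
  show "continuous_map ?X euclidean s"
  proof (rule continuous_map_euclideanI)
    fix T0 and \<epsilon> :: real assume "T0 \<in> topspace ?X" and \<epsilon>: "0 < \<epsilon>"
    then have T0: "T0 \<in> \<Omega>" by simp
    obtain B C N k where B: "B \<in> open_flow_boxes \<Omega>1" and C: "C \<in> open_flow_boxes \<Omega>2"
      and N: "openin ?X N" "T0 \<in> N" "\<forall>T\<in>N. h1 T \<in> flow_box B \<and> h2 T \<in> flow_box C \<and>
         s T = flow_coordinate B (h1 T) - flow_coordinate C (h2 T) + k"
      using s[OF T0] by blast
    have e2: "0 < \<epsilon>/2" using \<epsilon> by simp
    have box: "h1 T0 \<in> flow_box B" "h2 T0 \<in> flow_box C" using N(2,3) by auto
    obtain N1 where N1: "openin h1.cod.X N1" "h1 T0 \<in> N1" "\<And>T. T \<in> N1 \<Longrightarrow> T \<in> flow_box B \<and> T \<in> flow_box B \<and>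
      (\<exists>w. norm w < \<epsilon>/2 \<and> flow_coordinate B T = flow_coordinate B (h1 T0) - w \<and>
           flow_coordinate B T = flow_coordinate B (h1 T0) - w)"
      by (rule h1.cod.flow_coordinate_local[OF flc(1) B box(1) B box(1) e2]) (rule that)
    obtain N2 where N2: "openin h2.cod.X N2" "h2 T0 \<in> N2" "\<And>T. T \<in> N2 \<Longrightarrow> T \<in> flow_box C \<and> T \<in> flow_box C \<and>
      (\<exists>w. norm w < \<epsilon>/2 \<and> flow_coordinate C T = flow_coordinate C (h2 T0) - w \<and>
           flow_coordinate C T = flow_coordinate C (h2 T0) - w)"
      by (rule h2.cod.flow_coordinate_local[OF flc(2) C box(2) C box(2) e2]) (rule that)
    define U where "U = N \<inter> {T \<in> topspace ?X. h1 T \<in> N1} \<inter> {T \<in> topspace ?X. h2 T \<in> N2}"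
    have "openin ?X {T \<in> topspace ?X. h1 T \<in> N1}" "openin ?X {T \<in> topspace ?X. h2 T \<in> N2}"
      using h1.continuous h2.continuous N1(1) N2(1) unfolding continuous_map_def by blast+
    then have "openin ?X U" using N(1) unfolding U_def by blast
    moreover have "T0 \<in> U" using N(2) N1(2) N2(2) T0 by (simp add: U_def)
    moreover have "dist (s T0) (s T) < \<epsilon>" if TU: "T \<in> U" for T
    proof -
      obtain w1 where w1: "norm w1 < \<epsilon>/2" "flow_coordinate B (h1 T) = flow_coordinate B (h1 T0) - w1"
        using N1(3)[of "h1 T"] TU by (auto simp: U_def)
      obtain w2 where w2: "norm w2 < \<epsilon>/2" "flow_coordinate C (h2 T) = flow_coordinate C (h2 T0) - w2"
        using N2(3)[of "h2 T"] TU by (auto simp: U_def)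
      have "s T0 - s T = w1 - w2" using N(2,3) TU w1(2) w2(2) by (simp add: U_def)
      then show ?thesis using w1(1) w2(1) norm_triangle_ineq4[of w1 w2] by (simp add: dist_norm)
    qed
    ultimately show "\<exists>U. openin ?X U \<and> T0 \<in> U \<and> (\<forall>T\<in>U. dist (s T0) (s T) < \<epsilon>)" by blast
  qed
  define \<gamma> where "\<gamma> T v = displacement h1 T v - displacement h2 T v - (s (T \<ominus> v) - s T)" for T v
  have \<gamma>_add: "\<gamma> T (x + y) = \<gamma> T x + \<gamma> (T \<ominus> x) y" if "T \<in> \<Omega>" for T x y
    using h1.displacement_cocycle[OF that, of x y] h2.displacement_cocycle[OF that, of x y]
    by (simp add: \<gamma>_def algebra_simps)
  have small: "\<exists>\<delta>>0. \<forall>v. norm v < \<delta> \<longrightarrow> \<gamma> T v = 0" if T: "T \<in> \<Omega>" for T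
  proof -
    obtain B C N k where B: "B \<in> open_flow_boxes \<Omega>1" and C: "C \<in> open_flow_boxes \<Omega>2"
      and N: "openin ?X N" "T \<in> N" "\<forall>T\<in>N. h1 T \<in> flow_box B \<and> h2 T \<in> flow_box C \<and>
         s T = flow_coordinate B (h1 T) - flow_coordinate C (h2 T) + k"
      using s[OF T] by blast
    have box: "h1 T \<in> flow_box B" "h2 T \<in> flow_box C" using N(2,3) by auto
    obtain e1 where e1: "0 < e1" "\<And>v. norm v < e1 \<Longrightarrow>
        flow_coordinate B (h1 (T \<ominus> v)) = flow_coordinate B (h1 T) + displacement h1 T v"
      using h1.flow_coordinate_displacement[OF T B box(1)] by blast
    obtain e2 where e2: "0 < e2" "\<And>v. norm v < e2 \<Longrightarrow>
        flow_coordinate C (h2 (T \<ominus> v)) = flow_coordinate C (h2 T) + displacement h2 T v"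
      using h2.flow_coordinate_displacement[OF T C box(2)] by blast
    obtain e3 where e3: "0 < e3" "\<And>v. norm v < e3 \<Longrightarrow> T \<ominus> v \<in> N"
      using h1.dom.small_translation[OF N(1,2)] by blast
    have "\<gamma> T v = 0" if "norm v < min e1 (min e2 e3)" for v
      using N(2,3) e3(2)[of v] e1(2)[of v] e2(2)[of v] that by (simp add: \<gamma>_def)
    moreover have "0 < min e1 (min e2 e3)" using e1(1) e2(1) e3(1) by simp
    ultimately show ?thesis by blast
  qed
  fix T and v :: "real^'a" assume T: "T \<in> \<Omega>"
  have "\<gamma> T (0 *\<^sub>R v) = \<gamma> T (1 *\<^sub>R v)"
  proof (rule connected_local_const[where f = "\<lambda>t. \<gamma> T (t *\<^sub>R v)" and A = "UNIV :: real set"])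
    show "\<forall>a\<in>UNIV. eventually (\<lambda>b. \<gamma> T (a *\<^sub>R v) = \<gamma> T (b *\<^sub>R v)) (at a within UNIV)"
    proof
      fix a :: real
      obtain \<delta> where \<delta>: "0 < \<delta>" "\<And>u. norm u < \<delta> \<Longrightarrow> \<gamma> (T \<ominus> a *\<^sub>R v) u = 0"
        using small[OF h1.dom.translate_closed[OF T]] by blast
      have "((\<lambda>b. (b - a) *\<^sub>R v) \<longlongrightarrow> (a - a) *\<^sub>R v) (at a)" by (intro tendsto_intros)
      then have "eventually (\<lambda>b. norm ((b - a) *\<^sub>R v) < \<delta>) (at a)"
        using \<delta>(1) by (auto dest: tendstoD simp: dist_norm)
      then show "eventually (\<lambda>b. \<gamma> T (a *\<^sub>R v) = \<gamma> T (b *\<^sub>R v)) (at a within UNIV)"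
      proof (rule eventually_mono)
        fix b assume "norm ((b - a) *\<^sub>R v) < \<delta>"
        moreover have "\<gamma> T (b *\<^sub>R v) = \<gamma> T (a *\<^sub>R v) + \<gamma> (T \<ominus> a *\<^sub>R v) ((b - a) *\<^sub>R v)"
          using \<gamma>_add[OF T, of "a *\<^sub>R v" "(b - a) *\<^sub>R v"] by (simp add: algebra_simps)
        ultimately show "\<gamma> T (a *\<^sub>R v) = \<gamma> T (b *\<^sub>R v)" using \<delta>(2) by simp
      qed
    qed
  qed simp_all
  moreover have "\<gamma> T 0 = 0" using small[OF T] by force
  ultimately show "displacement h1 T v - displacement h2 T v = s (T \<ominus> v) - s T" by (simp add: \<gamma>_def)
qed


section \<open>Locality of the factor map\<close>

text \<open>Near \<open>S0\<close>, the map \<open>\<phi>\<close> carries the slice of a flow box with coordinate \<open>c\<close> into the transversal \<open>\<Xi>2\<close>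
  translated by \<open>c + k\<close>. Agreement of \<open>S\<close> and \<open>S'\<close> fixes \<open>c\<close>. Continuity makes the patch of the
  image known up to a small translation, which is unique because returns to \<open>\<Xi>2\<close> are
  separated.\<close>

lemma local_if_respects_transversals:
  fixes \<Omega>1 :: "('d::finite, 'm::metric_space) tiling set" and \<Omega>2 :: "('d, 'n::metric_space) tiling set"
  assumes \<Omega>1: "compact_tiling_space \<Omega>1" and \<Omega>2: "compact_tiling_space \<Omega>2" "FLC \<Omega>2"
    and \<phi>: "continuous_map (tiling_topology \<Omega>1) (tiling_topology \<Omega>2) \<phi>" and S0: "S0 \<in> \<Omega>1"
    and B: "(\<Xi>1, \<epsilon>1) \<in> open_flow_boxes \<Omega>1" and C: "(\<Xi>2, \<epsilon>2) \<in> open_flow_boxes \<Omega>2"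
    and N: "openin (tiling_topology \<Omega>1) N" "S0 \<in> N"
      "\<And>S. S \<in> N \<Longrightarrow> S \<in> flow_box (\<Xi>1, \<epsilon>1) \<and> \<phi> S \<ominus> - (flow_coordinate (\<Xi>1, \<epsilon>1) S + k) \<in> \<Xi>2"
  obtains M R where "openin (tiling_topology \<Omega>1) M" "S0 \<in> M"
    "\<And>S S'. S \<in> M \<Longrightarrow> S' \<in> M \<Longrightarrow> patch S 0 R = patch S' 0 R \<Longrightarrow> patch (\<phi> S) 0 r = patch (\<phi> S') 0 r"
proof -
  interpret \<Omega>1: compact_tiling_space \<Omega>1 by (rule \<Omega>1)
  interpret \<Omega>2: compact_tiling_space \<Omega>2 by (rule \<Omega>2)
  have \<phi>_in: "\<phi> S \<in> \<Omega>2" if "S \<in> \<Omega>1" for S using \<phi> that by (auto simp: continuous_map_def)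
  have "FLC_transversal \<Omega>1 \<Xi>1" "FLC_transversal \<Omega>2 \<Xi>2" and \<epsilon>2: "0 < \<epsilon>2"
    using B C by (simp_all add: open_flow_boxes_def)
  then have ld: "locally_determined \<Omega>1 \<Xi>1" "locally_determined \<Omega>2 \<Xi>2"
    by (simp_all add: locally_determined_if_FLC_transversal)
  obtain R1 where R1: "\<And>T T'. T \<in> \<Omega>1 \<Longrightarrow> T' \<in> \<Omega>1 \<Longrightarrow> patch T 0 R1 = patch T' 0 R1 \<Longrightarrow> T \<in> \<Xi>1 \<longleftrightarrow> T' \<in> \<Xi>1"
    using ld(1) unfolding locally_determined_def by blast
  obtain R2 where R2: "\<And>T T'. T \<in> \<Omega>2 \<Longrightarrow> T' \<in> \<Omega>2 \<Longrightarrow> patch T 0 R2 = patch T' 0 R2 \<Longrightarrow> T \<in> \<Xi>2 \<longleftrightarrow> T' \<in> \<Xi>2"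
    using ld(2) unfolding locally_determined_def by blast
  define \<rho> where "\<rho> = max (r + 1) (\<epsilon>1 + norm k + 1 + R2)"
  define \<tau> where "\<tau> = min 1 (\<epsilon>2/2)"
  have \<tau>: "0 < \<tau>" "\<tau> \<le> 1" "\<tau> \<le> \<epsilon>2/2" using \<epsilon>2 by (auto simp: \<tau>_def)
  obtain L where L: "openin \<Omega>2.X L" "\<phi> S0 \<in> L" "L \<subseteq> \<Omega>2"
    "\<And>T. T \<in> L \<Longrightarrow> \<exists>w. norm w < \<tau> \<and> patch (T \<ominus> w) 0 \<rho> = patch (\<phi> S0) 0 \<rho>"
    using \<Omega>2.nbhd_patch_eq[OF \<Omega>2(2) \<phi>_in[OF S0] \<tau>(1), of \<rho>] by blast
  define M where "M = N \<inter> {S \<in> topspace \<Omega>1.X. \<phi> S \<in> L}"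
  have "openin \<Omega>1.X {S \<in> topspace \<Omega>1.X. \<phi> S \<in> L}" using \<phi> L(1) by (simp add: continuous_map_def)
  then have "openin \<Omega>1.X M" using N(1) unfolding M_def by blast
  moreover have "S0 \<in> M" using N(2) L(2) S0 by (simp add: M_def)
  moreover have "patch (\<phi> S) 0 r = patch (\<phi> S') 0 r"
    if S: "S \<in> M" "S' \<in> M" and eq: "patch S 0 (\<epsilon>1 + R1) = patch S' 0 (\<epsilon>1 + R1)" for S S'
  proof -
    have S\<Omega>: "S \<in> \<Omega>1" "S' \<in> \<Omega>1" using S by (auto simp: M_def)
    have SN: "S \<in> N" "S' \<in> N" using S by (auto simp: M_def)
    define c where "c = flow_coordinate (\<Xi>1, \<epsilon>1) S"
    have c: "norm c < \<epsilon>1" "S \<ominus> -c \<in> \<Xi>1"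
      using flow_coordinate[OF B, of S] N(3)[OF SN(1)] by (simp_all add: c_def)
    have "patch (S \<ominus> -c) 0 R1 = patch (S' \<ominus> -c) 0 R1"
      by (rule patch_eq_translate[OF eq]) (use c(1) in simp)
    then have "S' \<ominus> -c \<in> \<Xi>1"
      using R1[of "S \<ominus> -c" "S' \<ominus> -c"] S\<Omega> \<Omega>1.translate_closed c(2) by blast
    then have c': "flow_coordinate (\<Xi>1, \<epsilon>1) S' = c" by (rule flow_coordinate_eqI[OF B c(1)])
    define q where "q = c + k"
    have q: "norm q < \<epsilon>1 + norm k" using c(1) norm_triangle_ineq[of c k] by (simp add: q_def)
    have slice: "\<phi> S \<ominus> -q \<in> \<Xi>2" "\<phi> S' \<ominus> -q \<in> \<Xi>2"
      using N(3)[OF SN(1)] N(3)[OF SN(2)] c' by (simp_all add: c_def q_def)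
    have base: "\<phi> S0 \<ominus> (-q - w) \<in> \<Xi>2"
      if T: "T \<in> \<Omega>2" "T \<ominus> -q \<in> \<Xi>2" and w: "norm w < \<tau>" "patch (T \<ominus> w) 0 \<rho> = patch (\<phi> S0) 0 \<rho>" for T w
    proof -
      have "norm (-q - w) + R2 \<le> \<rho>"
        using q w(1) \<tau>(2) norm_triangle_ineq4[of "-q" w] by (simp add: \<rho>_def)
      then have "patch (T \<ominus> w \<ominus> (-q - w)) 0 R2 = patch (\<phi> S0 \<ominus> (-q - w)) 0 R2"
        by (rule patch_eq_translate[OF w(2)])
      moreover have "T \<ominus> w \<ominus> (-q - w) = T \<ominus> -q" by simp
      ultimately show ?thesis
        using R2[of "T \<ominus> -q" "\<phi> S0 \<ominus> (-q - w)"] T \<phi>_in[OF S0] \<Omega>2.translate_closed by metis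
    qed
    have SL: "\<phi> S \<in> L" "\<phi> S' \<in> L" using S by (auto simp: M_def)
    obtain w where w: "norm w < \<tau>" "patch (\<phi> S \<ominus> w) 0 \<rho> = patch (\<phi> S0) 0 \<rho>" using L(4)[OF SL(1)] by blast
    obtain w' where w': "norm w' < \<tau>" "patch (\<phi> S' \<ominus> w') 0 \<rho> = patch (\<phi> S0) 0 \<rho>"
      using L(4)[OF SL(2)] by blast
    have "-q - w = -q - w'"
    proof (rule flow_box_returns[OF C])
      show "\<phi> S0 \<ominus> (-q - w) \<in> \<Xi>2" by (rule base[OF \<phi>_in[OF S\<Omega>(1)] slice(1) w])
      show "\<phi> S0 \<ominus> (-q - w') \<in> \<Xi>2" by (rule base[OF \<phi>_in[OF S\<Omega>(2)] slice(2) w'])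
      show "norm (- q - w' - (- q - w)) < \<epsilon>2"
        using w(1) w'(1) \<tau>(3) norm_triangle_ineq4[of w w'] by simp
    qed
    then have "patch (\<phi> S \<ominus> w) 0 \<rho> = patch (\<phi> S' \<ominus> w) 0 \<rho>" using w(2) w'(2) by simp
    moreover have "norm (-w) + r \<le> \<rho>" using w(1) \<tau>(2) by (simp add: \<rho>_def)
    ultimately have "patch (\<phi> S \<ominus> w \<ominus> -w) 0 r = patch (\<phi> S' \<ominus> w \<ominus> -w) 0 r" by (rule patch_eq_translate)
    then show ?thesis by simp
  qed
  ultimately show ?thesis using that by blast
qed

lemma local_derivation_if_coordinate_difference:
  fixes \<Omega> :: "('d::finite, 'l::metric_space) tiling set"
    and \<Omega>1 :: "('d, 'm::metric_space) tiling set"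
    and \<Omega>2 :: "('d, 'n::metric_space) tiling set"
  assumes h1: "orbit_map \<Omega> \<Omega>1 h1" and h2: "orbit_map \<Omega> \<Omega>2 h2"
    and equiv: "orbit_equivalence \<Omega> \<Omega>1 h1" and flc: "FLC \<Omega>1" "FLC \<Omega>2"
    and diff: "coordinate_difference \<Omega> \<Omega>1 \<Omega>2 h1 h2 s"
    and \<phi>: "factor_map \<Omega>1 \<Omega>2 \<phi>" "\<And>T. T \<in> \<Omega> \<Longrightarrow> \<phi> (h1 T) = h2 T \<ominus> s T"
  shows "local_derivation \<Omega>1 \<Omega>2 \<phi>"
proof -
  interpret h1: orbit_map \<Omega> \<Omega>1 h1 by (rule h1)
  interpret h2: orbit_map \<Omega> \<Omega>2 h2 by (rule h2)
  note s = bspec[OF diff[unfolded coordinate_difference_def]]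
  let ?X = "tiling_topology \<Omega>" and ?X1 = "tiling_topology \<Omega>1"
  have homeo: "homeomorphic_map ?X ?X1 h1" using equiv by (simp add: orbit_equivalence_def)
  then have onto: "h1 ` \<Omega> = \<Omega>1" using homeomorphic_imp_surjective_map by fastforce
  have cont: "continuous_map ?X1 (tiling_topology \<Omega>2) \<phi>" using \<phi>(1) by (simp add: factor_map_def)
  have "\<exists>R>0. \<forall>S\<in>\<Omega>1. \<forall>S'\<in>\<Omega>1. patch S 0 R = patch S' 0 R \<longrightarrow> patch (\<phi> S) 0 r = patch (\<phi> S') 0 r"
    for r :: real
  proof -
    have "\<exists>d>0. \<forall>S\<in>\<Omega>1. \<forall>S'\<in>\<Omega>1. patch S 0 (1/d) = patch S' 0 (1/d) \<longrightarrow>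
        patch (\<phi> S) 0 r = patch (\<phi> S') 0 r"
    proof (rule h1.cod.uniform_if_local)
      fix S0 assume S0: "S0 \<in> \<Omega>1"
      obtain T0 where T0: "T0 \<in> \<Omega>" "S0 = h1 T0" using S0 onto by blast
      obtain B C N k where B: "B \<in> open_flow_boxes \<Omega>1" and C: "C \<in> open_flow_boxes \<Omega>2"
        and N: "openin ?X N" "T0 \<in> N" "\<forall>T\<in>N. h1 T \<in> flow_box B \<and> h2 T \<in> flow_box C \<and>
           s T = flow_coordinate B (h1 T) - flow_coordinate C (h2 T) + k"
        using s[OF T0(1)] by blast
      have C': "(fst C, snd C) \<in> open_flow_boxes \<Omega>2" using C by simp
      have B': "(fst B, snd B) \<in> open_flow_boxes \<Omega>1" using B by simp
      have "openin ?X1 (h1 ` N)"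
        using homeomorphic_imp_open_map[OF homeo] N(1) by (simp add: open_map_def)
      moreover have "S0 \<in> h1 ` N" using T0(2) N(2) by blast
      moreover have "S \<in> flow_box (fst B, snd B) \<and> \<phi> S \<ominus> - (flow_coordinate (fst B, snd B) S + k) \<in> fst C"
        if SN: "S \<in> h1 ` N" for S
      proof -
        obtain T where T: "T \<in> N" "S = h1 T" using SN by blast
        then have "T \<in> \<Omega>" using openin_subset[OF N(1)] by auto
        then have "\<phi> S \<ominus> - (flow_coordinate B S + k) = h2 T \<ominus> - flow_coordinate C (h2 T)"
          using N(3) T \<phi>(2) by simp
        moreover have "h2 T \<ominus> - flow_coordinate C (h2 T) \<in> fst C"
          using flow_coordinate(2)[OF C', of "h2 T"] N(3) T(1) by simp
        ultimately show ?thesis using N(3) T by simp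
      qed
      ultimately obtain M R where M: "openin ?X1 M" "S0 \<in> M"
        "\<And>S S'. S \<in> M \<Longrightarrow> S' \<in> M \<Longrightarrow> patch S 0 R = patch S' 0 R \<Longrightarrow> patch (\<phi> S) 0 r = patch (\<phi> S') 0 r"
        by (rule local_if_respects_transversals[OF h1.cod.compact_tiling_space_axioms
              h2.cod.compact_tiling_space_axioms flc(2) cont S0 B' C']) (assumption, rule that)
      obtain e where e: "0 < e" "\<And>S. S \<in> \<Omega>1 \<Longrightarrow> eps_close e S0 S \<Longrightarrow> S \<in> M"
        using h1.cod.open_close[OF M(1,2)] by blast
      obtain d0 where d0: "0 < d0" "d0 \<le> e" "\<And>T U V. T \<in> \<Omega>1 \<Longrightarrow> U \<in> \<Omega>1 \<Longrightarrow> V \<in> \<Omega>1 \<Longrightarrow>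
          eps_close d0 T U \<Longrightarrow> eps_close d0 U V \<Longrightarrow> eps_close e T V"
        using h1.cod.close_halve[OF e(1)] by blast
      define d where "d = min d0 (1 / max R 1)"
      have d: "0 < d" "d \<le> d0" "d \<le> 1 / max R 1" using d0(1) by (auto simp: d_def)
      have "1 / (1 / max R 1) \<le> 1/d" using d(1,3) by (intro divide_left_mono) auto
      then have R: "R \<le> 1/d" by simp
      have "patch (\<phi> S) 0 r = patch (\<phi> S') 0 r"
        if S: "S \<in> \<Omega>1" "S' \<in> \<Omega>1" "eps_close d S0 S" and eq: "patch S 0 (1/d) = patch S' 0 (1/d)" for S S'
      proof -
        have 1: "eps_close d0 S0 S" using S(3) d(1,2) by (rule eps_close_mono)
        then have "S \<in> M" using e(2)[OF S(1)] d0(1,2) eps_close_mono by blast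
        have "eps_close d S S'"
          using eps_close_if_patch_eq[of S 0 "1/d" S' d] h1.cod.proper[OF S(1)] eq d(1) by simp
        then have "eps_close d0 S S'" using d(1,2) by (rule eps_close_mono)
        then have "S' \<in> M" using e(2)[OF S(2)] d0(3)[OF S0 S(1,2) 1] by blast
        have "patch S 0 R = patch S' 0 R" by (rule patch_eq_mono[OF eq]) (use R in simp)
        then show ?thesis using M(3) \<open>S \<in> M\<close> \<open>S' \<in> M\<close> by blast
      qed
      with d(1) show "\<exists>d>0. \<forall>S\<in>\<Omega>1. eps_close d S0 S \<longrightarrow> (\<forall>S'\<in>\<Omega>1.
          patch S 0 (1/d) = patch S' 0 (1/d) \<longrightarrow> patch (\<phi> S) 0 r = patch (\<phi> S') 0 r)"
        by blast
    next
      fix S and d e :: real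
      assume *: "\<forall>S'\<in>\<Omega>1. patch S 0 (1/e) = patch S' 0 (1/e) \<longrightarrow> patch (\<phi> S) 0 r = patch (\<phi> S') 0 r"
        and d: "0 < d" "d \<le> e"
      have "1/e \<le> 1/d" using d by (simp add: frac_le)
      then have "patch S 0 (1/e) = patch S' 0 (1/e)" if "patch S 0 (1/d) = patch S' 0 (1/d)" for S'
        using patch_eq_mono[OF that, of 0 "1/e"] by simp
      with * show "\<forall>S'\<in>\<Omega>1. patch S 0 (1/d) = patch S' 0 (1/d) \<longrightarrow> patch (\<phi> S) 0 r = patch (\<phi> S') 0 r"
        by blast
    qed
    then obtain d where d: "0 < d" "\<forall>S\<in>\<Omega>1. \<forall>S'\<in>\<Omega>1. patch S 0 (1/d) = patch S' 0 (1/d) \<longrightarrow>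
        patch (\<phi> S) 0 r = patch (\<phi> S') 0 r" by blast
    have "0 < 1/d" using d(1) by simp
    with d(2) show ?thesis by blast
  qed
  then show ?thesis using flc \<phi>(1) by (simp add: local_derivation_def)
qed


section \<open>Equal classes yield factor maps\<close>

theorem theorem10p1:
  fixes \<Omega> :: "('d::finite, 'l::metric_space) tiling set"
    and \<Omega>\<^sub>1 :: "('d, 'm::metric_space) tiling set"
    and \<Omega>\<^sub>2 :: "('d, 'n::metric_space) tiling set"
    and h\<^sub>1 :: "('d, 'l) tiling \<Rightarrow> ('d, 'm) tiling"
    and h\<^sub>2 :: "('d, 'l) tiling \<Rightarrow> ('d, 'n) tiling"
  assumes "tiling_space \<Omega>" "minimal_space \<Omega>" "aperiodic \<Omega>"
    and "tiling_space \<Omega>\<^sub>1" "minimal_space \<Omega>\<^sub>1" "aperiodic \<Omega>\<^sub>1"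
    and "tiling_space \<Omega>\<^sub>2" "minimal_space \<Omega>\<^sub>2" "aperiodic \<Omega>\<^sub>2"
    and "continuous_map (tiling_topology \<Omega>) (tiling_topology \<Omega>\<^sub>1) h\<^sub>1" "h\<^sub>1 ` \<Omega> = \<Omega>\<^sub>1"
    and "continuous_map (tiling_topology \<Omega>) (tiling_topology \<Omega>\<^sub>2) h\<^sub>2" "h\<^sub>2 ` \<Omega> = \<Omega>\<^sub>2"
    and "preserves_orbits \<Omega> h\<^sub>1" "preserves_orbits \<Omega> h\<^sub>2"
    and "orbit_equivalence \<Omega> \<Omega>\<^sub>1 h\<^sub>1"
  shows "(weak_class_of_map \<Omega> h\<^sub>1 = weak_class_of_map \<Omega> h\<^sub>2 \<longrightarrow>
           (\<exists>\<phi>. factor_map \<Omega>\<^sub>1 \<Omega>\<^sub>2 \<phi> \<and>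
                homotopic_with (\<lambda>_. True) (tiling_topology \<Omega>) (tiling_topology \<Omega>\<^sub>2) h\<^sub>2 (\<phi> \<circ> h\<^sub>1))) \<and>
         (FLC \<Omega> \<and> FLC \<Omega>\<^sub>1 \<and> FLC \<Omega>\<^sub>2 \<and>
         strong_class_of_map \<Omega> \<Omega>\<^sub>1 h\<^sub>1 = strong_class_of_map \<Omega> \<Omega>\<^sub>2 h\<^sub>2 \<longrightarrow>
           (\<exists>\<phi>. local_derivation \<Omega>\<^sub>1 \<Omega>\<^sub>2 \<phi> \<and>
                homotopic_with (\<lambda>_. True) (tiling_topology \<Omega>) (tiling_topology \<Omega>\<^sub>2) h\<^sub>2 (\<phi> \<circ> h\<^sub>1)))"
proof -
  have spaces: "compact_tiling_space \<Omega>" "compact_tiling_space \<Omega>\<^sub>1" "compact_tiling_space \<Omega>\<^sub>2"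
    using assms(1,4,7) by (simp_all add: compact_tiling_space_if_tiling_space)
  have h1: "orbit_map \<Omega> \<Omega>\<^sub>1 h\<^sub>1"
    by (intro orbit_map.intro orbit_map_axioms.intro spaces assms(6,10,14))
  have h2: "orbit_map \<Omega> \<Omega>\<^sub>2 h\<^sub>2"
    by (intro orbit_map.intro orbit_map_axioms.intro spaces assms(9,12,15))
  show ?thesis
  proof (intro conjI impI)
    assume "weak_class_of_map \<Omega> h\<^sub>1 = weak_class_of_map \<Omega> h\<^sub>2"
    then obtain s where "continuous_map (tiling_topology \<Omega>) euclidean s"
      "\<And>T v. T \<in> \<Omega> \<Longrightarrow> displacement h\<^sub>1 T v - displacement h\<^sub>2 T v = s (T \<ominus> v) - s T"
      using cohomologous_if_weak_class_eq[OF h1] by blast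
    then obtain \<phi> where "factor_map \<Omega>\<^sub>1 \<Omega>\<^sub>2 \<phi>"
      "homotopic_with (\<lambda>_. True) (tiling_topology \<Omega>) (tiling_topology \<Omega>\<^sub>2) h\<^sub>2 (\<phi> \<circ> h\<^sub>1)"
      using factor_map_if_displacements_cohomologous[OF h1 h2 assms(16,13,8)] by blast
    then show "\<exists>\<phi>. factor_map \<Omega>\<^sub>1 \<Omega>\<^sub>2 \<phi> \<and>
        homotopic_with (\<lambda>_. True) (tiling_topology \<Omega>) (tiling_topology \<Omega>\<^sub>2) h\<^sub>2 (\<phi> \<circ> h\<^sub>1)"
      by blast
  next
    assume "FLC \<Omega> \<and> FLC \<Omega>\<^sub>1 \<and> FLC \<Omega>\<^sub>2 \<and>
      strong_class_of_map \<Omega> \<Omega>\<^sub>1 h\<^sub>1 = strong_class_of_map \<Omega> \<Omega>\<^sub>2 h\<^sub>2"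
    then have flc: "FLC \<Omega>\<^sub>1" "FLC \<Omega>\<^sub>2"
      and eq: "strong_class_of_map \<Omega> \<Omega>\<^sub>1 h\<^sub>1 = strong_class_of_map \<Omega> \<Omega>\<^sub>2 h\<^sub>2" by auto
    obtain s where s: "coordinate_difference \<Omega> \<Omega>\<^sub>1 \<Omega>\<^sub>2 h\<^sub>1 h\<^sub>2 s"
      by (rule flow_coordinate_difference_if_strong_class_eq[OF spaces(2) flc(1) spaces(3) assms(10,12) eq])
        (rule that)
    obtain \<phi> where \<phi>: "factor_map \<Omega>\<^sub>1 \<Omega>\<^sub>2 \<phi>"
      "homotopic_with (\<lambda>_. True) (tiling_topology \<Omega>) (tiling_topology \<Omega>\<^sub>2) h\<^sub>2 (\<phi> \<circ> h\<^sub>1)"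
      "\<And>T. T \<in> \<Omega> \<Longrightarrow> \<phi> (h\<^sub>1 T) = h\<^sub>2 T \<ominus> s T"
      by (rule factor_map_if_displacements_cohomologous[OF h1 h2 assms(16,13,8)
            cobounding_if_coordinate_difference[OF h1 h2 flc s]]) (assumption+, rule that)
    have "local_derivation \<Omega>\<^sub>1 \<Omega>\<^sub>2 \<phi>"
      by (rule local_derivation_if_coordinate_difference[OF h1 h2 assms(16) flc s \<phi>(1,3)])
    with \<phi>(2) show "\<exists>\<phi>. local_derivation \<Omega>\<^sub>1 \<Omega>\<^sub>2 \<phi> \<and>
        homotopic_with (\<lambda>_. True) (tiling_topology \<Omega>) (tiling_topology \<Omega>\<^sub>2) h\<^sub>2 (\<phi> \<circ> h\<^sub>1)"
      by blast
  qed
qed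

end
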